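(* Let $((A,[-,-]_A),(A^*,[-,-]_{A^*}))$ be a Leibniz bialgebra, and let $(D=A\oplus A^*,[-,-]_D)$ be its double Leibniz algebra. Suppose that $\{e_1,\dots,e_n\}$ is a basis of $A$ and $\{e_1^*,\dots,e_n^*\}$ is the dual basis of $A^*$. Set \[ r=\sum_{i=1}^n e_i\otimes e_i^*\in A\otimes A^*\subset D\otimes D. \] Then $(D,[-,-]_D,\Delta_r)$, with $\Delta_r:D\to D\otimes D$ defined by $\Delta_r(u)=F(u)r$ for $u\in D$, is a factorizable Leibniz bialgebra.
   Context: All vector spaces and algebras are finite-dimensional over an algebraically closed field $\mathbb{K}$ of characteristic zero. A (left) Leibniz algebra is a vector space $A$ with a bilinear multiplication $[-,-]_A$ satisfying $[x,[y,z]_A]_A=[[x,y]_A,z]_A+[y,[x,z]_A]_A$. Define $\mathcal{L}_A(x)y=[x,y]_A=\mathcal{R}_A(y)x$ and $\sigma(x\otimes y)=y\otimes x$. For a linear map $f:A\to\mathrm{End}(V)$, $f^*:A\to\mathrm{End}(V^* )$ is defined by $\langle f^*(x)u^*,v\rangle=-\langle u^*,f(x)v\rangle$. A Leibniz coalgebra is a vector space $A$ with a linear map $\Delta:A\to A\otimes A$ such that $(\Delta\otimes\mathrm{id})\Delta+(\sigma\otimes\mathrm{id})(\mathrm{id}\otimes\Delta)\Delta-(\mathrm{id}\otimes\Delta)\Delta=0$. A Leibniz bialgebra is a triple $(A,[-,-]_A,\Delta)$ where $(A,[-,-]_A)$ is a Leibniz algebra, $(A,\Delta)$ is a Leibniz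 coalgebra, and for all $x,y\in A$: \[ \sigma(\mathcal{R}_A(y)\otimes\mathrm{id})\Delta(x)=(\mathcal{R}_A(x)\otimes\mathrm{id})\Delta(y), \] \[ \Delta([x,y]_A)=\big(\mathrm{id}\otimes\mathcal{R}_A(y)-(\mathcal{L}_A+\mathcal{R}_A)(y)\otimes\mathrm{id}\big)(\mathrm{id}+\sigma)\Delta(x)+\big(\mathrm{id}\otimes\mathcal{L}_A(x)+\mathcal{L}_A(x)\otimes\mathrm{id}\big)\Delta(y). \] It is also denoted $((A,[-,-]_A),(A^*,[-,-]_{A^*}))$, where $[-,-]_{A^*}$ is the Leibniz algebra structure on $A^*$ given by $\langle\Delta(x),a^*\otimes b^*\rangle=\langle x,[a^*,b^*]_{A^*}\rangle$. The double Leibniz algebra of a Leibniz bialgebra is $D=A\oplus A^*$ with the (Leibniz) multiplication \[ \begin{aligned} [x+a^*,y+b^*]_D=&[x,y]_A+\mathcal{L}^*_{A^*}(a^* )y-(\mathcal{L}^*_{A^*}+\mathcal{R}^*_{A^*})(b^* )x\\ &+[a^*,b^*]_{A^*}+\mathcal{L}^*_A(x)b^*-(\mathcal{L}^*_A+\mathcal{R}^*_A)(y)a^*, \end{aligned} \] where $(A^* )^*$ is identified with $A$. For a Leibniz algebra $(B,[-,-]_B)$ put $F(x)=(\mathcal{L}_B+\mathcal{R}_B)(x)\otimes\mathrm{id}-\mathrm{id}\otimes\mathcal{R}_B(x)\in\mathrm{End}(B\otimes B)$. For $r=\sum_i a_i\otimes b_i\in B\otimes B$ put $[[r,r]]=\sum_{i,j}\big([a_i,a_j]_B\otimes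 b_i\otimes b_j-a_i\otimes([b_i,a_j]_B+[a_j,b_i]_B)\otimes b_j+a_i\otimes a_j\otimes[b_j,b_i]_B\big)$. If $[[r,r]]=0$ (i.e. $r$ solves the classical Leibniz Yang-Baxter equation) and $F(x)(r-\sigma(r))=0$ for all $x\in B$, then $(B,[-,-]_B,\Delta_r)$ with $\Delta_r(x)=F(x)r$ (which is then a Leibniz bialgebra) is called a quasi-triangular Leibniz bialgebra. It is called factorizable if moreover $T_{r-\sigma(r)}:B^*\to B$ is a linear isomorphism, where for $s\in B\otimes B$ the map $T_s:B^*\to B$ is given by $\langle T_s(a^* ),b^*\rangle=\langle s,a^*\otimes b^*\rangle$. *)

theory Defs
  imports
    "HOL-Computational_Algebra.Polynomial"
    "HOL-Library.Function_Algebras"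
    "HOL-Analysis.Product_Vector"
begin

text \<open>
  A finite-dimensional vector space is a subspace \<open>V\<close> (the carrier) of an ambient vector space given
  by an additive group type and a scalar multiplication \<open>s\<close>. Carriers are needed because the dual
  space depends on \<open>s\<close> and hence cannot be a type. Maps are total functions of which only the
  values on the carrier matter.
\<close>

section \<open>Linear algebra on carriers\<close>

locale findim_space = vector_space scale
  for scale :: "'k::field \<Rightarrow> 'a::ab_group_add \<Rightarrow> 'a" +
  fixes V :: "'a set"
  assumes finitely_spanned: "\<exists>B. finite B \<and> V = span B"

definition linear_on ::
  "('k \<Rightarrow> 'a \<Rightarrow> 'a) \<Rightarrow> 'a set \<Rightarrow> ('k \<Rightarrow> 'b \<Rightarrow> 'b) \<Rightarrow> 'b set \<Rightarrow> ('a::plus \<Rightarrow> 'b::plus) \<Rightarrow> bool"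
  where "linear_on s V t W f \<longleftrightarrow>
    (\<forall>x\<in>V. f x \<in> W) \<and>
    (\<forall>x\<in>V. \<forall>y\<in>V. f (x + y) = f x + f y) \<and>
    (\<forall>c. \<forall>x\<in>V. f (s c x) = t c (f x))"

definition bilinear_on ::
  "('k \<Rightarrow> 'a \<Rightarrow> 'a) \<Rightarrow> 'a set \<Rightarrow> ('k \<Rightarrow> 'b \<Rightarrow> 'b) \<Rightarrow> 'b set \<Rightarrow> ('a::plus \<Rightarrow> 'a \<Rightarrow> 'b::plus) \<Rightarrow> bool"
  where "bilinear_on s V t W f \<longleftrightarrow>
    (\<forall>x\<in>V. linear_on s V t W (\<lambda>y. f x y)) \<and> (\<forall>y\<in>V. linear_on s V t W (\<lambda>x. f x y))"

definition fun_scale :: "'k::times \<Rightarrow> ('x \<Rightarrow> 'k) \<Rightarrow> ('x \<Rightarrow> 'k)"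
  where "fun_scale c f = (\<lambda>x. c * f x)"

text \<open>Functionals on \<open>V\<close> are normalized to be 0 outside \<open>V\<close>, so that equal functionals are equal functions.\<close>

definition dual_space :: "('k::field \<Rightarrow> 'a::ab_group_add \<Rightarrow> 'a) \<Rightarrow> 'a set \<Rightarrow> ('a \<Rightarrow> 'k) set"
  where "dual_space s V = {u. linear_on s V (*) UNIV u \<and> (\<forall>x. x \<notin> V \<longrightarrow> u x = 0)}"

text \<open>The canonical map from \<open>V\<close> to its bidual, and its inverse (for finite-dimensional \<open>V\<close>).\<close>

definition to_bidual ::
  "('k::field \<Rightarrow> 'a::ab_group_add \<Rightarrow> 'a) \<Rightarrow> 'a set \<Rightarrow> 'a \<Rightarrow> (('a \<Rightarrow> 'k) \<Rightarrow> 'k)"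
  where "to_bidual s V x = (\<lambda>u. if u \<in> dual_space s V then u x else 0)"

definition of_bidual ::
  "('k::field \<Rightarrow> 'a::ab_group_add \<Rightarrow> 'a) \<Rightarrow> 'a set \<Rightarrow> (('a \<Rightarrow> 'k) \<Rightarrow> 'k) \<Rightarrow> 'a"
  where "of_bidual s V = inv_into V (to_bidual s V)"

section \<open>Tensors\<close>

text \<open>
  \<open>x \<otimes> y\<close> is realized as the evaluation \<open>\<beta> \<mapsto> \<beta> x y\<close> on bilinear forms, and \<open>V \<otimes> V\<close> as the span
  of these functionals in the dual of the space of bilinear forms; the universal property is proved
  below (\<open>tensor_square_universal\<close>). Elements of \<open>V \<otimes> V \<otimes> V\<close> are likewise functionals of trilinear forms,
  so no associativity isomorphism is needed. In this model a map out of a tensor product acts by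
  \<open>t \<mapsto> t (\<lambda>x y. \<dots>)\<close>, where the dots tell what happens to \<open>x \<otimes> y\<close>. Tensors are 0 on arguments that
  are not multilinear on \<open>V\<close>.
\<close>

abbreviation bilinear_form ::
  "('k::field \<Rightarrow> 'a::ab_group_add \<Rightarrow> 'a) \<Rightarrow> 'a set \<Rightarrow> ('a \<Rightarrow> 'a \<Rightarrow> 'k) \<Rightarrow> bool"
  where "bilinear_form s V \<equiv> bilinear_on s V (*) UNIV"

definition trilinear_form ::
  "('k::field \<Rightarrow> 'a::ab_group_add \<Rightarrow> 'a) \<Rightarrow> 'a set \<Rightarrow> ('a \<Rightarrow> 'a \<Rightarrow> 'a \<Rightarrow> 'k) \<Rightarrow> bool"
  where "trilinear_form s V \<gamma> \<longleftrightarrow>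
    (\<forall>x\<in>V. bilinear_form s V (\<lambda>y z. \<gamma> x y z)) \<and>
    (\<forall>y\<in>V. bilinear_form s V (\<lambda>x z. \<gamma> x y z))"

type_synonym ('k, 'a) tensor2 = "('a \<Rightarrow> 'a \<Rightarrow> 'k) \<Rightarrow> 'k"
type_synonym ('k, 'a) tensor3 = "('a \<Rightarrow> 'a \<Rightarrow> 'a \<Rightarrow> 'k) \<Rightarrow> 'k"

definition tensor ::
  "('k::field \<Rightarrow> 'a::ab_group_add \<Rightarrow> 'a) \<Rightarrow> 'a set \<Rightarrow> 'a \<Rightarrow> 'a \<Rightarrow> ('k, 'a) tensor2"
  where "tensor s V x y = (\<lambda>\<beta>. if bilinear_form s V \<beta> then \<beta> x y else 0)"

definition triple_tensor ::
  "('k::field \<Rightarrow> 'a::ab_group_add \<Rightarrow> 'a) \<Rightarrow> 'a set \<Rightarrow> 'a \<Rightarrow> 'a \<Rightarrow> 'a \<Rightarrow> ('k, 'a) tensor3"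
  where "triple_tensor s V x y z = (\<lambda>\<gamma>. if trilinear_form s V \<gamma> then \<gamma> x y z else 0)"

definition tensor_square ::
  "('k::field \<Rightarrow> 'a::ab_group_add \<Rightarrow> 'a) \<Rightarrow> 'a set \<Rightarrow> ('k, 'a) tensor2 set"
  where "tensor_square s V = module.span fun_scale {tensor s V x y | x y. x \<in> V \<and> y \<in> V}"

text \<open>\<open>f \<otimes> g\<close> for endomorphisms \<open>f\<close>, \<open>g\<close> of \<open>V\<close>\<close>

definition tensor_map ::
  "('k::field \<Rightarrow> 'a::ab_group_add \<Rightarrow> 'a) \<Rightarrow> 'a set \<Rightarrow> ('a \<Rightarrow> 'a) \<Rightarrow> ('a \<Rightarrow> 'a) \<Rightarrow>
    ('k, 'a) tensor2 \<Rightarrow> ('k, 'a) tensor2"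
  where "tensor_map s V f g t = (\<lambda>\<beta>. if bilinear_form s V \<beta> then t (\<lambda>x y. \<beta> (f x) (g y)) else 0)"

definition flip :: "('k, 'a) tensor2 \<Rightarrow> ('k, 'a) tensor2"
  where "flip t = (\<lambda>\<beta>. t (\<lambda>x y. \<beta> y x))"

text \<open>\<open>\<sigma> \<otimes> id\<close>\<close>

definition flip12 :: "('k, 'a) tensor3 \<Rightarrow> ('k, 'a) tensor3"
  where "flip12 t = (\<lambda>\<gamma>. t (\<lambda>x y z. \<gamma> y x z))"

text \<open>\<open>\<Delta> \<otimes> id\<close> and \<open>id \<otimes> \<Delta>\<close>\<close>

definition comult_left ::
  "('k::field \<Rightarrow> 'a::ab_group_add \<Rightarrow> 'a) \<Rightarrow> 'a set \<Rightarrow> ('a \<Rightarrow> ('k, 'a) tensor2) \<Rightarrow>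
    ('k, 'a) tensor2 \<Rightarrow> ('k, 'a) tensor3"
  where "comult_left s V \<Delta> t =
    (\<lambda>\<gamma>. if trilinear_form s V \<gamma> then t (\<lambda>x z. \<Delta> x (\<lambda>x1 x2. \<gamma> x1 x2 z)) else 0)"

definition comult_right ::
  "('k::field \<Rightarrow> 'a::ab_group_add \<Rightarrow> 'a) \<Rightarrow> 'a set \<Rightarrow> ('a \<Rightarrow> ('k, 'a) tensor2) \<Rightarrow>
    ('k, 'a) tensor2 \<Rightarrow> ('k, 'a) tensor3"
  where "comult_right s V \<Delta> t =
    (\<lambda>\<gamma>. if trilinear_form s V \<gamma> then t (\<lambda>x y. \<Delta> y (\<lambda>y1 y2. \<gamma> x y1 y2)) else 0)"

text \<open>The pairing \<open>\<langle>t, a \<otimes> b\<rangle>\<close> of a tensor with functionals \<open>a\<close>, \<open>b\<close>\<close>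

definition tensor_pairing :: "('k::times, 'a) tensor2 \<Rightarrow> ('a \<Rightarrow> 'k) \<Rightarrow> ('a \<Rightarrow> 'k) \<Rightarrow> 'k"
  where "tensor_pairing t a b = t (\<lambda>x y. a x * b y)"

text \<open>The map \<open>T\<^sub>t : V\<^sup>* \<rightarrow> V\<close> with \<open>\<langle>T\<^sub>t a, b\<rangle> = \<langle>t, a \<otimes> b\<rangle>\<close>\<close>

definition tensor_to_map ::
  "('k::field \<Rightarrow> 'a::ab_group_add \<Rightarrow> 'a) \<Rightarrow> 'a set \<Rightarrow> ('k, 'a) tensor2 \<Rightarrow> ('a \<Rightarrow> 'k) \<Rightarrow> 'a"
  where "tensor_to_map s V t a =
    of_bidual s V (\<lambda>b. if b \<in> dual_space s V then tensor_pairing t a b else 0)"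

section \<open>Leibniz bialgebras\<close>

definition lmult :: "('a \<Rightarrow> 'a \<Rightarrow> 'a) \<Rightarrow> 'a \<Rightarrow> ('a \<Rightarrow> 'a)"
  where "lmult br x = (\<lambda>y. br x y)"

definition rmult :: "('a \<Rightarrow> 'a \<Rightarrow> 'a) \<Rightarrow> 'a \<Rightarrow> ('a \<Rightarrow> 'a)"
  where "rmult br y = (\<lambda>x. br x y)"

locale leibniz_algebra = findim_space +
  fixes br :: "'b \<Rightarrow> 'b \<Rightarrow> 'b"
  assumes bilinear_br: "bilinear_on scale V scale V br"
    and leibniz: "\<lbrakk>x \<in> V; y \<in> V; z \<in> V\<rbrakk> \<Longrightarrow> br x (br y z) = br (br x y) z + br y (br x z)"

locale leibniz_coalgebra = findim_space +
  fixes \<Delta> :: "'b \<Rightarrow> ('a, 'b) tensor2"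
  assumes linear_comult: "linear_on scale V fun_scale (tensor_square scale V) \<Delta>"
    and coleibniz: "x \<in> V \<Longrightarrow>
      comult_left scale V \<Delta> (\<Delta> x) + flip12 (comult_right scale V \<Delta> (\<Delta> x))
        - comult_right scale V \<Delta> (\<Delta> x) = 0"

locale leibniz_bialgebra = leibniz_algebra scale V br + leibniz_coalgebra scale V \<Delta>
  for scale :: "'k::field \<Rightarrow> 'a::ab_group_add \<Rightarrow> 'a" and V br \<Delta> +
  assumes compat_flip: "\<lbrakk>x \<in> V; y \<in> V\<rbrakk> \<Longrightarrow>
      flip (tensor_map scale V (rmult br y) id (\<Delta> x)) = tensor_map scale V (rmult br x) id (\<Delta> y)"
    and compat_br: "\<lbrakk>x \<in> V; y \<in> V\<rbrakk> \<Longrightarrow>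
      \<Delta> (br x y) =
        tensor_map scale V id (rmult br y) (\<Delta> x + flip (\<Delta> x))
        - tensor_map scale V (lmult br y + rmult br y) id (\<Delta> x + flip (\<Delta> x))
        + (tensor_map scale V id (lmult br x) (\<Delta> y) + tensor_map scale V (lmult br x) id (\<Delta> y))"

section \<open>The double\<close>

text \<open>The bracket on \<open>V\<^sup>*\<close> with \<open>\<langle>x, [a, b]\<rangle> = \<langle>\<Delta> x, a \<otimes> b\<rangle>\<close>\<close>

definition dual_bracket ::
  "'a set \<Rightarrow> ('a \<Rightarrow> ('k::field, 'a) tensor2) \<Rightarrow> ('a \<Rightarrow> 'k) \<Rightarrow> ('a \<Rightarrow> 'k) \<Rightarrow> ('a \<Rightarrow> 'k)"
  where "dual_bracket V \<Delta> a b = (\<lambda>x. if x \<in> V then tensor_pairing (\<Delta> x) a b else 0)"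

text \<open>\<open>f\<^sup>* : V \<rightarrow> End(W\<^sup>*)\<close> for \<open>f : V \<rightarrow> End(W)\<close>, where \<open>\<langle>f\<^sup>* x u, w\<rangle> = - \<langle>u, f x w\<rangle>\<close>\<close>

definition dual_rep :: "'b set \<Rightarrow> ('a \<Rightarrow> 'b \<Rightarrow> 'b) \<Rightarrow> 'a \<Rightarrow> ('b \<Rightarrow> 'k::field) \<Rightarrow> ('b \<Rightarrow> 'k)"
  where "dual_rep W f x u = (\<lambda>w. if w \<in> W then - u (f x w) else 0)"

text \<open>\<open>f\<^sup>*\<close> for \<open>f : V\<^sup>* \<rightarrow> End(V\<^sup>*)\<close>, with the bidual of \<open>V\<close> identified with \<open>V\<close>\<close>

definition dual_rep' ::
  "('k::field \<Rightarrow> 'a::ab_group_add \<Rightarrow> 'a) \<Rightarrow> 'a set \<Rightarrow> (('a \<Rightarrow> 'k) \<Rightarrow> ('a \<Rightarrow> 'k) \<Rightarrow> ('a \<Rightarrow> 'k)) \<Rightarrow>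
    ('a \<Rightarrow> 'k) \<Rightarrow> 'a \<Rightarrow> 'a"
  where "dual_rep' s V f a x = of_bidual s V (dual_rep (dual_space s V) f a (to_bidual s V x))"

definition double_scale ::
  "('k::field \<Rightarrow> 'a::ab_group_add \<Rightarrow> 'a) \<Rightarrow> 'k \<Rightarrow> 'a \<times> ('a \<Rightarrow> 'k) \<Rightarrow> 'a \<times> ('a \<Rightarrow> 'k)"
  where "double_scale s = module_prod.scale s fun_scale"

definition double_space ::
  "('k::field \<Rightarrow> 'a::ab_group_add \<Rightarrow> 'a) \<Rightarrow> 'a set \<Rightarrow> ('a \<times> ('a \<Rightarrow> 'k)) set"
  where "double_space s V = V \<times> dual_space s V"

definition double_bracket ::
  "('k::field \<Rightarrow> 'a::ab_group_add \<Rightarrow> 'a) \<Rightarrow> 'a set \<Rightarrow> ('a \<Rightarrow> 'a \<Rightarrow> 'a) \<Rightarrow> ('a \<Rightarrow> ('k, 'a) tensor2) \<Rightarrow>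
    'a \<times> ('a \<Rightarrow> 'k) \<Rightarrow> 'a \<times> ('a \<Rightarrow> 'k) \<Rightarrow> 'a \<times> ('a \<Rightarrow> 'k)"
  where "double_bracket s V br \<Delta> = (\<lambda>(x, a) (y, b).
    let br' = dual_bracket V \<Delta> in
      (br x y + dual_rep' s V (lmult br') a y
         - (dual_rep' s V (lmult br') b x + dual_rep' s V (rmult br') b x),
       br' a b + dual_rep V (lmult br) x b
         - (dual_rep V (lmult br) y a + dual_rep V (rmult br) y a)))"

section \<open>Quasi-triangular and factorizable Leibniz bialgebras\<close>

text \<open>The operator \<open>F(x)\<close> on \<open>V \<otimes> V\<close>\<close>

definition F_op ::
  "('k::field \<Rightarrow> 'a::ab_group_add \<Rightarrow> 'a) \<Rightarrow> 'a set \<Rightarrow> ('a \<Rightarrow> 'a \<Rightarrow> 'a) \<Rightarrow> 'a \<Rightarrow>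
    ('k, 'a) tensor2 \<Rightarrow> ('k, 'a) tensor2"
  where "F_op s V br x t =
    tensor_map s V (lmult br x + rmult br x) id t - tensor_map s V id (rmult br x) t"

definition coboundary ::
  "('k::field \<Rightarrow> 'a::ab_group_add \<Rightarrow> 'a) \<Rightarrow> 'a set \<Rightarrow> ('a \<Rightarrow> 'a \<Rightarrow> 'a) \<Rightarrow> ('k, 'a) tensor2 \<Rightarrow>
    'a \<Rightarrow> ('k, 'a) tensor2"
  where "coboundary s V br r = (\<lambda>x. F_op s V br x r)"

text \<open>
  \<open>[[r, r]]\<close>. With \<open>r = \<Sum>\<^sub>i a\<^sub>i \<otimes> b\<^sub>i\<close>, the outer \<open>r\<close> binds \<open>(a, b)\<close> to \<open>(a\<^sub>i, b\<^sub>i)\<close> and the inner one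
  binds \<open>(a', b')\<close> to \<open>(a\<^sub>j, b\<^sub>j)\<close>; the usual double sum is recovered in \<open>yang_baxter_sum\<close> below.
\<close>

definition yang_baxter ::
  "('k::field \<Rightarrow> 'a::ab_group_add \<Rightarrow> 'a) \<Rightarrow> 'a set \<Rightarrow> ('a \<Rightarrow> 'a \<Rightarrow> 'a) \<Rightarrow> ('k, 'a) tensor2 \<Rightarrow>
    ('k, 'a) tensor3"
  where "yang_baxter s V br r = (\<lambda>\<gamma>. if trilinear_form s V \<gamma> then
      r (\<lambda>a b. r (\<lambda>a' b'.
        \<gamma> (br a a') b b' - \<gamma> a (br b a' + br a' b) b' + \<gamma> a a' (br b' b)))
    else 0)"

text \<open>
  The predicates take \<open>r\<close> as a parameter and are about the triple \<open>(V, br, \<Delta>\<^sub>r)\<close> with \<open>\<Delta>\<^sub>r(x) = F(x)r\<close>,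
  which is explicitly required to be a Leibniz bialgebra.
\<close>

locale quasi_triangular_leibniz_bialgebra =
  leibniz_bialgebra scale V br "coboundary scale V br r"
  for scale :: "'k::field \<Rightarrow> 'a::ab_group_add \<Rightarrow> 'a" and V br r +
  assumes r_in: "r \<in> tensor_square scale V"
    and yang_baxter: "yang_baxter scale V br r = 0"
    and invariant: "x \<in> V \<Longrightarrow> F_op scale V br x (r - flip r) = 0"

locale factorizable_leibniz_bialgebra = quasi_triangular_leibniz_bialgebra +
  assumes linear_iso:
    "linear_on fun_scale (dual_space scale V) scale V (tensor_to_map scale V (r - flip r))"
    "bij_betw (tensor_to_map scale V (r - flip r)) (dual_space scale V) V"

section \<open>Adequacy of the tensor model\<close>

lemma tensor_map_tensor:
  assumes "linear_on s V s V f" "linear_on s V s V g"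
  shows "tensor_map s V f g (tensor s V x y) = tensor s V (f x) (g y)"
  using assms
  by (auto simp: tensor_map_def tensor_def bilinear_on_def linear_on_def fun_eq_iff)

lemma flip_tensor:
  fixes s :: "'k::field \<Rightarrow> 'a::ab_group_add \<Rightarrow> 'a"
  shows "flip (tensor s V x y) = tensor s V y x"
proof (rule ext)
  fix \<beta> :: "'a \<Rightarrow> 'a \<Rightarrow> 'k"
  have "bilinear_form s V (\<lambda>x y. \<beta> y x) = bilinear_form s V \<beta>"
    by (auto simp: bilinear_on_def)
  then show "flip (tensor s V x y) \<beta> = tensor s V y x \<beta>"
    by (simp add: flip_def tensor_def)
qed

lemma sum_fun_apply: "(\<Sum>i\<in>I. f i) x = (\<Sum>i\<in>I. f i x)"
  by (induction I rule: infinite_finite_induct) auto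

interpretation fun_scale: vector_space "fun_scale :: 'k::field \<Rightarrow> ('x \<Rightarrow> 'k) \<Rightarrow> ('x \<Rightarrow> 'k)"
  by unfold_locales (auto simp: fun_scale_def fun_eq_iff algebra_simps)

theorem tensor_square_universal:
  fixes s :: "'k::field \<Rightarrow> 'a::ab_group_add \<Rightarrow> 'a" and t :: "'k \<Rightarrow> 'z::ab_group_add \<Rightarrow> 'z"
  assumes "vector_space s" "module.subspace s V" "vector_space t"
    and h: "bilinear_on s V t UNIV h"
  shows "\<exists>H. linear_on fun_scale (tensor_square s V) t UNIV H \<and>
      (\<forall>x\<in>V. \<forall>y\<in>V. H (tensor s V x y) = h x y) \<and>
      (\<forall>H'. linear_on fun_scale (tensor_square s V) t UNIV H' \<and>
        (\<forall>x\<in>V. \<forall>y\<in>V. H' (tensor s V x y) = h x y) \<longrightarrow> (\<forall>\<tau>\<in>tensor_square s V. H' \<tau> = H \<tau>))"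
proof -
  interpret T: vector_space t by fact
  interpret P: vector_space_pair t "(*) :: 'k \<Rightarrow> 'k \<Rightarrow> 'k"
    by unfold_locales (simp_all add: algebra_simps)
  let ?lin = "Vector_Spaces.linear t ((*) :: 'k \<Rightarrow> 'k \<Rightarrow> 'k)"
  let ?G = "{tensor s V x y | x y. x \<in> V \<and> y \<in> V}"
  have separate: "z = z'" if "\<And>\<phi>. ?lin \<phi> \<Longrightarrow> \<phi> z = \<phi> z'" for z z'
  proof (rule ccontr)
    assume "z \<noteq> z'"
    then have "T.independent {z - z'}" by simp
    from P.linear_independent_extend[OF this, of "\<lambda>_. 1"]
    obtain \<phi> where \<phi>: "?lin \<phi>" "\<phi> (z - z') = 1" by auto
    from \<phi>(1) have "\<phi> (z - z') = \<phi> z - \<phi> z'"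
      by (simp add: Vector_Spaces.linear_iff_module_hom module_hom.diff)
    with \<phi>(2) that[OF \<phi>(1)] show False by simp
  qed
  have bil: "bilinear_form s V (\<lambda>x y. \<phi> (h x y))" if "?lin \<phi>" for \<phi>
    using h that unfolding bilinear_on_def linear_on_def
    by (auto simp: Vector_Spaces.linear_iff_module_hom module_hom.add module_hom.scale)
  define R where "R \<tau> z \<longleftrightarrow> (\<forall>\<phi>. ?lin \<phi> \<longrightarrow> \<phi> z = \<tau> (\<lambda>x y. \<phi> (h x y)))" for \<tau> z
  have uniq: "z = z'" if "R \<tau> z" "R \<tau> z'" for \<tau> z z'
    by (rule separate) (use that in \<open>metis R_def\<close>)
  have R_tensor: "R (tensor s V x y) (h x y)" for x y
    by (simp add: R_def tensor_def bil)
  have R_add: "R (\<tau> + \<tau>') (z + z')" if "R \<tau> z" "R \<tau>' z'" for \<tau> \<tau>' z z'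
    using that by (simp add: R_def Vector_Spaces.linear_iff_module_hom module_hom.add)
  have R_scale: "R (fun_scale c \<tau>) (t c z)" if "R \<tau> z" for c \<tau> z
    using that by (simp add: R_def Vector_Spaces.linear_iff_module_hom module_hom.scale fun_scale_def)
  have ex: "\<exists>z. R \<tau> z" if "\<tau> \<in> tensor_square s V" for \<tau>
    using that unfolding tensor_square_def
  proof (induction rule: fun_scale.span_induct_alt)
    case base
    have "R 0 0" by (simp add: R_def Vector_Spaces.linear_iff_module_hom module_hom.zero)
    then show ?case ..
  next
    case (step c x y)
    then show ?case using R_tensor R_add R_scale by blast
  qed
  define H where "H \<tau> = (SOME z. R \<tau> z)" for \<tau>
  have H: "R \<tau> (H \<tau>)" if "\<tau> \<in> tensor_square s V" for \<tau>
    unfolding H_def using ex[OF that] by (rule someI_ex)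
  have closed: "\<tau> + \<tau>' \<in> tensor_square s V" "fun_scale c \<tau> \<in> tensor_square s V"
    if "\<tau> \<in> tensor_square s V" "\<tau>' \<in> tensor_square s V" for c \<tau> \<tau>'
    using that by (auto simp: tensor_square_def fun_scale.span_add fun_scale.span_scale)
  have lin_H: "linear_on fun_scale (tensor_square s V) t UNIV H"
    unfolding linear_on_def
  proof (intro conjI ballI allI)
    fix \<tau> \<tau>' c assume \<tau>: "\<tau> \<in> tensor_square s V" and \<tau>': "\<tau>' \<in> tensor_square s V"
    show "H (\<tau> + \<tau>') = H \<tau> + H \<tau>'"
      by (rule uniq[OF H[OF closed(1)[OF \<tau> \<tau>']] R_add[OF H[OF \<tau>] H[OF \<tau>']]])
  next
    fix \<tau> c assume \<tau>: "\<tau> \<in> tensor_square s V"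
    show "H (fun_scale c \<tau>) = t c (H \<tau>)"
      by (rule uniq[OF H[OF closed(2)[OF \<tau> \<tau>]] R_scale[OF H[OF \<tau>]]])
  qed simp
  have gen: "tensor s V x y \<in> tensor_square s V" if "x \<in> V" "y \<in> V" for x y
    unfolding tensor_square_def using that by (blast intro: fun_scale.span_base)
  have H_tensor: "H (tensor s V x y) = h x y" if "x \<in> V" "y \<in> V" for x y
    using H gen R_tensor uniq that by blast
  have "H' \<tau> = H \<tau>" if H': "linear_on fun_scale (tensor_square s V) t UNIV H'"
      "\<forall>x\<in>V. \<forall>y\<in>V. H' (tensor s V x y) = h x y" and \<tau>: "\<tau> \<in> tensor_square s V" for H' \<tau>
  proof -
    have "\<tau> \<in> tensor_square s V \<and> H' \<tau> = H \<tau>"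
      using \<tau> unfolding tensor_square_def
    proof (induction rule: fun_scale.span_induct_alt)
      case base
      have 0: "0 \<in> tensor_square s V" by (simp add: tensor_square_def fun_scale.span_zero)
      have "K 0 = 0" if "linear_on fun_scale (tensor_square s V) t UNIV K" for K
        using that 0 T.scale_zero_left fun_scale.scale_zero_left unfolding linear_on_def by metis
      with 0 H'(1) lin_H show ?case unfolding tensor_square_def[symmetric] by metis
    next
      case (step c g y)
      then obtain u v where g: "g = tensor s V u v" "u \<in> V" "v \<in> V" by auto
      have mem: "g \<in> tensor_square s V" "y \<in> tensor_square s V" "fun_scale c g \<in> tensor_square s V"
        using g gen step closed(2)[of g g] by (auto simp: tensor_square_def)
      have "H' g = H g" using g H'(2) H_tensor by simp
      then have "H' (fun_scale c g + y) = H (fun_scale c g + y)"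
        using H'(1) lin_H mem step unfolding linear_on_def tensor_square_def by simp
      with closed(1)[OF mem(3,2)] show ?case unfolding tensor_square_def[symmetric] by blast
    qed
    then show ?thesis ..
  qed
  with lin_H H_tensor show ?thesis by blast
qed

lemma bilinear_form_sum:
  fixes s :: "'k::field \<Rightarrow> 'a::ab_group_add \<Rightarrow> 'a"
  assumes "\<And>j. j \<in> I \<Longrightarrow> bilinear_form s V (Q j)"
  shows "bilinear_form s V (\<lambda>x y. \<Sum>j\<in>I. Q j x y)"
  using assms unfolding bilinear_on_def linear_on_def by (simp add: sum.distrib sum_distrib_left)

lemma yang_baxter_sum:
  fixes s :: "'k::field \<Rightarrow> 'a::ab_group_add \<Rightarrow> 'a"
  assumes "leibniz_algebra s V br"
    and ab: "\<And>i. i \<in> I \<Longrightarrow> a i \<in> V" "\<And>i. i \<in> I \<Longrightarrow> b i \<in> V"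
    and r: "r = (\<Sum>i\<in>I. tensor s V (a i) (b i))"
  shows "yang_baxter s V br r = (\<Sum>i\<in>I. \<Sum>j\<in>I.
      triple_tensor s V (br (a i) (a j)) (b i) (b j)
      - triple_tensor s V (a i) (br (b i) (a j) + br (a j) (b i)) (b j)
      + triple_tensor s V (a i) (a j) (br (b j) (b i)))"
proof (rule ext)
  fix \<gamma> :: "'a \<Rightarrow> 'a \<Rightarrow> 'a \<Rightarrow> 'k"
  interpret leibniz_algebra s V br by fact
  have V: "x + y \<in> V" "s c x \<in> V" if "x \<in> V" "y \<in> V" for x y c
    using finitely_spanned that by (auto simp: span_add span_scale)
  have br: "br x y \<in> V" "br (x + x') y = br x y + br x' y" "br x (y + y') = br x y + br x y'"
    "br (s c x) y = s c (br x y)" "br x (s c y) = s c (br x y)"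
    if "x \<in> V" "y \<in> V" "x' \<in> V" "y' \<in> V" for x y x' y' c
    using bilinear_br that unfolding bilinear_on_def linear_on_def by auto
  show "yang_baxter s V br r \<gamma> = (\<Sum>i\<in>I. \<Sum>j\<in>I.
      triple_tensor s V (br (a i) (a j)) (b i) (b j)
      - triple_tensor s V (a i) (br (b i) (a j) + br (a j) (b i)) (b j)
      + triple_tensor s V (a i) (a j) (br (b j) (b i))) \<gamma>"
  proof (cases "trilinear_form s V \<gamma>")
    case True
    let ?in = "\<lambda>a b a' b'. \<gamma> (br a a') b b' - \<gamma> a (br b a' + br a' b) b' + \<gamma> a a' (br b' b)"
    have \<gamma>: "\<gamma> (x + x') y z = \<gamma> x y z + \<gamma> x' y z" "\<gamma> x (y + y') z = \<gamma> x y z + \<gamma> x y' z"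
      "\<gamma> x y (z + z') = \<gamma> x y z + \<gamma> x y z'" "\<gamma> (s c x) y z = c * \<gamma> x y z"
      "\<gamma> x (s c y) z = c * \<gamma> x y z" "\<gamma> x y (s c z) = c * \<gamma> x y z"
      if "x \<in> V" "y \<in> V" "z \<in> V" "x' \<in> V" "y' \<in> V" "z' \<in> V" for x y z x' y' z' c
      using True that unfolding trilinear_form_def bilinear_on_def linear_on_def by auto
    have bil: "bilinear_form s V (?in x y)" if "x \<in> V" "y \<in> V" for x y
      unfolding bilinear_on_def linear_on_def using that by (auto simp: V br \<gamma> algebra_simps)
    have inner: "r (?in x y) = (\<Sum>j\<in>I. ?in x y (a j) (b j))" if "x \<in> V" "y \<in> V" for x y
      unfolding r sum_fun_apply using bil[OF that] by (simp add: tensor_def)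
    have "bilinear_form s V (\<lambda>x y. r (?in x y)) \<longleftrightarrow>
        bilinear_form s V (\<lambda>x y. \<Sum>j\<in>I. ?in x y (a j) (b j))"
      unfolding bilinear_on_def linear_on_def by (simp add: inner V)
    moreover have "bilinear_form s V (\<lambda>x y. \<Sum>j\<in>I. ?in x y (a j) (b j))"
    proof (rule bilinear_form_sum)
      fix j assume "j \<in> I"
      then show "bilinear_form s V (\<lambda>x y. ?in x y (a j) (b j))"
        unfolding bilinear_on_def linear_on_def by (auto simp: V br \<gamma> ab algebra_simps)
    qed
    ultimately have "bilinear_form s V (\<lambda>x y. r (?in x y))" by blast
    then have "yang_baxter s V br r \<gamma> = (\<Sum>i\<in>I. r (?in (a i) (b i)))"
      using True unfolding yang_baxter_def by (subst r) (simp add: sum_fun_apply tensor_def)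
    with True show ?thesis
      by (simp add: inner ab sum_fun_apply triple_tensor_def)
  qed (simp add: yang_baxter_def triple_tensor_def sum_fun_apply)
qed

end

theory Submission
  imports Defs
begin

text \<open>
  On \<open>D = A \<oplus> A\<^sup>*\<close> the form \<open>\<omega>(x + a, y + b) = a(y) - b(x)\<close> is skew, nondegenerate and satisfies
  \<open>\<omega>(u, [v, w]) = \<omega>([u, w] + [w, u], v)\<close>; both \<open>A\<close> and \<open>A\<^sup>*\<close> are isotropic subalgebras. By invariance, the
  function \<open>\<omega>(z, [u,[v,w]] - [[u,v],w] - [v,[u,w]])\<close> has enough symmetries to reduce the Leibniz identity
  of \<open>D\<close> to those of \<open>A\<close> and \<open>A\<^sup>*\<close> and to the two compatibility conditions.

  Identify \<open>D\<close> with \<open>D\<^sup>*\<close> by \<open>\<omega>\<close> and let \<open>P\<close>, \<open>Q\<close> be the projections onto \<open>A\<close> and \<open>A\<^sup>*\<close>. Then \<open>r\<close> becomes \<open>Q\<close>, the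
  tensor \<open>r - \<sigma>(r)\<close> becomes the (invariant) inverse of \<open>\<omega>\<close>, and \<open>\<Delta>\<^sub>r\<close> is dual to the bracket
  \<open>[Qp, Qq] - [Pp, Pq]\<close>. All conditions on \<open>\<Delta>\<^sub>r\<close> thus become identities in \<open>D\<close> that follow from
  invariance and the Leibniz identity.
\<close>

section \<open>Tensors as functionals on multilinear forms\<close>

text \<open>The bracket of D is forced: if A and its dual are isotropic subalgebras, invariance of
  \<open>\<omega>\<close> determines every mixed bracket. Invariance is therefore available before
  the Leibniz identity, which is the hard part of the double. By the symmetries only two families of
  scalars must still vanish: the defect of one mixed type, which is the bracket compatibility, and a
  pairing of two anticommutators, which is the flip compatibility.

  For the cobracket, the decisive consequence of the Leibniz identity is that anticommutators
  annihilate from the left, so \<open>\<omega>\<close> vanishes between anticommutators. As A and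
  its dual are subalgebras, Q is a Rota-Baxter operator of weight -1. The bracket dual to the
  cobracket is its descendent bracket [Qp, q] + [p, Qq] - [p, q], and the bracket compatibility
  measures how far left multiplications fail to commute with Q.

  The obstacle is the tensor model: a tensor is a functional on all forms. A finite system of
  coordinate functionals reduces equations to products of linear forms, and every linear form on D
  is some \<open>\<omega> p\<close>.\<close>

text \<open>
  By linearity and locality, these are exactly the elements of \<open>V \<otimes> V\<close> (lemmas \<open>tensorial2_tensor_square\<close>
  and \<open>tensorial2_in_tensor_square\<close>); \<open>tensorial3\<close> plays the role of membership in \<open>V \<otimes> V \<otimes> V\<close>.
\<close>

definition tensorial2 ::
  "('k::field \<Rightarrow> 'a::ab_group_add \<Rightarrow> 'a) \<Rightarrow> 'a set \<Rightarrow> ('k, 'a) tensor2 \<Rightarrow> bool"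
  where "tensorial2 s V t \<longleftrightarrow>
    (\<forall>\<beta>. \<not> bilinear_form s V \<beta> \<longrightarrow> t \<beta> = 0) \<and>
    (\<forall>\<beta> \<beta>'. bilinear_form s V \<beta> \<longrightarrow> bilinear_form s V \<beta>' \<longrightarrow>
      t (\<lambda>x y. \<beta> x y + \<beta>' x y) = t \<beta> + t \<beta>') \<and>
    (\<forall>c \<beta>. bilinear_form s V \<beta> \<longrightarrow> t (\<lambda>x y. c * \<beta> x y) = c * t \<beta>) \<and>
    (\<forall>\<beta> \<beta>'. (\<forall>x\<in>V. \<forall>y\<in>V. \<beta> x y = \<beta>' x y) \<longrightarrow> t \<beta> = t \<beta>')"

definition tensorial3 ::
  "('k::field \<Rightarrow> 'a::ab_group_add \<Rightarrow> 'a) \<Rightarrow> 'a set \<Rightarrow> ('k, 'a) tensor3 \<Rightarrow> bool"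
  where "tensorial3 s V t \<longleftrightarrow>
    (\<forall>\<gamma>. \<not> trilinear_form s V \<gamma> \<longrightarrow> t \<gamma> = 0) \<and>
    (\<forall>\<gamma> \<gamma>'. trilinear_form s V \<gamma> \<longrightarrow> trilinear_form s V \<gamma>' \<longrightarrow>
      t (\<lambda>x y z. \<gamma> x y z + \<gamma>' x y z) = t \<gamma> + t \<gamma>') \<and>
    (\<forall>c \<gamma>. trilinear_form s V \<gamma> \<longrightarrow> t (\<lambda>x y z. c * \<gamma> x y z) = c * t \<gamma>) \<and>
    (\<forall>\<gamma> \<gamma>'. (\<forall>x\<in>V. \<forall>y\<in>V. \<forall>z\<in>V. \<gamma> x y z = \<gamma>' x y z) \<longrightarrow> t \<gamma> = t \<gamma>')"

lemma tensorial2D: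
  assumes "tensorial2 s V t"
  shows "\<not> bilinear_form s V \<beta> \<Longrightarrow> t \<beta> = 0"
    and "bilinear_form s V \<beta> \<Longrightarrow> bilinear_form s V \<beta>' \<Longrightarrow>
      t (\<lambda>x y. \<beta> x y + \<beta>' x y) = t \<beta> + t \<beta>'"
    and "bilinear_form s V \<beta> \<Longrightarrow> t (\<lambda>x y. c * \<beta> x y) = c * t \<beta>"
    and "(\<And>x y. x \<in> V \<Longrightarrow> y \<in> V \<Longrightarrow> \<beta> x y = \<beta>' x y) \<Longrightarrow> t \<beta> = t \<beta>'"
  proof -
  note conj = assms[unfolded tensorial2_def]
  note conj' = conj[THEN conjunct2] and conj'' = conj[THEN conjunct2, THEN conjunct2]
  show "\<not> bilinear_form s V \<beta> \<Longrightarrow> t \<beta> = 0"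
    by (rule conj[THEN conjunct1, rule_format])
  show "bilinear_form s V \<beta> \<Longrightarrow> bilinear_form s V \<beta>' \<Longrightarrow> t (\<lambda>x y. \<beta> x y + \<beta>' x y) = t \<beta> + t \<beta>'"
    by (rule conj'[THEN conjunct1, rule_format])
  show "bilinear_form s V \<beta> \<Longrightarrow> t (\<lambda>x y. c * \<beta> x y) = c * t \<beta>"
    by (rule conj''[THEN conjunct1, rule_format])
  show "(\<And>x y. x \<in> V \<Longrightarrow> y \<in> V \<Longrightarrow> \<beta> x y = \<beta>' x y) \<Longrightarrow> t \<beta> = t \<beta>'"
    by (rule conj''[THEN conjunct2, rule_format])
qed

lemma tensorial3D:
  assumes "tensorial3 s V t"
  shows "\<not> trilinear_form s V \<gamma> \<Longrightarrow> t \<gamma> = 0"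
    and "trilinear_form s V \<gamma> \<Longrightarrow> trilinear_form s V \<gamma>' \<Longrightarrow>
      t (\<lambda>x y z. \<gamma> x y z + \<gamma>' x y z) = t \<gamma> + t \<gamma>'"
    and "trilinear_form s V \<gamma> \<Longrightarrow> t (\<lambda>x y z. c * \<gamma> x y z) = c * t \<gamma>"
    and "(\<And>x y z. x \<in> V \<Longrightarrow> y \<in> V \<Longrightarrow> z \<in> V \<Longrightarrow> \<gamma> x y z = \<gamma>' x y z) \<Longrightarrow> t \<gamma> = t \<gamma>'"
  proof -
  note conj = assms[unfolded tensorial3_def]
  note conj' = conj[THEN conjunct2] and conj'' = conj[THEN conjunct2, THEN conjunct2]
  show "\<not> trilinear_form s V \<gamma> \<Longrightarrow> t \<gamma> = 0"
    by (rule conj[THEN conjunct1, rule_format])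
  show "trilinear_form s V \<gamma> \<Longrightarrow> trilinear_form s V \<gamma>' \<Longrightarrow> t (\<lambda>x y z. \<gamma> x y z + \<gamma>' x y z) = t \<gamma> + t \<gamma>'"
    by (rule conj'[THEN conjunct1, rule_format])
  show "trilinear_form s V \<gamma> \<Longrightarrow> t (\<lambda>x y z. c * \<gamma> x y z) = c * t \<gamma>"
    by (rule conj''[THEN conjunct1, rule_format])
  show "(\<And>x y z. x \<in> V \<Longrightarrow> y \<in> V \<Longrightarrow> z \<in> V \<Longrightarrow> \<gamma> x y z = \<gamma>' x y z) \<Longrightarrow> t \<gamma> = t \<gamma>'"
    by (rule conj''[THEN conjunct2, rule_format])
qed

lemma tensorial2I:
  fixes s :: "'k::field \<Rightarrow> 'a::ab_group_add \<Rightarrow> 'a"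
  assumes "\<And>\<beta>. \<not> bilinear_form s V \<beta> \<Longrightarrow> t \<beta> = 0"
    and "\<And>\<beta> \<beta>'. bilinear_form s V \<beta> \<Longrightarrow> bilinear_form s V \<beta>' \<Longrightarrow>
      t (\<lambda>x y. \<beta> x y + \<beta>' x y) = t \<beta> + t \<beta>'"
    and "\<And>c \<beta>. bilinear_form s V \<beta> \<Longrightarrow> t (\<lambda>x y. c * \<beta> x y) = c * t \<beta>"
    and "\<And>\<beta> \<beta>'. (\<And>x y. x \<in> V \<Longrightarrow> y \<in> V \<Longrightarrow> \<beta> x y = \<beta>' x y) \<Longrightarrow> t \<beta> = t \<beta>'"
  shows "tensorial2 s V t"
  unfolding tensorial2_def by (intro conjI allI impI; rule assms; simp)

lemma tensorial3I:
  fixes s :: "'k::field \<Rightarrow> 'a::ab_group_add \<Rightarrow> 'a"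
  assumes "\<And>\<beta>. \<not> trilinear_form s V \<beta> \<Longrightarrow> t \<beta> = 0"
    and "\<And>\<beta> \<beta>'. trilinear_form s V \<beta> \<Longrightarrow> trilinear_form s V \<beta>' \<Longrightarrow>
      t (\<lambda>x y z. \<beta> x y z + \<beta>' x y z) = t \<beta> + t \<beta>'"
    and "\<And>c \<beta>. trilinear_form s V \<beta> \<Longrightarrow> t (\<lambda>x y z. c * \<beta> x y z) = c * t \<beta>"
    and "\<And>\<beta> \<beta>'. (\<And>x y z. x \<in> V \<Longrightarrow> y \<in> V \<Longrightarrow> z \<in> V \<Longrightarrow> \<beta> x y z = \<beta>' x y z) \<Longrightarrow> t \<beta> = t \<beta>'"
  shows "tensorial3 s V t"
  unfolding tensorial3_def by (intro conjI allI impI; rule assms; simp)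

text \<open>Bilinearity on V only involves sums and multiples that stay in V, so it depends on the
  restriction alone. Since \<open>tensor\<close> is guarded by a test for bilinearity, the locality
  clause of \<open>tensorial2\<close> rests on this.\<close>

lemma bilinear_form_cong:
  fixes s :: "'k::field \<Rightarrow> 'a::ab_group_add \<Rightarrow> 'a"
  assumes "module.subspace s V" "vector_space s"
    and eq: "\<And>x y. x \<in> V \<Longrightarrow> y \<in> V \<Longrightarrow> \<beta> x y = \<beta>' x y"
  shows "bilinear_form s V \<beta> = bilinear_form s V \<beta>'"
proof -
  interpret vector_space s by fact
  have "x + y \<in> V" "s c x \<in> V" if "x \<in> V" "y \<in> V" for x y c
    using assms(1) that by (auto simp: subspace_add subspace_scale)
  then show ?thesis unfolding bilinear_on_def linear_on_def by (simp add: eq)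
qed

lemma bilinear_form_add:
  fixes s :: "'k::field \<Rightarrow> 'a::ab_group_add \<Rightarrow> 'a"
  assumes "bilinear_form s V \<beta>" "bilinear_form s V \<beta>'"
  shows "bilinear_form s V (\<lambda>x y. \<beta> x y + \<beta>' x y)"
  using assms unfolding bilinear_on_def linear_on_def by (simp add: algebra_simps)

lemma bilinear_form_scale:
  fixes s :: "'k::field \<Rightarrow> 'a::ab_group_add \<Rightarrow> 'a"
  assumes "bilinear_form s V \<beta>"
  shows "bilinear_form s V (\<lambda>x y. c * \<beta> x y)"
  using assms unfolding bilinear_on_def linear_on_def by (simp add: algebra_simps)

lemma bilinear_form_swap:
  fixes s :: "'k::field \<Rightarrow> 'a::ab_group_add \<Rightarrow> 'a"
  shows "bilinear_form s V (\<lambda>x y. \<beta> y x) \<longleftrightarrow> bilinear_form s V \<beta>"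
  unfolding bilinear_on_def by auto

lemma bilinear_form_mult:
  fixes s :: "'k::field \<Rightarrow> 'a::ab_group_add \<Rightarrow> 'a"
  assumes "linear_on s V (*) UNIV a" "linear_on s V (*) UNIV b"
  shows "bilinear_form s V (\<lambda>x y. a x * b y)"
  using assms unfolding bilinear_on_def linear_on_def by (simp add: algebra_simps)

lemma bilinear_form_compose:
  fixes s :: "'k::field \<Rightarrow> 'a::ab_group_add \<Rightarrow> 'a"
  assumes "bilinear_form s V \<beta>" "linear_on s V s V f" "linear_on s V s V g"
  shows "bilinear_form s V (\<lambda>x y. \<beta> (f x) (g y))"
  using assms unfolding bilinear_on_def linear_on_def by simp

lemma trilinear_form_add:
  fixes s :: "'k::field \<Rightarrow> 'a::ab_group_add \<Rightarrow> 'a"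
  assumes "trilinear_form s V \<gamma>" "trilinear_form s V \<gamma>'"
  shows "trilinear_form s V (\<lambda>x y z. \<gamma> x y z + \<gamma>' x y z)"
  using assms unfolding trilinear_form_def by (simp add: bilinear_form_add)

lemma trilinear_form_scale:
  fixes s :: "'k::field \<Rightarrow> 'a::ab_group_add \<Rightarrow> 'a"
  assumes "trilinear_form s V \<gamma>"
  shows "trilinear_form s V (\<lambda>x y z. c * \<gamma> x y z)"
  using assms unfolding trilinear_form_def by (simp add: bilinear_form_scale)

lemma trilinear_form_swap:
  fixes s :: "'k::field \<Rightarrow> 'a::ab_group_add \<Rightarrow> 'a"
  shows "trilinear_form s V (\<lambda>x y z. \<gamma> y x z) \<longleftrightarrow> trilinear_form s V \<gamma>"
  unfolding trilinear_form_def by auto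

lemma trilinear_form_mult:
  fixes s :: "'k::field \<Rightarrow> 'a::ab_group_add \<Rightarrow> 'a"
  assumes "linear_on s V (*) UNIV a" "linear_on s V (*) UNIV b" "linear_on s V (*) UNIV c"
  shows "trilinear_form s V (\<lambda>x y z. a x * b y * c z)"
  using assms unfolding trilinear_form_def bilinear_on_def linear_on_def
  by (simp add: algebra_simps)

lemma trilinear_form_fix:
  assumes "trilinear_form s V \<gamma>"
  shows "x \<in> V \<Longrightarrow> bilinear_form s V (\<lambda>y z. \<gamma> x y z)"
    and "y \<in> V \<Longrightarrow> bilinear_form s V (\<lambda>x z. \<gamma> x y z)"
    and "z \<in> V \<Longrightarrow> bilinear_form s V (\<lambda>x y. \<gamma> x y z)"
  using assms unfolding trilinear_form_def bilinear_on_def by auto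

text \<open>Dimension is left open, so that dual spaces and the double are instances before any
  coordinates on them are available.\<close>

locale carrier_space = vector_space scale
  for scale :: "'k::field \<Rightarrow> 'a::ab_group_add \<Rightarrow> 'a" +
  fixes V :: "'a set"
  assumes subspace_V: "subspace V"
begin

lemma V_closed [simp]:
  "0 \<in> V" "x \<in> V \<Longrightarrow> y \<in> V \<Longrightarrow> x + y \<in> V" "x \<in> V \<Longrightarrow> y \<in> V \<Longrightarrow> x - y \<in> V"
  "x \<in> V \<Longrightarrow> - x \<in> V" "x \<in> V \<Longrightarrow> scale c x \<in> V"
  using subspace_V subspace_0 subspace_add subspace_diff subspace_neg subspace_scale by auto

lemma V_sum [simp]: "(\<And>i. i \<in> I \<Longrightarrow> h i \<in> V) \<Longrightarrow> (\<Sum>i\<in>I. h i) \<in> V"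
  using subspace_V subspace_sum by auto

lemma linear_formD:
  assumes "linear_on scale V (*) UNIV h"
  shows "h 0 = 0" "x \<in> V \<Longrightarrow> y \<in> V \<Longrightarrow> h (x + y) = h x + h y"
    "x \<in> V \<Longrightarrow> y \<in> V \<Longrightarrow> h (x - y) = h x - h y"
    "x \<in> V \<Longrightarrow> h (- x) = - h x" "x \<in> V \<Longrightarrow> h (scale c x) = c * h x"
    "(\<And>i. i \<in> I \<Longrightarrow> z i \<in> V) \<Longrightarrow> h (\<Sum>i\<in>I. z i) = (\<Sum>i\<in>I. h (z i))"
proof -
  have add: "h (x + y) = h x + h y" if "x \<in> V" "y \<in> V" for x y
    using assms that unfolding linear_on_def by auto
  have sc: "h (scale c x) = c * h x" if "x \<in> V" for x c
    using assms that unfolding linear_on_def by auto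
  have neg: "h (- x) = - h x" if "x \<in> V" for x
    using sc[OF that, of "-1"] by simp
  show h0: "h 0 = 0" using sc[of 0 0] by simp
  show "h (x + y) = h x + h y" if "x \<in> V" "y \<in> V" using add that .
  show "h (scale c x) = c * h x" if "x \<in> V" using sc that .
  show "h (- x) = - h x" if "x \<in> V" using neg that .
  show "h (x - y) = h x - h y" if "x \<in> V" "y \<in> V"
    using add[of x "- y"] neg[of y] that by simp
  show "h (\<Sum>i\<in>I. z i) = (\<Sum>i\<in>I. h (z i))" if "\<And>i. i \<in> I \<Longrightarrow> z i \<in> V"
    using that by (induction I rule: infinite_finite_induct) (auto simp: h0 add)
qed

lemma bilinear_form_cong_V:
  "(\<And>x y. x \<in> V \<Longrightarrow> y \<in> V \<Longrightarrow> \<beta> x y = \<beta>' x y) \<Longrightarrow>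
    bilinear_form scale V \<beta> = bilinear_form scale V \<beta>'"
  using subspace_V vector_space_axioms by (rule bilinear_form_cong)

lemma trilinear_form_cong:
  assumes "\<And>x y z. x \<in> V \<Longrightarrow> y \<in> V \<Longrightarrow> z \<in> V \<Longrightarrow> \<gamma> x y z = \<gamma>' x y z"
  shows "trilinear_form scale V \<gamma> = trilinear_form scale V \<gamma>'"
proof -
  have "bilinear_form scale V (\<lambda>y z. \<gamma> x y z) = bilinear_form scale V (\<lambda>y z. \<gamma>' x y z)"
    "bilinear_form scale V (\<lambda>y z. \<gamma> y x z) = bilinear_form scale V (\<lambda>y z. \<gamma>' y x z)"
    if "x \<in> V" for x
    using assms that by (intro bilinear_form_cong_V; simp)+
  then show ?thesis unfolding trilinear_form_def by auto
qed

lemma tensorial2_tensor: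
  assumes "x \<in> V" "y \<in> V"
  shows "tensorial2 scale V (tensor scale V x y)"
  unfolding tensorial2_def tensor_def
proof (intro conjI allI impI)
  fix \<beta> \<beta>' :: "'a \<Rightarrow> 'a \<Rightarrow> 'k"
  assume eq: "\<forall>x\<in>V. \<forall>y\<in>V. \<beta> x y = \<beta>' x y"
  then have "bilinear_form scale V \<beta> = bilinear_form scale V \<beta>'"
    by (intro bilinear_form_cong_V) auto
  with eq assms show "(if bilinear_form scale V \<beta> then \<beta> x y else 0) =
      (if bilinear_form scale V \<beta>' then \<beta>' x y else 0)" by simp
qed (auto simp: bilinear_form_add bilinear_form_scale)

lemma tensorial3_triple_tensor:
  assumes "x \<in> V" "y \<in> V" "z \<in> V"
  shows "tensorial3 scale V (triple_tensor scale V x y z)"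
  unfolding tensorial3_def triple_tensor_def
proof (intro conjI allI impI)
  fix \<gamma> \<gamma>' :: "'a \<Rightarrow> 'a \<Rightarrow> 'a \<Rightarrow> 'k"
  assume eq: "\<forall>x\<in>V. \<forall>y\<in>V. \<forall>z\<in>V. \<gamma> x y z = \<gamma>' x y z"
  then have "trilinear_form scale V \<gamma> = trilinear_form scale V \<gamma>'"
    by (intro trilinear_form_cong) auto
  with eq assms show "(if trilinear_form scale V \<gamma> then \<gamma> x y z else 0) =
      (if trilinear_form scale V \<gamma>' then \<gamma>' x y z else 0)" by simp
qed (auto simp: trilinear_form_add trilinear_form_scale)

lemma tensorial2_0: "tensorial2 scale V 0"
  unfolding tensorial2_def by simp

lemma tensorial2_add:
  assumes t: "tensorial2 scale V t" and t': "tensorial2 scale V t'"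
  shows "tensorial2 scale V (t + t')"
proof (rule tensorial2I)
  fix \<beta> \<beta>'
  assume eq: "\<And>x y. x \<in> V \<Longrightarrow> y \<in> V \<Longrightarrow> \<beta> x y = (\<beta>' x y :: 'k)"
  show "(t + t') \<beta> = (t + t') \<beta>'"
    using tensorial2D(4)[OF t eq] tensorial2D(4)[OF t' eq] by (simp add: fun_scale_def)
qed (simp_all add: tensorial2D(1-3)[OF t] tensorial2D(1-3)[OF t'] fun_scale_def algebra_simps)

lemma tensorial2_scale:
  assumes t: "tensorial2 scale V t"
  shows "tensorial2 scale V (fun_scale c t)"
proof (rule tensorial2I)
  fix \<beta> \<beta>'
  assume eq: "\<And>x y. x \<in> V \<Longrightarrow> y \<in> V \<Longrightarrow> \<beta> x y = (\<beta>' x y :: 'k)"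
  show "(fun_scale c t) \<beta> = (fun_scale c t) \<beta>'"
    using tensorial2D(4)[OF t eq] by (simp add: fun_scale_def)
qed (simp_all add: tensorial2D(1-3)[OF t] fun_scale_def algebra_simps)

lemma tensorial2_diff:
  assumes t: "tensorial2 scale V t" and t': "tensorial2 scale V t'"
  shows "tensorial2 scale V (t - t')"
proof (rule tensorial2I)
  fix \<beta> \<beta>'
  assume eq: "\<And>x y. x \<in> V \<Longrightarrow> y \<in> V \<Longrightarrow> \<beta> x y = (\<beta>' x y :: 'k)"
  show "(t - t') \<beta> = (t - t') \<beta>'"
    using tensorial2D(4)[OF t eq] tensorial2D(4)[OF t' eq] by (simp add: fun_scale_def)
qed (simp_all add: tensorial2D(1-3)[OF t] tensorial2D(1-3)[OF t'] fun_scale_def algebra_simps)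

lemma tensorial2_sum:
  "(\<And>i. i \<in> I \<Longrightarrow> tensorial2 scale V (t i)) \<Longrightarrow> tensorial2 scale V (\<Sum>i\<in>I. t i)"
  by (induction I rule: infinite_finite_induct) (auto simp: tensorial2_0 tensorial2_add)

lemma tensorial2_tensor_square:
  assumes "t \<in> tensor_square scale V"
  shows "tensorial2 scale V t"
  using assms unfolding tensor_square_def
proof (induction rule: fun_scale.span_induct_alt)
  case base
  show ?case by (rule tensorial2_0)
next
  case (step c x y)
  then show ?case using tensorial2_add tensorial2_scale tensorial2_tensor by blast
qed

lemma tensorial3_0: "tensorial3 scale V 0"
  unfolding tensorial3_def by simp

lemma tensorial3_add:
  assumes t: "tensorial3 scale V t" and t': "tensorial3 scale V t'"
  shows "tensorial3 scale V (t + t')"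
proof (rule tensorial3I)
  fix \<beta> \<beta>'
  assume eq: "\<And>x y z. x \<in> V \<Longrightarrow> y \<in> V \<Longrightarrow> z \<in> V \<Longrightarrow> \<beta> x y z = (\<beta>' x y z :: 'k)"
  show "(t + t') \<beta> = (t + t') \<beta>'"
    using tensorial3D(4)[OF t eq] tensorial3D(4)[OF t' eq] by (simp add: fun_scale_def)
qed (simp_all add: tensorial3D(1-3)[OF t] tensorial3D(1-3)[OF t'] fun_scale_def algebra_simps)

lemma tensorial3_diff:
  assumes t: "tensorial3 scale V t" and t': "tensorial3 scale V t'"
  shows "tensorial3 scale V (t - t')"
proof (rule tensorial3I)
  fix \<beta> \<beta>'
  assume eq: "\<And>x y z. x \<in> V \<Longrightarrow> y \<in> V \<Longrightarrow> z \<in> V \<Longrightarrow> \<beta> x y z = (\<beta>' x y z :: 'k)"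
  show "(t - t') \<beta> = (t - t') \<beta>'"
    using tensorial3D(4)[OF t eq] tensorial3D(4)[OF t' eq] by (simp add: fun_scale_def)
qed (simp_all add: tensorial3D(1-3)[OF t] tensorial3D(1-3)[OF t'] fun_scale_def algebra_simps)

lemma tensorial3_sum:
  "(\<And>i. i \<in> I \<Longrightarrow> tensorial3 scale V (t i)) \<Longrightarrow> tensorial3 scale V (\<Sum>i\<in>I. t i)"
  by (induction I rule: infinite_finite_induct) (auto simp: tensorial3_0 tensorial3_add)

lemma tensorial2_flip:
  assumes t: "tensorial2 scale V t"
  shows "tensorial2 scale V (flip t)"
proof (rule tensorial2I)
  fix \<beta> \<beta>'
  assume eq: "\<And>x y. x \<in> V \<Longrightarrow> y \<in> V \<Longrightarrow> \<beta> x y = (\<beta>' x y :: 'k)"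
  show "flip t \<beta> = flip t \<beta>'"
    unfolding flip_def by (rule tensorial2D(4)[OF t]) (rule eq)
next
  fix \<beta>
  assume "\<not> bilinear_form scale V \<beta>"
  then have "\<not> bilinear_form scale V (\<lambda>x y. \<beta> y x)" by (subst bilinear_form_swap)
  then show "flip t \<beta> = 0"
    unfolding flip_def by (rule tensorial2D(1)[OF t])
next
  fix \<beta> \<beta>'
  assume "bilinear_form scale V \<beta>" "bilinear_form scale V \<beta>'"
  show "flip t (\<lambda>x y. \<beta> x y + \<beta>' x y) = flip t \<beta> + flip t \<beta>'"
    unfolding flip_def by (rule tensorial2D(2)[OF t]; rule bilinear_form_swap[THEN iffD2]; fact)
next
  fix c \<beta>
  assume "bilinear_form scale V \<beta>"
  show "flip t (\<lambda>x y. c * \<beta> x y) = c * flip t \<beta>"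
    unfolding flip_def by (rule tensorial2D(3)[OF t]; rule bilinear_form_swap[THEN iffD2]; fact)
qed

lemma tensorial3_flip12:
  assumes t: "tensorial3 scale V t"
  shows "tensorial3 scale V (flip12 t)"
proof (rule tensorial3I)
  fix \<beta> \<beta>'
  assume eq: "\<And>x y z. x \<in> V \<Longrightarrow> y \<in> V \<Longrightarrow> z \<in> V \<Longrightarrow> \<beta> x y z = (\<beta>' x y z :: 'k)"
  show "flip12 t \<beta> = flip12 t \<beta>'"
    unfolding flip12_def by (rule tensorial3D(4)[OF t]) (rule eq)
next
  fix \<beta>
  assume "\<not> trilinear_form scale V \<beta>"
  then have "\<not> trilinear_form scale V (\<lambda>x y z. \<beta> y x z)" by (subst trilinear_form_swap)
  then show "flip12 t \<beta> = 0"
    unfolding flip12_def by (rule tensorial3D(1)[OF t])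
next
  fix \<beta> \<beta>'
  assume "trilinear_form scale V \<beta>" "trilinear_form scale V \<beta>'"
  show "flip12 t (\<lambda>x y z. \<beta> x y z + \<beta>' x y z) = flip12 t \<beta> + flip12 t \<beta>'"
    unfolding flip12_def by (rule tensorial3D(2)[OF t]; rule trilinear_form_swap[THEN iffD2]; fact)
next
  fix c \<beta>
  assume "trilinear_form scale V \<beta>"
  show "flip12 t (\<lambda>x y z. c * \<beta> x y z) = c * flip12 t \<beta>"
    unfolding flip12_def by (rule tensorial3D(3)[OF t]; rule trilinear_form_swap[THEN iffD2]; fact)
qed

lemma tensorial2_tensor_map:
  assumes t: "tensorial2 scale V t"
    and f: "linear_on scale V scale V f" and g: "linear_on scale V scale V g"
  shows "tensorial2 scale V (tensor_map scale V f g t)"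
  unfolding tensorial2_def tensor_map_def
proof (intro conjI allI impI)
  fix \<beta> \<beta>' :: "'a \<Rightarrow> 'a \<Rightarrow> 'k"
  assume eq: "\<forall>x\<in>V. \<forall>y\<in>V. \<beta> x y = \<beta>' x y"
  then have "bilinear_form scale V \<beta> = bilinear_form scale V \<beta>'"
    by (intro bilinear_form_cong_V) auto
  moreover have "t (\<lambda>x y. \<beta> (f x) (g y)) = t (\<lambda>x y. \<beta>' (f x) (g y))"
    using f g eq by (intro tensorial2D(4)[OF t]) (auto simp: linear_on_def)
  ultimately show "(if bilinear_form scale V \<beta> then t (\<lambda>x y. \<beta> (f x) (g y)) else 0) =
      (if bilinear_form scale V \<beta>' then t (\<lambda>x y. \<beta>' (f x) (g y)) else 0)" by simp
qed (use f g in \<open>auto simp: bilinear_form_add bilinear_form_scale bilinear_form_compose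
    tensorial2D(2,3)[OF t]\<close>)

lemma comult_formD:
  assumes \<Delta>: "linear_on scale V fun_scale W \<Delta>"
  shows "x \<in> V \<Longrightarrow> y \<in> V \<Longrightarrow> \<Delta> (x + y) \<beta> = \<Delta> x \<beta> + \<Delta> y \<beta>"
    and "x \<in> V \<Longrightarrow> \<Delta> (scale c x) \<beta> = c * \<Delta> x \<beta>"
  using assms unfolding linear_on_def by (auto simp: fun_scale_def)

text \<open>A tensor is 0 on arguments that are not bilinear, so the nested evaluation in
  \<open>comult_left\<close> is meaningful only if the inner value is bilinear in x and z. It is
  linear in x because \<Delta> is, and in z because the tensor \<open>\<Delta> x\<close> is linear
  in its form.\<close>

lemma bilinear_form_comult_left:
  assumes \<Delta>: "linear_on scale V fun_scale W \<Delta>" "\<And>x. x \<in> V \<Longrightarrow> tensorial2 scale V (\<Delta> x)"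
    and \<gamma>: "trilinear_form scale V \<gamma>"
  shows "bilinear_form scale V (\<lambda>x z. \<Delta> x (\<lambda>x1 x2. \<gamma> x1 x2 z))"
proof -
  have "\<Delta> x (\<lambda>x1 x2. \<gamma> x1 x2 (z + z')) = \<Delta> x (\<lambda>x1 x2. \<gamma> x1 x2 z) + \<Delta> x (\<lambda>x1 x2. \<gamma> x1 x2 z')"
    if "x \<in> V" "z \<in> V" "z' \<in> V" for x z z'
  proof -
    have "\<Delta> x (\<lambda>x1 x2. \<gamma> x1 x2 (z + z')) = \<Delta> x (\<lambda>x1 x2. \<gamma> x1 x2 z + \<gamma> x1 x2 z')"
      using \<gamma> that unfolding trilinear_form_def bilinear_on_def linear_on_def
      by (intro tensorial2D(4)[OF \<Delta>(2)]) auto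
    then show ?thesis using tensorial2D(2)[OF \<Delta>(2)] trilinear_form_fix(3)[OF \<gamma>] that by auto
  qed
  moreover have "\<Delta> x (\<lambda>x1 x2. \<gamma> x1 x2 (scale c z)) = c * \<Delta> x (\<lambda>x1 x2. \<gamma> x1 x2 z)"
    if "x \<in> V" "z \<in> V" for x z c
  proof -
    have "\<Delta> x (\<lambda>x1 x2. \<gamma> x1 x2 (scale c z)) = \<Delta> x (\<lambda>x1 x2. c * \<gamma> x1 x2 z)"
      using \<gamma> that unfolding trilinear_form_def bilinear_on_def linear_on_def
      by (intro tensorial2D(4)[OF \<Delta>(2)]) auto
    then show ?thesis using tensorial2D(3)[OF \<Delta>(2)] trilinear_form_fix(3)[OF \<gamma>] that by auto
  qed
  ultimately show ?thesis
    unfolding bilinear_on_def linear_on_def by (simp add: comult_formD[OF \<Delta>(1)])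
qed

lemma tensorial3_comult_left:
  assumes \<Delta>: "linear_on scale V fun_scale W \<Delta>" "\<And>x. x \<in> V \<Longrightarrow> tensorial2 scale V (\<Delta> x)"
    and t: "tensorial2 scale V t"
  shows "tensorial3 scale V (comult_left scale V \<Delta> t)"
proof -
  note bil = bilinear_form_comult_left[OF \<Delta>]
  let ?t = "\<lambda>\<gamma>. t (\<lambda>x z. \<Delta> x (\<lambda>x1 x2. \<gamma> x1 x2 z))"
  have cong: "?t \<gamma> = ?t \<gamma>'"
    if "\<And>x y z. x \<in> V \<Longrightarrow> y \<in> V \<Longrightarrow> z \<in> V \<Longrightarrow> \<gamma> x y z = \<gamma>' x y z" for \<gamma> \<gamma>'
    using that by (intro tensorial2D(4)[OF t] tensorial2D(4)[OF \<Delta>(2)])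
  have add: "?t (\<lambda>x y z. \<gamma> x y z + \<gamma>' x y z) = ?t \<gamma> + ?t \<gamma>'"
    if "trilinear_form scale V \<gamma>" "trilinear_form scale V \<gamma>'" for \<gamma> \<gamma>'
  proof -
    have "?t (\<lambda>x y z. \<gamma> x y z + \<gamma>' x y z) =
        t (\<lambda>x z. \<Delta> x (\<lambda>x1 x2. \<gamma> x1 x2 z) + \<Delta> x (\<lambda>x1 x2. \<gamma>' x1 x2 z))"
      using that by (intro tensorial2D(4)[OF t] tensorial2D(2)[OF \<Delta>(2)] trilinear_form_fix(3))
    then show ?thesis using tensorial2D(2)[OF t bil[OF _ that(1)] bil[OF _ that(2)]] by simp
  qed
  have mult: "?t (\<lambda>x y z. c * \<gamma> x y z) = c * ?t \<gamma>"
    if \<gamma>: "trilinear_form scale V \<gamma>" for c \<gamma>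
  proof -
    have "\<Delta> x (\<lambda>x1 x2. c * \<gamma> x1 x2 z) = c * \<Delta> x (\<lambda>x1 x2. \<gamma> x1 x2 z)"
      if "x \<in> V" "z \<in> V" for x z
      using \<Delta>(2)[OF that(1)] trilinear_form_fix(3)[OF \<gamma> that(2)] by (rule tensorial2D(3))
    then have "?t (\<lambda>x y z. c * \<gamma> x y z) = t (\<lambda>x z. c * \<Delta> x (\<lambda>x1 x2. \<gamma> x1 x2 z))"
      by (rule tensorial2D(4)[OF t])
    then show ?thesis using tensorial2D(3)[OF t bil[OF _ \<gamma>]] by simp
  qed
  have local: "comult_left scale V \<Delta> t \<gamma> = comult_left scale V \<Delta> t \<gamma>'"
    if "\<And>x y z. x \<in> V \<Longrightarrow> y \<in> V \<Longrightarrow> z \<in> V \<Longrightarrow> \<gamma> x y z = \<gamma>' x y z" for \<gamma> \<gamma>'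
  proof -
    have "trilinear_form scale V \<gamma> = trilinear_form scale V \<gamma>'" "?t \<gamma> = ?t \<gamma>'"
      using trilinear_form_cong[of \<gamma> \<gamma>'] cong[of \<gamma> \<gamma>'] that by blast+
    then show ?thesis unfolding comult_left_def by simp
  qed
  show ?thesis
  proof (rule tensorial3I)
    show "comult_left scale V \<Delta> t \<gamma> = comult_left scale V \<Delta> t \<gamma>'"
      if "\<And>x y z. x \<in> V \<Longrightarrow> y \<in> V \<Longrightarrow> z \<in> V \<Longrightarrow> \<gamma> x y z = \<gamma>' x y z" for \<gamma> \<gamma>'
      using that by (rule local)
  qed (simp_all add: comult_left_def trilinear_form_add trilinear_form_scale add mult)
qed

lemma tensorial3_comult_right:
  assumes \<Delta>: "linear_on scale V fun_scale W \<Delta>" "\<And>x. x \<in> V \<Longrightarrow> tensorial2 scale V (\<Delta> x)"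
    and t: "tensorial2 scale V t"
  shows "tensorial3 scale V (comult_right scale V \<Delta> t)"
proof -
  have rot: "trilinear_form scale V (\<lambda>x y z. \<gamma> z x y) \<longleftrightarrow> trilinear_form scale V \<gamma>"
    for \<gamma> :: "'a \<Rightarrow> 'a \<Rightarrow> 'a \<Rightarrow> 'k"
    unfolding trilinear_form_def bilinear_on_def by auto
  let ?L = "comult_left scale V \<Delta> (flip t)"
  \<comment> \<open>Rotating the three arguments of the form and flipping t exchanges the two
    factors on which \<Delta> can act; this transfers the whole claim from
    \<open>comult_left\<close>.\<close>
  have eq: "comult_right scale V \<Delta> t = (\<lambda>\<gamma>. ?L (\<lambda>x y z. \<gamma> z x y))"
    unfolding comult_left_def comult_right_def flip_def by (subst rot) (rule refl)
  have left: "tensorial3 scale V ?L"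
    using \<Delta> tensorial2_flip[OF t] by (rule tensorial3_comult_left)
  show ?thesis
    unfolding eq
  proof (rule tensorial3I)
    fix \<gamma> \<gamma>' :: "'a \<Rightarrow> 'a \<Rightarrow> 'a \<Rightarrow> 'k"
    assume eq: "\<And>x y z. x \<in> V \<Longrightarrow> y \<in> V \<Longrightarrow> z \<in> V \<Longrightarrow> \<gamma> x y z = \<gamma>' x y z"
    show "?L (\<lambda>x y z. \<gamma> z x y) = ?L (\<lambda>x y z. \<gamma>' z x y)"
      by (rule tensorial3D(4)[OF left]) (rule eq)
  next
    fix \<gamma>
    assume "\<not> trilinear_form scale V \<gamma>"
    then have "\<not> trilinear_form scale V (\<lambda>x y z. \<gamma> z x y)" by (subst rot)
    then show "?L (\<lambda>x y z. \<gamma> z x y) = 0"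
      by (rule tensorial3D(1)[OF left])
  next
    fix \<gamma> \<gamma>' :: "'a \<Rightarrow> 'a \<Rightarrow> 'a \<Rightarrow> 'k"
    assume "trilinear_form scale V \<gamma>" "trilinear_form scale V \<gamma>'"
    show "?L (\<lambda>x y z. \<gamma> z x y + \<gamma>' z x y) = ?L (\<lambda>x y z. \<gamma> z x y) + ?L (\<lambda>x y z. \<gamma>' z x y)"
      by (rule tensorial3D(2)[OF left]; rule rot[THEN iffD2]; fact)
  next
    fix c \<gamma>
    assume "trilinear_form scale V \<gamma>"
    show "?L (\<lambda>x y z. c * \<gamma> z x y) = c * ?L (\<lambda>x y z. \<gamma> z x y)"
      by (rule tensorial3D(3)[OF left]; rule rot[THEN iffD2]; fact)
  qed
qed

end

section \<open>Finite coordinates: expansion and separation of tensors\<close>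

locale coordinates = carrier_space +
  fixes I :: "'i set" and f :: "'i \<Rightarrow> 'b" and \<phi> :: "'i \<Rightarrow> 'b \<Rightarrow> 'a"
  assumes finite_I: "finite I"
    and f_in: "k \<in> I \<Longrightarrow> f k \<in> V"
    and linear_coord: "k \<in> I \<Longrightarrow> linear_on scale V (*) UNIV (\<phi> k)"
    and expand: "x \<in> V \<Longrightarrow> (\<Sum>k\<in>I. scale (\<phi> k x) (f k)) = x"
begin

lemma findim: "findim_space scale V"
proof
  have "V \<subseteq> span (f ` I)"
  proof
    fix x assume "x \<in> V"
    have "(\<Sum>k\<in>I. scale (\<phi> k x) (f k)) \<in> span (f ` I)"
      by (intro span_sum span_scale span_base) auto
    then show "x \<in> span (f ` I)" by (simp add: expand \<open>x \<in> V\<close>)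
  qed
  moreover have "span (f ` I) \<subseteq> V" using f_in subspace_V by (intro span_minimal) auto
  ultimately show "\<exists>B. finite B \<and> V = span B" using finite_I by blast
qed

lemma form_expand:
  assumes "linear_on scale V (*) UNIV h" "x \<in> V"
  shows "h x = (\<Sum>k\<in>I. \<phi> k x * h (f k))"
proof -
  have "h x = h (\<Sum>k\<in>I. scale (\<phi> k x) (f k))" using expand assms(2) by simp
  also have "\<dots> = (\<Sum>k\<in>I. \<phi> k x * h (f k))"
    using assms(1) f_in by (subst linear_formD(6)) (auto simp: linear_formD(5))
  finally show ?thesis .
qed

lemma bilinear_expand:
  assumes "bilinear_form scale V \<beta>" "x \<in> V" "y \<in> V"
  shows "\<beta> x y = (\<Sum>k\<in>I. \<Sum>l\<in>I. \<beta> (f k) (f l) * (\<phi> k x * \<phi> l y))"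
proof -
  have "\<beta> x y = (\<Sum>k\<in>I. \<phi> k x * \<beta> (f k) y)"
    using assms form_expand[of "\<lambda>x. \<beta> x y"] unfolding bilinear_on_def by auto
  also have "\<dots> = (\<Sum>k\<in>I. \<phi> k x * (\<Sum>l\<in>I. \<phi> l y * \<beta> (f k) (f l)))"
    using assms f_in form_expand[of "\<beta> (f _)"] unfolding bilinear_on_def
    by (intro sum.cong refl) auto
  finally show ?thesis by (simp add: sum_distrib_left algebra_simps)
qed

lemma trilinear_expand:
  assumes "trilinear_form scale V \<gamma>" "x \<in> V" "y \<in> V" "z \<in> V"
  shows "\<gamma> x y z = (\<Sum>k\<in>I. \<Sum>l\<in>I. \<Sum>m\<in>I. \<gamma> (f k) (f l) (f m) * (\<phi> k x * \<phi> l y * \<phi> m z))"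
proof -
  have "\<gamma> x y z = (\<Sum>k\<in>I. \<phi> k x * \<gamma> (f k) y z)"
    using assms form_expand[of "\<lambda>x. \<gamma> x y z"] unfolding trilinear_form_def bilinear_on_def by auto
  also have "\<dots> = (\<Sum>k\<in>I. \<phi> k x * (\<Sum>l\<in>I. \<Sum>m\<in>I. \<gamma> (f k) (f l) (f m) * (\<phi> l y * \<phi> m z)))"
    using assms f_in bilinear_expand[of "\<gamma> (f _)"] trilinear_form_fix(1)[OF assms(1)]
    by (intro sum.cong refl) auto
  finally show ?thesis by (simp add: sum_distrib_left algebra_simps)
qed

lemma bilinear_form_coord: "k \<in> I \<Longrightarrow> l \<in> I \<Longrightarrow> bilinear_form scale V (\<lambda>x y. \<phi> k x * \<phi> l y)"
  using linear_coord by (intro bilinear_form_mult)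

lemma tensorial2_sum_form:
  assumes t: "tensorial2 scale V t" and "\<And>j. j \<in> J \<Longrightarrow> bilinear_form scale V (Q j)"
  shows "t (\<lambda>x y. \<Sum>j\<in>J. Q j x y) = (\<Sum>j\<in>J. t (Q j))"
proof -
  have z: "t (\<lambda>x y. 0) = 0"
    using tensorial2D(3)[OF t, of "\<lambda>x y. 0" 0] by (simp add: bilinear_on_def linear_on_def)
  show ?thesis
    using assms(2)
    by (induction J rule: infinite_finite_induct)
      (auto simp: z tensorial2D(2)[OF t] bilinear_form_sum)
qed

lemma tensorial2_expand:
  assumes t: "tensorial2 scale V t" and \<beta>: "bilinear_form scale V \<beta>"
  shows "t \<beta> = (\<Sum>k\<in>I. \<Sum>l\<in>I. \<beta> (f k) (f l) * t (\<lambda>x y. \<phi> k x * \<phi> l y))"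
proof -
  have "t \<beta> = t (\<lambda>x y. \<Sum>k\<in>I. \<Sum>l\<in>I. \<beta> (f k) (f l) * (\<phi> k x * \<phi> l y))"
    using bilinear_expand[OF \<beta>] by (intro tensorial2D(4)[OF t])
  also have "\<dots> = (\<Sum>k\<in>I. t (\<lambda>x y. \<Sum>l\<in>I. \<beta> (f k) (f l) * (\<phi> k x * \<phi> l y)))"
    by (intro tensorial2_sum_form t bilinear_form_sum bilinear_form_scale bilinear_form_coord)
  also have "\<dots> = (\<Sum>k\<in>I. \<Sum>l\<in>I. t (\<lambda>x y. \<beta> (f k) (f l) * (\<phi> k x * \<phi> l y)))"
    by (intro sum.cong refl tensorial2_sum_form t bilinear_form_scale bilinear_form_coord)
  also have "\<dots> = (\<Sum>k\<in>I. \<Sum>l\<in>I. \<beta> (f k) (f l) * t (\<lambda>x y. \<phi> k x * \<phi> l y))"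
    by (intro sum.cong refl tensorial2D(3)[OF t] bilinear_form_coord)
  finally show ?thesis .
qed

text \<open>Here finite dimension enters: the values of t on products of coordinate functionals are
  its coefficients with respect to the tensors of the vectors \<open>f k\<close> and
  \<open>f l\<close>.\<close>

lemma tensorial2_in_tensor_square:
  assumes t: "tensorial2 scale V t"
  shows "t \<in> tensor_square scale V"
proof -
  have "t = (\<Sum>k\<in>I. \<Sum>l\<in>I. fun_scale (t (\<lambda>x y. \<phi> k x * \<phi> l y)) (tensor scale V (f k) (f l)))"
  proof
    fix \<beta>
    show "t \<beta> = (\<Sum>k\<in>I. \<Sum>l\<in>I.
        fun_scale (t (\<lambda>x y. \<phi> k x * \<phi> l y)) (tensor scale V (f k) (f l))) \<beta>"
      using tensorial2_expand[OF t] tensorial2D(1)[OF t]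
      by (cases "bilinear_form scale V \<beta>")
        (simp_all add: sum_fun_apply fun_scale_def tensor_def mult.commute)
  qed
  also have "\<dots> \<in> tensor_square scale V"
    unfolding tensor_square_def using f_in
    by (intro fun_scale.span_sum fun_scale.span_scale fun_scale.span_base) blast
  finally show ?thesis .
qed

text \<open>Every bilinear form is a combination of products of coordinate functionals, so these
  products already separate tensors.\<close>

lemma tensorial2_eqI:
  assumes "tensorial2 scale V t" "tensorial2 scale V t'"
    and "\<And>k l. k \<in> I \<Longrightarrow> l \<in> I \<Longrightarrow> t (\<lambda>x y. \<phi> k x * \<phi> l y) = t' (\<lambda>x y. \<phi> k x * \<phi> l y)"
  shows "t = t'"
proof
  fix \<beta> show "t \<beta> = t' \<beta>"
    using tensorial2D(1)[OF assms(1)] tensorial2D(1)[OF assms(2)]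
      tensorial2_expand[OF assms(1)] tensorial2_expand[OF assms(2)] assms(3)
    by (cases "bilinear_form scale V \<beta>") simp_all
qed

lemma trilinear_form_coord:
  "k \<in> I \<Longrightarrow> l \<in> I \<Longrightarrow> m \<in> I \<Longrightarrow> trilinear_form scale V (\<lambda>x y z. \<phi> k x * \<phi> l y * \<phi> m z)"
  using linear_coord by (intro trilinear_form_mult)

lemma trilinear_form_sum:
  "(\<And>j. j \<in> J \<Longrightarrow> trilinear_form scale V (Q j)) \<Longrightarrow>
    trilinear_form scale V (\<lambda>x y z. \<Sum>j\<in>J. Q j x y z)"
  unfolding trilinear_form_def by (simp add: bilinear_form_sum)

lemma tensorial3_sum_form:
  assumes t: "tensorial3 scale V t" and "\<And>j. j \<in> J \<Longrightarrow> trilinear_form scale V (Q j)"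
  shows "t (\<lambda>x y z. \<Sum>j\<in>J. Q j x y z) = (\<Sum>j\<in>J. t (Q j))"
proof -
  have z: "t (\<lambda>x y z. 0) = 0"
    using tensorial3D(3)[OF t, of "\<lambda>x y z. 0" 0]
    by (simp add: trilinear_form_def bilinear_on_def linear_on_def)
  show ?thesis
    using assms(2)
    by (induction J rule: infinite_finite_induct)
      (auto simp: z tensorial3D(2)[OF t] trilinear_form_sum)
qed

lemma tensorial3_expand:
  assumes t: "tensorial3 scale V t" and \<gamma>: "trilinear_form scale V \<gamma>"
  shows "t \<gamma> = (\<Sum>k\<in>I. \<Sum>l\<in>I. \<Sum>m\<in>I.
    \<gamma> (f k) (f l) (f m) * t (\<lambda>x y z. \<phi> k x * \<phi> l y * \<phi> m z))"
proof -
  let ?Q = "\<lambda>k l m x y z. \<gamma> (f k) (f l) (f m) * (\<phi> k x * \<phi> l y * \<phi> m z)"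
  have "t \<gamma> = t (\<lambda>x y z. \<Sum>k\<in>I. \<Sum>l\<in>I. \<Sum>m\<in>I. ?Q k l m x y z)"
    using trilinear_expand[OF \<gamma>] by (intro tensorial3D(4)[OF t])
  also have "\<dots> = (\<Sum>k\<in>I. t (\<lambda>x y z. \<Sum>l\<in>I. \<Sum>m\<in>I. ?Q k l m x y z))"
    by (intro tensorial3_sum_form t trilinear_form_sum trilinear_form_scale trilinear_form_coord)
  also have "\<dots> = (\<Sum>k\<in>I. \<Sum>l\<in>I. t (\<lambda>x y z. \<Sum>m\<in>I. ?Q k l m x y z))"
    by (intro sum.cong refl tensorial3_sum_form t trilinear_form_sum trilinear_form_scale
        trilinear_form_coord)
  also have "\<dots> = (\<Sum>k\<in>I. \<Sum>l\<in>I. \<Sum>m\<in>I. t (?Q k l m))"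
    by (intro sum.cong refl tensorial3_sum_form t trilinear_form_scale trilinear_form_coord)
  also have "\<dots> = (\<Sum>k\<in>I. \<Sum>l\<in>I. \<Sum>m\<in>I.
      \<gamma> (f k) (f l) (f m) * t (\<lambda>x y z. \<phi> k x * \<phi> l y * \<phi> m z))"
    by (intro sum.cong refl tensorial3D(3)[OF t] trilinear_form_coord)
  finally show ?thesis .
qed

lemma tensorial3_eq_0I:
  assumes "tensorial3 scale V t"
    and "\<And>k l m. k \<in> I \<Longrightarrow> l \<in> I \<Longrightarrow> m \<in> I \<Longrightarrow> t (\<lambda>x y z. \<phi> k x * \<phi> l y * \<phi> m z) = 0"
  shows "t = 0"
proof
  fix \<gamma> show "t \<gamma> = 0 \<gamma>"
    using tensorial3D(1)[OF assms(1)] tensorial3_expand[OF assms(1)] assms(2)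
    by (cases "trilinear_form scale V \<gamma>") simp_all
qed

end

section \<open>Dual spaces and biduals\<close>

context carrier_space
begin

lemma dual_spaceD:
  assumes "u \<in> dual_space scale V"
  shows "linear_on scale V (*) UNIV u" "x \<notin> V \<Longrightarrow> u x = 0"
  using assms unfolding dual_space_def by auto

lemma dual_space_eqI:
  assumes "u \<in> dual_space scale V" "v \<in> dual_space scale V" "\<And>x. x \<in> V \<Longrightarrow> u x = v x"
  shows "u = v"
proof
  fix x show "u x = v x"
    using assms dual_spaceD(2)[of u x] dual_spaceD(2)[of v x] by (cases "x \<in> V") auto
qed

lemma restrict_in_dual_space:
  assumes "linear_on scale V (*) UNIV h"
  shows "(\<lambda>x. if x \<in> V then h x else 0) \<in> dual_space scale V"
  using assms unfolding dual_space_def linear_on_def by simp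

lemma carrier_space_dual: "carrier_space fun_scale (dual_space scale V)"
proof
  show "fun_scale.subspace (dual_space scale V)"
    unfolding fun_scale.subspace_def dual_space_def linear_on_def
    by (auto simp: fun_scale_def algebra_simps)
qed

end

context coordinates
begin

lemma of_bidual_to_bidual:
  assumes "x \<in> V"
  shows "of_bidual scale V (to_bidual scale V x) = x"
proof -
  have "inj_on (to_bidual scale V) V"
  proof (rule inj_onI)
    fix x y assume xy: "x \<in> V" "y \<in> V" and eq: "to_bidual scale V x = to_bidual scale V y"
    have "\<phi> k x = \<phi> k y" if "k \<in> I" for k
      using fun_cong[OF eq, of "\<lambda>x. if x \<in> V then \<phi> k x else 0"]
        restrict_in_dual_space[OF linear_coord[OF that]] xy by (simp add: to_bidual_def)
    then have "(\<Sum>k\<in>I. scale (\<phi> k x) (f k)) = (\<Sum>k\<in>I. scale (\<phi> k y) (f k))" by simp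
    then show "x = y" unfolding expand[OF xy(1)] expand[OF xy(2)] .
  qed
  then show ?thesis unfolding of_bidual_def using assms by (rule inv_into_f_f)
qed

lemma bidual_surj:
  assumes \<Phi>: "linear_on fun_scale (dual_space scale V) (*) UNIV \<Phi>"
    and 0: "\<And>u. u \<notin> dual_space scale V \<Longrightarrow> \<Phi> u = 0"
  shows "of_bidual scale V \<Phi> \<in> V"
    and "u \<in> dual_space scale V \<Longrightarrow> u (of_bidual scale V \<Phi>) = \<Phi> u"
proof -
  interpret dual: carrier_space fun_scale "dual_space scale V" by (rule carrier_space_dual)
  \<comment> \<open>Coordinate functionals are only linear on V; cutting them off to 0 outside V
    makes them elements of \<open>dual_space\<close>, where \<Phi> can be applied.\<close>
  define \<psi> where "\<psi> k x = (if x \<in> V then \<phi> k x else 0)" for k x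
  have \<psi>: "\<psi> k \<in> dual_space scale V" if "k \<in> I" for k
    unfolding \<psi>_def using restrict_in_dual_space[OF linear_coord[OF that]] .
  \<comment> \<open>The only candidate: if \<Phi> is evaluation at a point, this is the coordinate
    expansion of that point.\<close>
  define x where "x = (\<Sum>k\<in>I. scale (\<Phi> (\<psi> k)) (f k))"
  have x: "x \<in> V" unfolding x_def using f_in by simp
  have eval: "u x = \<Phi> u" if u: "u \<in> dual_space scale V" for u
  proof -
    note lin = dual_spaceD(1)[OF u]
    have "u = (\<Sum>k\<in>I. fun_scale (u (f k)) (\<psi> k))"
    proof (rule dual_space_eqI[OF u])
      show "(\<Sum>k\<in>I. fun_scale (u (f k)) (\<psi> k)) \<in> dual_space scale V"
        using \<psi> by simp
    qed (simp add: sum_fun_apply fun_scale_def \<psi>_def form_expand[OF lin] mult.commute)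
    then have "\<Phi> u = \<Phi> (\<Sum>k\<in>I. fun_scale (u (f k)) (\<psi> k))" by simp
    also have "\<dots> = (\<Sum>k\<in>I. u (f k) * \<Phi> (\<psi> k))"
      using \<psi> by (subst dual.linear_formD(6)[OF \<Phi>]) (simp_all add: dual.linear_formD(5)[OF \<Phi>])
    also have "\<dots> = u x"
      unfolding x_def using f_in
      by (subst linear_formD(6)[OF lin]) (simp_all add: linear_formD(5)[OF lin] mult.commute)
    finally show ?thesis ..
  qed
  have "\<Phi> = to_bidual scale V x"
    using eval 0 by (auto simp: to_bidual_def fun_eq_iff)
  then have "of_bidual scale V \<Phi> = x" using of_bidual_to_bidual[OF x] by simp
  then show "of_bidual scale V \<Phi> \<in> V" "u \<in> dual_space scale V \<Longrightarrow> u (of_bidual scale V \<Phi>) = \<Phi> u"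
    using x eval by simp_all
qed

end

section \<open>Invariant forms and Lagrangian splittings\<close>

text \<open>A quadratic Leibniz algebra stripped of its Leibniz identity, which for the double is a
  conclusion and has to be reached from invariance.\<close>

locale invariant_form = carrier_space scale V
  for scale :: "'k::field \<Rightarrow> 'a::ab_group_add \<Rightarrow> 'a" and V +
  fixes br :: "'a \<Rightarrow> 'a \<Rightarrow> 'a" and \<omega> :: "'a \<Rightarrow> 'a \<Rightarrow> 'k"
  assumes bilinear_br: "bilinear_on scale V scale V br"
    and bilinear_form: "bilinear_form scale V \<omega>"
    and skew: "x \<in> V \<Longrightarrow> y \<in> V \<Longrightarrow> \<omega> x y = - \<omega> y x"
    and nondegenerate: "x \<in> V \<Longrightarrow> (\<And>y. y \<in> V \<Longrightarrow> \<omega> x y = 0) \<Longrightarrow> x = 0"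
    and invariant: "x \<in> V \<Longrightarrow> y \<in> V \<Longrightarrow> z \<in> V \<Longrightarrow> \<omega> x (br y z) = \<omega> (br x z + br z x) y"
begin

lemma br_in [simp]: "x \<in> V \<Longrightarrow> y \<in> V \<Longrightarrow> br x y \<in> V"
  using bilinear_br unfolding bilinear_on_def linear_on_def by blast

lemma br_add:
  "x \<in> V \<Longrightarrow> y \<in> V \<Longrightarrow> z \<in> V \<Longrightarrow> br (x + y) z = br x z + br y z"
  "x \<in> V \<Longrightarrow> y \<in> V \<Longrightarrow> z \<in> V \<Longrightarrow> br z (x + y) = br z x + br z y"
  using bilinear_br unfolding bilinear_on_def linear_on_def by blast+

lemma br_scale:
  "x \<in> V \<Longrightarrow> y \<in> V \<Longrightarrow> br (scale c x) y = scale c (br x y)"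
  "x \<in> V \<Longrightarrow> y \<in> V \<Longrightarrow> br x (scale c y) = scale c (br x y)"
  using bilinear_br unfolding bilinear_on_def linear_on_def by blast+

lemma br_diff:
  "x \<in> V \<Longrightarrow> y \<in> V \<Longrightarrow> z \<in> V \<Longrightarrow> br (x - y) z = br x z - br y z"
  "x \<in> V \<Longrightarrow> y \<in> V \<Longrightarrow> z \<in> V \<Longrightarrow> br z (x - y) = br z x - br z y"
  using br_add(1)[of "x - y" y z] br_add(2)[of "x - y" y z] by simp_all

lemma linear_\<omega>: "x \<in> V \<Longrightarrow> linear_on scale V (*) UNIV (\<omega> x)"
  "y \<in> V \<Longrightarrow> linear_on scale V (*) UNIV (\<lambda>x. \<omega> x y)"
  using bilinear_form unfolding bilinear_on_def by auto

lemma \<omega>_add: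
  "x \<in> V \<Longrightarrow> y \<in> V \<Longrightarrow> z \<in> V \<Longrightarrow> \<omega> (x + y) z = \<omega> x z + \<omega> y z"
  "x \<in> V \<Longrightarrow> y \<in> V \<Longrightarrow> z \<in> V \<Longrightarrow> \<omega> z (x + y) = \<omega> z x + \<omega> z y"
  using linear_formD(2)[OF linear_\<omega>(1)] linear_formD(2)[OF linear_\<omega>(2)] by auto

lemma \<omega>_diff:
  "x \<in> V \<Longrightarrow> y \<in> V \<Longrightarrow> z \<in> V \<Longrightarrow> \<omega> (x - y) z = \<omega> x z - \<omega> y z"
  "x \<in> V \<Longrightarrow> y \<in> V \<Longrightarrow> z \<in> V \<Longrightarrow> \<omega> z (x - y) = \<omega> z x - \<omega> z y"
  using linear_formD(3)[OF linear_\<omega>(1)] linear_formD(3)[OF linear_\<omega>(2)] by auto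

lemma \<omega>_minus:
  "x \<in> V \<Longrightarrow> y \<in> V \<Longrightarrow> \<omega> (- x) y = - \<omega> x y"
  "x \<in> V \<Longrightarrow> y \<in> V \<Longrightarrow> \<omega> x (- y) = - \<omega> x y"
  using linear_formD(4)[OF linear_\<omega>(1)] linear_formD(4)[OF linear_\<omega>(2)] by auto

lemma \<omega>_scale:
  "x \<in> V \<Longrightarrow> y \<in> V \<Longrightarrow> \<omega> (scale c x) y = c * \<omega> x y"
  "x \<in> V \<Longrightarrow> y \<in> V \<Longrightarrow> \<omega> x (scale c y) = c * \<omega> x y"
  using linear_formD(5)[OF linear_\<omega>(1)] linear_formD(5)[OF linear_\<omega>(2)] by auto

lemma \<omega>_zero [simp]: "x \<in> V \<Longrightarrow> \<omega> x 0 = 0" "x \<in> V \<Longrightarrow> \<omega> 0 x = 0"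
  using linear_formD(1)[OF linear_\<omega>(1)] linear_formD(1)[OF linear_\<omega>(2)] by auto

lemma \<omega>_sum:
  "x \<in> V \<Longrightarrow> (\<And>i. i \<in> I \<Longrightarrow> h i \<in> V) \<Longrightarrow> \<omega> x (\<Sum>i\<in>I. h i) = (\<Sum>i\<in>I. \<omega> x (h i))"
  using linear_formD(6)[OF linear_\<omega>(1)] by auto

lemmas \<omega>_linear = \<omega>_add \<omega>_diff \<omega>_minus \<omega>_scale
lemmas br_linear = br_add br_diff br_scale

abbreviation acomm :: "'a \<Rightarrow> 'a \<Rightarrow> 'a"
  where "acomm x y \<equiv> br x y + br y x"

lemma eq_if_\<omega>_eq:
  assumes "x \<in> V" "y \<in> V" "\<And>z. z \<in> V \<Longrightarrow> \<omega> x z = \<omega> y z"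
  shows "x = y"
  using nondegenerate[of "x - y"] assms by (simp add: \<omega>_diff)

lemma \<omega>_acomm:
  assumes "x \<in> V" "y \<in> V" "z \<in> V"
  shows "\<omega> (acomm x z) y = \<omega> x (br y z)"
  using invariant[OF assms] by simp

text \<open>The right side of \<open>invariant\<close> is symmetric in x and z, so exchanging x and
  z on the left changes nothing. With skewness, left multiplications become skew-adjoint.\<close>

lemma \<omega>_br_left:
  assumes "x \<in> V" "y \<in> V" "z \<in> V"
  shows "\<omega> x (br y z) = - \<omega> (br y x) z"
  using invariant[of x y z] invariant[of z y x] skew[of z "br y x"] assms by (simp add: add.commute)

section \<open>Symmetries of the Leibniz defect\<close>

definition leibniz_defect :: "'a \<Rightarrow> 'a \<Rightarrow> 'a \<Rightarrow> 'a"
  where "leibniz_defect x y z = br x (br y z) - br (br x y) z - br y (br x z)"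

lemma leib_in [simp]: "x \<in> V \<Longrightarrow> y \<in> V \<Longrightarrow> z \<in> V \<Longrightarrow> leibniz_defect x y z \<in> V"
  by (simp add: leibniz_defect_def)

text \<open>As an operator on w the defect is the commutator of two left multiplications minus a
  left multiplication. All of these are skew-adjoint, hence so is the defect; skewness of
  \<open>\<omega>\<close> turns this into symmetry in w and z.\<close>

lemma \<omega>_leib_swap:
  assumes "u \<in> V" "v \<in> V" "w \<in> V" "z \<in> V"
  shows "\<omega> z (leibniz_defect u v w) = \<omega> w (leibniz_defect u v z)"
proof -
  have "\<omega> z (br u (br v w)) = \<omega> (br v (br u z)) w"
    using assms by (simp add: \<omega>_br_left[of z u] \<omega>_br_left[of "br u z" v])
  moreover have "\<omega> z (br v (br u w)) = \<omega> (br u (br v z)) w"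
    using assms by (simp add: \<omega>_br_left[of z v] \<omega>_br_left[of "br v z" u])
  moreover have "\<omega> z (br (br u v) w) = - \<omega> (br (br u v) z) w"
    using assms by (simp add: \<omega>_br_left)
  ultimately have "\<omega> z (leibniz_defect u v w) = - \<omega> (leibniz_defect u v z) w"
    using assms by (simp add: leibniz_defect_def \<omega>_linear)
  then show ?thesis using skew[of w "leibniz_defect u v z"] assms by simp
qed

text \<open>The aim is to move v out of the defect. The adjoint of right multiplication by w is the
  map \<open>\<lambda>z. acomm z w\<close>, so what remains in front of v is the failure of left
  multiplication by u to be a derivation of \<open>acomm\<close>, and this is a sum of two
  defects.\<close>

lemma \<omega>_leib_rotate:
  assumes "u \<in> V" "v \<in> V" "w \<in> V" "z \<in> V"
  shows "\<omega> z (leibniz_defect u v w) = - (\<omega> v (leibniz_defect u z w) + \<omega> v (leibniz_defect u w z))"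
proof -
  have "\<omega> z (br u (br v w)) = - \<omega> (acomm (br u z) w) v"
    using assms by (simp only: \<omega>_acomm br_in) (simp add: \<omega>_br_left[of z u])
  moreover have "\<omega> z (br (br u v) w) = - \<omega> (br u (acomm z w)) v"
  proof -
    have "\<omega> z (br (br u v) w) = \<omega> (acomm z w) (br u v)"
      using assms by (simp only: \<omega>_acomm br_in)
    also have "\<dots> = - \<omega> (br u (acomm z w)) v"
      using assms by (intro \<omega>_br_left) auto
    finally show ?thesis .
  qed
  moreover have "\<omega> z (br v (br u w)) = \<omega> (acomm z (br u w)) v"
    using assms by (simp only: \<omega>_acomm br_in)
  ultimately have "\<omega> z (leibniz_defect u v w) =
      \<omega> (br u (acomm z w) - acomm (br u z) w - acomm z (br u w)) v"
    using assms by (simp only: leibniz_defect_def \<omega>_linear br_in V_closed) simp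
  also have "br u (acomm z w) - acomm (br u z) w - acomm z (br u w) = leibniz_defect u z w + leibniz_defect u w z"
    using assms by (simp add: leibniz_defect_def br_add algebra_simps)
  finally show ?thesis
    using skew[of "leibniz_defect u z w + leibniz_defect u w z" v] assms by (simp add: \<omega>_add)
qed

text \<open>Symmetrizing the defect in u and v cancels the iterated products and leaves
  \<open>- br (acomm u v) w\<close>. Invariance writes its pairing with z as a pairing of
  anticommutators, the shape in which the flip compatibility will be available.\<close>

lemma \<omega>_leib_acomm:
  assumes "u \<in> V" "v \<in> V" "w \<in> V" "z \<in> V"
  shows "\<omega> z (leibniz_defect u v w) = - \<omega> z (leibniz_defect v u w) - \<omega> (acomm z w) (acomm u v)"
proof -
  have "\<omega> (acomm z w) (acomm u v) = \<omega> z (br (acomm u v) w)"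
    using assms by (intro \<omega>_acomm) auto
  moreover have "leibniz_defect u v w = - leibniz_defect v u w - br (acomm u v) w"
    using assms by (simp add: leibniz_defect_def br_add algebra_simps)
  ultimately show ?thesis using assms by (simp only: \<omega>_linear leib_in br_in V_closed)
qed

text \<open>Three arguments from a set X of vectors on which the Leibniz identity holds suffice,
  whatever the fourth. The symmetries carry the stray t from the outer slot into any other; the
  first slot is the delicate one, as it costs a pairing of anticommutators.\<close>

lemma \<omega>_leib_eq_0_if_three:
  assumes X: "X \<subseteq> V" and leibniz_defect: "\<forall>x\<in>X. \<forall>y\<in>X. \<forall>z\<in>X. leibniz_defect x y z = 0"
    and t: "t \<in> V" and x: "x \<in> X" "y \<in> X" "z \<in> X"
  shows "\<omega> t (leibniz_defect x y z) = 0" "\<omega> z (leibniz_defect x y t) = 0"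
    "\<omega> z (leibniz_defect x t y) = 0" "\<omega> z (leibniz_defect t x y) = 0"
proof -
  have V: "x \<in> V" "y \<in> V" "z \<in> V" using X x by auto
  have 1: "\<omega> t (leibniz_defect a b c) = 0" if "a \<in> X" "b \<in> X" "c \<in> X" for a b c
    using leibniz_defect that t by simp
  show "\<omega> t (leibniz_defect x y z) = 0" using 1 x by simp
  show "\<omega> z (leibniz_defect x y t) = 0" using \<omega>_leib_swap[of x y t z] t V 1 x by simp
  show 2: "\<omega> z (leibniz_defect x t y) = 0" using \<omega>_leib_rotate[of x t y z] t V 1 x by simp
  \<comment> \<open>The anticommutator pairing vanishes because the Leibniz identity in X makes
    \<open>acomm z y\<close> annihilate x from the left: moving t to the end turns the pairing into
    \<open>\<omega> (br (acomm z y) x) t\<close>.\<close>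
  have "br (acomm z y) x = - (leibniz_defect z y x + leibniz_defect y z x)"
    using V by (simp add: leibniz_defect_def br_add)
  then have "br (acomm z y) x = 0" using leibniz_defect x by simp
  moreover have "\<omega> (acomm (acomm z y) x) t = \<omega> (acomm z y) (br t x)"
    using V t by (intro \<omega>_acomm) auto
  moreover have "\<omega> (acomm z y) (acomm x t) = \<omega> (acomm z y) (br x t) + \<omega> (acomm z y) (br t x)"
    using V t by (simp add: \<omega>_add)
  moreover have "\<omega> (acomm z y) (br x t) = - \<omega> (br x (acomm z y)) t"
    using V t by (intro \<omega>_br_left) auto
  ultimately have "\<omega> (acomm z y) (acomm x t) = 0"
    using V t by (simp only: \<omega>_linear br_in V_closed) simp
  then show "\<omega> z (leibniz_defect t x y) = 0"
    using \<omega>_leib_acomm[of t x y z] 2 V t by (simp add: add.commute)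
qed

end

locale lagrangian_splitting = invariant_form +
  fixes A B :: "'b set" and P Q :: "'b \<Rightarrow> 'b"
  assumes A_sub: "A \<subseteq> V" and B_sub: "B \<subseteq> V"
    and isotropic: "x \<in> A \<Longrightarrow> y \<in> A \<Longrightarrow> \<omega> x y = 0" "x \<in> B \<Longrightarrow> y \<in> B \<Longrightarrow> \<omega> x y = 0"
    and subalgebra: "x \<in> A \<Longrightarrow> y \<in> A \<Longrightarrow> br x y \<in> A" "x \<in> B \<Longrightarrow> y \<in> B \<Longrightarrow> br x y \<in> B"
    and P_in_A: "x \<in> V \<Longrightarrow> P x \<in> A" and Q_in_B: "x \<in> V \<Longrightarrow> Q x \<in> B"
    and split: "x \<in> V \<Longrightarrow> P x + Q x = x"
begin

lemma in_V [simp]: "x \<in> A \<Longrightarrow> x \<in> V" "x \<in> B \<Longrightarrow> x \<in> V"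
  using A_sub B_sub by auto

lemma PQ_in_V [simp]: "x \<in> V \<Longrightarrow> P x \<in> V" "x \<in> V \<Longrightarrow> Q x \<in> V"
  using P_in_A Q_in_B by auto

text \<open>Sort the paired defect by the subalgebras containing u, v, w and the outer vector z.
  Three arguments in one subalgebra give 0. Six balanced types remain, named by the letters of u, v,
  w, z in this order (the second fact under \<open>BABA\<close> is BAAB). Swap, rotation and the
  exchange of u and v derive all of them from ABBA; only the exchange uses the condition on
  anticommutators.\<close>

lemma leib_eq_0I:
  assumes A: "\<forall>x\<in>A. \<forall>y\<in>A. \<forall>z\<in>A. leibniz_defect x y z = 0"
    and B: "\<forall>a\<in>B. \<forall>b\<in>B. \<forall>c\<in>B. leibniz_defect a b c = 0"
    and ABBA: "\<And>x y a b. x \<in> A \<Longrightarrow> y \<in> A \<Longrightarrow> a \<in> B \<Longrightarrow> b \<in> B \<Longrightarrow> \<omega> y (leibniz_defect x a b) = 0"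
    and acomm: "\<And>x y a b. x \<in> A \<Longrightarrow> y \<in> A \<Longrightarrow> a \<in> B \<Longrightarrow> b \<in> B \<Longrightarrow>
      \<omega> (acomm a x) (acomm y b) = 0"
    and V: "u \<in> V" "v \<in> V" "w \<in> V"
  shows "leibniz_defect u v w = 0"
proof -
  note A3 = \<omega>_leib_eq_0_if_three[OF A_sub A]
  note B3 = \<omega>_leib_eq_0_if_three[OF B_sub B]
  have ABAB: "\<omega> b (leibniz_defect x a y) = 0" if "x \<in> A" "y \<in> A" "a \<in> B" "b \<in> B" for x y a b
    using \<omega>_leib_swap[of x a y b] ABBA that by simp
  have BABA: "\<omega> y (leibniz_defect a x b) = 0" "\<omega> b (leibniz_defect a x y) = 0"
    if "x \<in> A" "y \<in> A" "a \<in> B" "b \<in> B" for x y a b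
    using \<omega>_leib_acomm[of a x b y] \<omega>_leib_acomm[of a x y b] ABBA[of x y a b] ABAB[of x y a b]
      acomm[of y x b a] that by (simp_all add: add.commute)
  have AABB: "\<omega> b (leibniz_defect x y a) = 0" if "x \<in> A" "y \<in> A" "a \<in> B" "b \<in> B" for x y a b
    using \<omega>_leib_rotate[of x y a b] ABBA that by simp
  have BBAA: "\<omega> y (leibniz_defect a b x) = 0" if "x \<in> A" "y \<in> A" "a \<in> B" "b \<in> B" for x y a b
    using \<omega>_leib_rotate[of a b x y] BABA that by simp
  have pure: "\<omega> z (leibniz_defect u v w) = 0"
    if "u \<in> A \<union> B" "v \<in> A \<union> B" "w \<in> A \<union> B" "z \<in> A \<union> B" for u v w z
    using that by (elim UnE) (blast intro: A3 B3 ABAB BABA AABB BBAA ABBA in_V)+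
  have split_form: "h x = 0"
    if h: "linear_on scale V (*) UNIV h" and "\<And>y. y \<in> A \<union> B \<Longrightarrow> h y = 0" "x \<in> V" for h x
    using linear_formD(2)[OF h, of "P x" "Q x"] that split P_in_A Q_in_B by simp
  have lin: "linear_on scale V (*) UNIV (\<lambda>u. \<omega> z (leibniz_defect u v w))"
    "linear_on scale V (*) UNIV (\<lambda>v. \<omega> z (leibniz_defect u v w))"
    "linear_on scale V (*) UNIV (\<lambda>w. \<omega> z (leibniz_defect u v w))" if "u \<in> V" "v \<in> V" "w \<in> V" "z \<in> V" for u v w z
    using that unfolding linear_on_def leibniz_defect_def
    by (simp_all add: \<omega>_linear br_linear algebra_simps)
  have "\<omega> z (leibniz_defect u v w) = 0" if "z \<in> V" for z
  proof -
    \<comment> \<open>Linearity extends the vanishing from the union of A and B to V one slot at a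
      time: w, v, u and finally z.\<close>
    have V': "x \<in> V" if "x \<in> A \<union> B" for x using that by auto
    have 1: "\<omega> z' (leibniz_defect u' v' w) = 0" if "u' \<in> A \<union> B" "v' \<in> A \<union> B" "z' \<in> A \<union> B" for u' v' z'
      using lin(3)[OF V'[OF that(1)] V'[OF that(2)] V(3) V'[OF that(3)]] pure[OF that(1,2) _ that(3)] V(3)
      by (rule split_form)
    have 2: "\<omega> z' (leibniz_defect u' v w) = 0" if "u' \<in> A \<union> B" "z' \<in> A \<union> B" for u' z'
      using lin(2)[OF V'[OF that(1)] V(2,3) V'[OF that(2)]] 1[OF that(1) _ that(2)] V(2)
      by (rule split_form)
    have 3: "\<omega> z' (leibniz_defect u v w) = 0" if "z' \<in> A \<union> B" for z'
      using lin(1)[OF V V'[OF that]] 2[OF _ that] V(1) by (rule split_form)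
    show ?thesis
      using linear_\<omega>(2)[OF leib_in[OF V]] 3 that by (rule split_form)
  qed
  then show ?thesis using V skew[of "leibniz_defect u v w"] by (intro nondegenerate) auto
qed

text \<open>Both sides equal \<open>\<omega> (P x) (Q y)\<close> by isotropy, so P and Q are adjoint
  to each other.\<close>

lemma \<omega>_P_left: "x \<in> V \<Longrightarrow> y \<in> V \<Longrightarrow> \<omega> (P x) y = \<omega> x (Q y)"
  using isotropic P_in_A Q_in_B \<omega>_add(1)[of "P x" "Q x" "Q y"] \<omega>_add(2)[of "P y" "Q y" "P x"]
  by (simp add: split)

lemma \<omega>_Q_left: "x \<in> V \<Longrightarrow> y \<in> V \<Longrightarrow> \<omega> (Q x) y = \<omega> x (P y)"
  using isotropic P_in_A Q_in_B \<omega>_add(1)[of "P x" "Q x" "P y"] \<omega>_add(2)[of "P y" "Q y" "Q x"]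
  by (simp add: split)

end

section \<open>The factorizable structure of a Manin triple\<close>

text \<open>The duality of the two families enters through \<open>Q_expand\<close>, which says that
  the tensor built from them is Q once read through \<open>\<omega>\<close>.\<close>

locale manin_triple = lagrangian_splitting +
  fixes I :: "'i set" and e e' :: "'i \<Rightarrow> 'b"
  assumes subspace_A: "subspace A" and subspace_B: "subspace B"
    and finite_I: "finite I"
    and e_in: "i \<in> I \<Longrightarrow> e i \<in> V" and e'_in: "i \<in> I \<Longrightarrow> e' i \<in> V"
    and Q_expand: "x \<in> V \<Longrightarrow> (\<Sum>i\<in>I. scale (\<omega> x (e i)) (e' i)) = Q x"
    and leib_eq_0: "x \<in> V \<Longrightarrow> y \<in> V \<Longrightarrow> z \<in> V \<Longrightarrow> leibniz_defect x y z = 0"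
begin

lemma leibniz_id: "x \<in> V \<Longrightarrow> y \<in> V \<Longrightarrow> z \<in> V \<Longrightarrow> br x (br y z) = br (br x y) z + br y (br x z)"
  using leib_eq_0[of x y z] by (simp add: leibniz_defect_def algebra_simps)

text \<open>Adding the Leibniz identities for x, y and for y, x cancels everything else. In other
  words, anticommutators lie in the left centre.\<close>

lemma br_acomm_left:
  assumes "x \<in> V" "y \<in> V" "z \<in> V"
  shows "br (acomm x y) z = 0"
  using leibniz_id[of x y z] leibniz_id[of y x z] assms by (simp add: br_add)

text \<open>The transpose of \<open>Q_expand\<close>: pairing with y shifts the expansion onto y,
  the adjoint of Q is P, and skewness contributes the sign.\<close>

lemma P_expand:
  assumes "x \<in> V"
  shows "(\<Sum>i\<in>I. scale (\<omega> x (e' i)) (e i)) = - P x"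
proof (rule eq_if_\<omega>_eq)
  show "(\<Sum>i\<in>I. scale (\<omega> x (e' i)) (e i)) \<in> V" "- P x \<in> V"
    using assms e_in by auto
  fix y assume y: "y \<in> V"
  have "\<omega> y (\<Sum>i\<in>I. scale (\<omega> x (e' i)) (e i)) = (\<Sum>i\<in>I. \<omega> x (e' i) * \<omega> y (e i))"
    using assms y e_in by (simp add: \<omega>_sum \<omega>_scale)
  also have "\<dots> = \<omega> x (\<Sum>i\<in>I. scale (\<omega> y (e i)) (e' i))"
    using assms y e'_in by (simp add: \<omega>_sum \<omega>_scale mult.commute)
  also have "\<dots> = \<omega> (P x) y"
    using assms y by (simp add: Q_expand \<omega>_P_left)
  finally show "\<omega> (\<Sum>i\<in>I. scale (\<omega> x (e' i)) (e i)) y = \<omega> (- P x) y"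
    using skew[of "\<Sum>i\<in>I. scale (\<omega> x (e' i)) (e i)" y] assms y e_in by (simp add: \<omega>_minus)
qed

text \<open>\<open>\<omega> (g k)\<close> is the coordinate functional for the k-th vector of
  \<open>case_sum e e'\<close>; the minus sign compensates the skewness of \<open>\<omega>\<close>.
  Because coordinates have this form, tensors may be tested on vectors of V instead of abstract
  functionals.\<close>

definition g :: "'i + 'i \<Rightarrow> 'b"
  where "g = case_sum e' (\<lambda>i. - e i)"

lemma g_in: "k \<in> I <+> I \<Longrightarrow> g k \<in> V"
  using e_in e'_in by (auto simp: g_def)

sublocale coordinates scale V "I <+> I" "case_sum e e'" "\<lambda>k. \<omega> (g k)"
proof
  show "finite (I <+> I)" using finite_I by simp
  show "case_sum e e' k \<in> V" if "k \<in> I <+> I" for k using that e_in e'_in by auto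
  show "linear_on scale V (*) UNIV (\<omega> (g k))" if "k \<in> I <+> I" for k
    using g_in[OF that] by (rule linear_\<omega>)
  fix x assume x: "x \<in> V"
  have "(\<Sum>k\<in>I <+> I. scale (\<omega> (g k) x) (case_sum e e' k)) =
      (\<Sum>i\<in>I. scale (\<omega> (e' i) x) (e i)) + (\<Sum>i\<in>I. scale (\<omega> (- e i) x) (e' i))"
    using finite_I by (simp add: sum.Plus g_def)
  also have "\<dots> = (\<Sum>i\<in>I. - scale (\<omega> x (e' i)) (e i)) + (\<Sum>i\<in>I. scale (\<omega> x (e i)) (e' i))"
    using e_in e'_in x skew[of _ x] by (intro arg_cong2[of _ _ _ _ "(+)"] sum.cong) (auto simp: \<omega>_minus)
  also have "\<dots> = x"
    using x by (simp add: sum_negf P_expand Q_expand split)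
  finally show "(\<Sum>k\<in>I <+> I. scale (\<omega> (g k) x) (case_sum e e' k)) = x" .
qed

abbreviation pair2 :: "'b \<Rightarrow> 'b \<Rightarrow> 'b \<Rightarrow> 'b \<Rightarrow> 'a"
  where "pair2 p q \<equiv> \<lambda>x y. \<omega> p x * \<omega> q y"

abbreviation pair3 :: "'b \<Rightarrow> 'b \<Rightarrow> 'b \<Rightarrow> 'b \<Rightarrow> 'b \<Rightarrow> 'b \<Rightarrow> 'a"
  where "pair3 p q s \<equiv> \<lambda>x y z. \<omega> p x * \<omega> q y * \<omega> s z"

lemma tensor2_eqI:
  assumes "tensorial2 scale V t" "tensorial2 scale V t'"
    and "\<And>p q. p \<in> V \<Longrightarrow> q \<in> V \<Longrightarrow> t (pair2 p q) = t' (pair2 p q)"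
  shows "t = t'"
  using assms(1,2) by (rule tensorial2_eqI) (intro assms(3) g_in)

lemma tensor3_eq_0I:
  assumes "tensorial3 scale V t"
    and "\<And>p q s. p \<in> V \<Longrightarrow> q \<in> V \<Longrightarrow> s \<in> V \<Longrightarrow> t (pair3 p q s) = 0"
  shows "t = 0"
  using assms(1) by (rule tensorial3_eq_0I) (intro assms(2) g_in)

lemma bilinear_pair2: "p \<in> V \<Longrightarrow> q \<in> V \<Longrightarrow> bilinear_form scale V (pair2 p q)"
  by (intro bilinear_form_mult linear_\<omega>)

lemma trilinear_pair3: "p \<in> V \<Longrightarrow> q \<in> V \<Longrightarrow> s \<in> V \<Longrightarrow> trilinear_form scale V (pair3 p q s)"
  by (intro trilinear_form_mult linear_\<omega>)

text \<open>Operators on tensors are traded for their adjoints on the test vectors; this is how the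
  conditions on the cobracket become formulas in V.\<close>

lemma tensor_map_pair:
  assumes "tensorial2 scale V t" "p \<in> V" "q \<in> V"
    and "\<And>x. x \<in> V \<Longrightarrow> \<omega> p (f x) = \<omega> p' x" "\<And>x. x \<in> V \<Longrightarrow> \<omega> q (h x) = \<omega> q' x"
  shows "tensor_map scale V f h t (pair2 p q) = t (pair2 p' q')"
proof -
  have "t (\<lambda>x y. \<omega> p (f x) * \<omega> q (h y)) = t (pair2 p' q')"
    by (rule tensorial2D(4)[OF assms(1)]) (simp add: assms)
  then show ?thesis unfolding tensor_map_def by (simp add: bilinear_pair2 assms)
qed

lemma adjoint_rmult: "p \<in> V \<Longrightarrow> y \<in> V \<Longrightarrow> x \<in> V \<Longrightarrow> \<omega> p (rmult br y x) = \<omega> (acomm p y) x"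
  unfolding rmult_def by (rule \<omega>_acomm[symmetric])

lemma adjoint_lmult: "p \<in> V \<Longrightarrow> y \<in> V \<Longrightarrow> x \<in> V \<Longrightarrow> \<omega> p (lmult br y x) = \<omega> (- br y p) x"
  unfolding lmult_def by (simp add: \<omega>_br_left[of p y x] \<omega>_minus)

text \<open>The adjoints \<open>- br y p\<close> of left and \<open>acomm p y\<close> of right
  multiplication add up to \<open>br p y\<close>.\<close>

lemma adjoint_both:
  assumes "p \<in> V" "y \<in> V" "x \<in> V"
  shows "\<omega> p ((lmult br y + rmult br y) x) = \<omega> (br p y) x"
proof -
  have "\<omega> p (acomm y x) = - \<omega> (acomm x y) p"
    using assms skew[of p "acomm y x"] by (simp add: add.commute)
  also have "\<dots> = - \<omega> x (br p y)" using assms by (simp only: \<omega>_acomm)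
  finally show ?thesis using assms skew[of x "br p y"] by (simp add: lmult_def rmult_def)
qed

lemma linear_mult:
  assumes "y \<in> V"
  shows "linear_on scale V scale V (rmult br y)" "linear_on scale V scale V (lmult br y)"
    "linear_on scale V scale V (lmult br y + rmult br y)" "linear_on scale V scale V id"
  using assms unfolding linear_on_def rmult_def lmult_def
  by (auto simp: br_linear scale_right_distrib)

lemma tensorial2_F_op:
  assumes "tensorial2 scale V t" "u \<in> V"
  shows "tensorial2 scale V (F_op scale V br u t)"
  unfolding F_op_def using assms by (intro tensorial2_diff tensorial2_tensor_map linear_mult)

lemma F_op_pair:
  assumes "tensorial2 scale V t" "u \<in> V" "p \<in> V" "q \<in> V"
  shows "F_op scale V br u t (pair2 p q) = t (pair2 (br p u) q) - t (pair2 p (acomm q u))"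
proof -
  have "tensor_map scale V (lmult br u + rmult br u) id t (pair2 p q) = t (pair2 (br p u) q)"
    using assms by (intro tensor_map_pair adjoint_both) auto
  moreover have "tensor_map scale V id (rmult br u) t (pair2 p q) = t (pair2 p (acomm q u))"
    using assms by (intro tensor_map_pair adjoint_rmult) auto
  ultimately show ?thesis by (simp add: F_op_def)
qed

section \<open>The tensor r, its cobracket and the dual bracket\<close>

definition r :: "('a, 'b) tensor2"
  where "r = (\<Sum>i\<in>I. tensor scale V (e i) (e' i))"

abbreviation cobr :: "'b \<Rightarrow> ('a, 'b) tensor2"
  where "cobr \<equiv> coboundary scale V br r"

lemma tensorial2_r: "tensorial2 scale V r"
  unfolding r_def using e_in e'_in by (intro tensorial2_sum tensorial2_tensor)

lemma r_pair:
  assumes "p \<in> V" "q \<in> V"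
  shows "r (pair2 p q) = \<omega> q (Q p)"
proof -
  have "r (pair2 p q) = (\<Sum>i\<in>I. \<omega> p (e i) * \<omega> q (e' i))"
    using assms by (simp add: r_def sum_fun_apply tensor_def bilinear_pair2)
  also have "\<dots> = \<omega> q (\<Sum>i\<in>I. scale (\<omega> p (e i)) (e' i))"
    using assms e'_in by (simp add: \<omega>_sum \<omega>_scale)
  finally show ?thesis using assms by (simp add: Q_expand)
qed

text \<open>Under \<open>\<omega>\<close>, the cobracket of \<open>r\<close> dualizes to this bracket, which is the direct sum of the bracket
  on \<open>B\<close> and the negated bracket on \<open>A\<close>.\<close>

definition rho :: "'b \<Rightarrow> 'b \<Rightarrow> 'b"
  where "rho p q = br (Q p) (Q q) - br (P p) (P q)"

lemma rho_in [simp]: "p \<in> V \<Longrightarrow> q \<in> V \<Longrightarrow> rho p q \<in> V"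
  by (simp add: rho_def)

text \<open>The mixed term \<open>br (Q p) (P q)\<close> is added and subtracted. In this form each
  product contains a single projection, as it does in the value of the cobracket.\<close>

lemma rho_alt:
  assumes "p \<in> V" "q \<in> V"
  shows "rho p q = br (Q p) q - br p (P q)"
  using br_add(2)[of "P q" "Q q" "Q p"] br_add(1)[of "P p" "Q p" "P q"] assms
  by (simp add: rho_def split)

lemma tensorial2_cobr: "u \<in> V \<Longrightarrow> tensorial2 scale V (cobr u)"
  unfolding coboundary_def by (intro tensorial2_F_op tensorial2_r)

text \<open>With r read as Q, the operator F yields one term with Q applied to \<open>br p u\<close>
  and one with Q applied to p. Adjointness frees u from both, and \<open>rho_alt\<close> recognizes
  the result.\<close>

lemma cobr_pair:
  assumes "u \<in> V" "p \<in> V" "q \<in> V"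
  shows "cobr u (pair2 p q) = \<omega> (rho p q) u"
proof -
  have "cobr u (pair2 p q) = \<omega> q (Q (br p u)) - \<omega> (acomm q u) (Q p)"
    using assms by (simp add: coboundary_def F_op_pair tensorial2_r r_pair)
  also have "\<omega> q (Q (br p u)) = - \<omega> (br p (P q)) u"
    using assms by (simp add: \<omega>_P_left[symmetric] \<omega>_br_left)
  also have "\<omega> (acomm q u) (Q p) = - \<omega> (br (Q p) q) u"
    using assms by (simp only: \<omega>_acomm PQ_in_V) (simp add: \<omega>_br_left[of q "Q p"])
  finally show ?thesis using assms by (simp add: rho_alt \<omega>_linear)
qed

lemma linear_cobr: "linear_on scale V fun_scale (tensor_square scale V) cobr"
  unfolding linear_on_def
proof (intro conjI ballI allI)
  fix x y c assume x: "x \<in> V" and y: "y \<in> V"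
  show "cobr x \<in> tensor_square scale V"
    using x by (intro tensorial2_in_tensor_square tensorial2_cobr)
  show "cobr (x + y) = cobr x + cobr y"
    using x y
    by (intro tensor2_eqI tensorial2_add tensorial2_cobr) (simp_all add: cobr_pair \<omega>_linear)
  show "cobr (scale c x) = fun_scale c (cobr x)"
    using x y by (intro tensor2_eqI tensorial2_scale tensorial2_cobr)
      (simp_all add: cobr_pair \<omega>_linear fun_scale_def)
qed

text \<open>Duality turns iterated cobrackets into iterated \<open>rho\<close>, so the coalgebra
  axiom becomes the Leibniz identity of \<open>rho\<close>.\<close>

lemma comult_left_pair:
  assumes "x \<in> V" "p \<in> V" "q \<in> V" "s \<in> V"
  shows "comult_left scale V cobr (cobr x) (pair3 p q s) = \<omega> (rho (rho p q) s) x"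
proof -
  have "cobr u (\<lambda>x1 x2. pair3 p q s x1 x2 z) = pair2 (rho p q) s u z" if "u \<in> V" "z \<in> V" for u z
  proof -
    have "cobr u (\<lambda>x1 x2. pair3 p q s x1 x2 z) = cobr u (\<lambda>x1 x2. \<omega> s z * pair2 p q x1 x2)"
      by (simp add: mult.commute)
    also have "\<dots> = \<omega> s z * cobr u (pair2 p q)"
      using that assms by (intro tensorial2D(3)[OF tensorial2_cobr] bilinear_pair2)
    finally show ?thesis using that assms by (simp add: cobr_pair)
  qed
  then have "cobr x (\<lambda>u z. cobr u (\<lambda>x1 x2. pair3 p q s x1 x2 z)) = cobr x (pair2 (rho p q) s)"
    by (rule tensorial2D(4)[OF tensorial2_cobr[OF assms(1)]])
  then show ?thesis
    using assms by (simp add: comult_left_def trilinear_pair3 cobr_pair)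
qed

lemma comult_right_pair:
  assumes "x \<in> V" "p \<in> V" "q \<in> V" "s \<in> V"
  shows "comult_right scale V cobr (cobr x) (pair3 p q s) = \<omega> (rho p (rho q s)) x"
proof -
  have "cobr u (\<lambda>x1 x2. pair3 p q s z x1 x2) = pair2 p (rho q s) z u" if "z \<in> V" "u \<in> V" for u z
  proof -
    have "cobr u (\<lambda>x1 x2. pair3 p q s z x1 x2) = cobr u (\<lambda>x1 x2. \<omega> p z * pair2 q s x1 x2)"
      by (simp add: mult.assoc)
    also have "\<dots> = \<omega> p z * cobr u (pair2 q s)"
      using that assms by (intro tensorial2D(3)[OF tensorial2_cobr] bilinear_pair2)
    finally show ?thesis using that assms by (simp add: cobr_pair)
  qed
  then have "cobr x (\<lambda>z u. cobr u (\<lambda>x1 x2. pair3 p q s z x1 x2)) = cobr x (pair2 p (rho q s))"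
    by (rule tensorial2D(4)[OF tensorial2_cobr[OF assms(1)]])
  then show ?thesis
    using assms by (simp add: comult_right_def trilinear_pair3 cobr_pair)
qed

text \<open>P and Q are only assumed to decompose vectors. Isotropy and nondegeneracy make the
  decomposition unique, which supplies their values on sums.\<close>

lemma PQ_sum:
  assumes "x \<in> A" "y \<in> B"
  shows "P (x + y) = x" "Q (x + y) = y"
proof -
  show "P (x + y) = x"
  proof (rule eq_if_\<omega>_eq)
    fix z assume z: "z \<in> V"
    have "\<omega> (P (x + y)) z = \<omega> x (Q z)"
      using assms z isotropic(2)[OF assms(2) Q_in_B] by (simp add: \<omega>_P_left \<omega>_add)
    also have "\<dots> = \<omega> x z"
      using \<omega>_add(2)[of "P z" "Q z" x] isotropic(1)[OF assms(1) P_in_A] assms z by (simp add: split)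
    finally show "\<omega> (P (x + y)) z = \<omega> x z" .
  qed (use assms in auto)
  then show "Q (x + y) = y" using split[of "x + y"] assms by simp
qed

lemma PQ_rho:
  assumes "p \<in> V" "q \<in> V"
  shows "P (rho p q) = - br (P p) (P q)" "Q (rho p q) = br (Q p) (Q q)"
proof -
  have "- br (P p) (P q) \<in> A" "br (Q p) (Q q) \<in> B"
    using assms subalgebra P_in_A Q_in_B subspace_A subspace_neg by auto
  from PQ_sum[OF this] show "P (rho p q) = - br (P p) (P q)" "Q (rho p q) = br (Q p) (Q q)"
    by (simp_all add: rho_def)
qed

lemma br_minus: "x \<in> V \<Longrightarrow> y \<in> V \<Longrightarrow> br (- x) y = - br x y" "x \<in> V \<Longrightarrow> y \<in> V \<Longrightarrow> br x (- y) = - br x y"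
  using br_scale[of x y "-1"] by simp_all

lemma PQ_minus:
  assumes "x \<in> V"
  shows "P (- x) = - P x" "Q (- x) = - Q x"
  using PQ_sum[of "- P x" "- Q x"] split[OF assms] P_in_A[OF assms] Q_in_B[OF assms]
    subspace_neg[OF subspace_A] subspace_neg[OF subspace_B] minus_add_distrib[of "P x" "Q x"]
  by simp_all

lemma rho_minus:
  "p \<in> V \<Longrightarrow> q \<in> V \<Longrightarrow> rho (- p) q = - rho p q"
  "p \<in> V \<Longrightarrow> q \<in> V \<Longrightarrow> rho p (- q) = - rho p q"
  by (simp_all add: rho_def PQ_minus br_minus)

text \<open>On the components in A and B, \<open>rho\<close> is the negated and the given bracket.
  The Leibniz identity is quadratic in the bracket, so negation preserves it.\<close>

lemma rho_leibniz:
  assumes "p \<in> V" "q \<in> V" "s \<in> V"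
  shows "rho p (rho q s) = rho (rho p q) s + rho q (rho p s)"
  using leibniz_id[of "P p" "P q" "P s"] leibniz_id[of "Q p" "Q q" "Q s"] assms
  by (simp add: rho_def[of p "rho _ _"] rho_def[of q "rho _ _"] rho_def[of "rho _ _"] PQ_rho br_minus)

lemma coleibniz_cobr:
  assumes "x \<in> V"
  shows "comult_left scale V cobr (cobr x) + flip12 (comult_right scale V cobr (cobr x))
    - comult_right scale V cobr (cobr x) = 0"
proof (rule tensor3_eq_0I)
  note t = linear_cobr tensorial2_cobr tensorial2_cobr[OF assms]
  show "tensorial3 scale V (comult_left scale V cobr (cobr x) +
      flip12 (comult_right scale V cobr (cobr x)) - comult_right scale V cobr (cobr x))"
    using t by (intro tensorial3_diff tensorial3_add tensorial3_flip12
        tensorial3_comult_left[OF t] tensorial3_comult_right[OF t])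
  fix p q s assume V: "p \<in> V" "q \<in> V" "s \<in> V"
  have "flip12 (comult_right scale V cobr (cobr x)) (pair3 p q s) =
      comult_right scale V cobr (cobr x) (pair3 q p s)"
    by (simp add: flip12_def mult.commute)
  then show "(comult_left scale V cobr (cobr x) + flip12 (comult_right scale V cobr (cobr x)) -
      comult_right scale V cobr (cobr x)) (pair3 p q s) = 0"
    using assms V by (simp add: comult_left_pair comult_right_pair rho_leibniz[of p q s] \<omega>_linear)
qed

lemma \<omega>_acomm_acomm:
  assumes "p \<in> V" "q \<in> V" "x \<in> V" "y \<in> V"
  shows "\<omega> (acomm p x) (acomm q y) = 0"
  using assms by (subst \<omega>_acomm) (simp_all add: br_acomm_left)

text \<open>The second term of \<open>rho_alt\<close> has an anticommutator as left factor and
  vanishes; invariance rewrites the first.\<close>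

lemma rho_acomm_left:
  assumes "p \<in> V" "q \<in> V" "x \<in> V" "y \<in> V"
  shows "\<omega> (rho (acomm q y) p) x = - \<omega> (acomm p x) (Q (acomm q y))"
proof -
  have "\<omega> (rho (acomm q y) p) x = \<omega> (br (Q (acomm q y)) p) x"
    using assms by (simp add: rho_alt br_acomm_left)
  also have "\<dots> = - \<omega> p (br (Q (acomm q y)) x)"
    using assms by (simp add: \<omega>_br_left)
  also have "\<dots> = - \<omega> (acomm p x) (Q (acomm q y))"
    using assms by (subst \<omega>_acomm) simp_all
  finally show ?thesis .
qed

section \<open>Compatibility of the cobracket with the bracket\<close>

lemma compat_flip_cobr:
  assumes "x \<in> V" "y \<in> V"
  shows "flip (tensor_map scale V (rmult br y) id (cobr x)) =
    tensor_map scale V (rmult br x) id (cobr y)"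
proof (rule tensor2_eqI)
  show "tensorial2 scale V (flip (tensor_map scale V (rmult br y) id (cobr x)))"
    "tensorial2 scale V (tensor_map scale V (rmult br x) id (cobr y))"
    using assms by (simp_all add: tensorial2_flip tensorial2_tensor_map tensorial2_cobr linear_mult)
  fix p q assume V: "p \<in> V" "q \<in> V"
  have "flip (tensor_map scale V (rmult br y) id (cobr x)) (pair2 p q) =
      tensor_map scale V (rmult br y) id (cobr x) (pair2 q p)"
    by (simp add: flip_def mult.commute)
  also have "\<dots> = cobr x (pair2 (acomm q y) p)"
    using assms V by (intro tensor_map_pair tensorial2_cobr adjoint_rmult) auto
  also have "\<dots> = - \<omega> (acomm p x) (Q (acomm q y))"
    using assms V by (simp add: cobr_pair rho_acomm_left)
  \<comment> \<open>Since P and Q are adjoint and sum to the identity, the two sides differ by the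
    pairing of two anticommutators, which is 0.\<close>
  also have "\<dots> = - \<omega> (acomm q y) (Q (acomm p x))"
  proof -
    let ?s = "acomm p x" and ?t = "acomm q y"
    have "\<omega> ?s (Q ?t) = - \<omega> (Q ?t) ?s" using assms V by (intro skew) auto
    also have "\<omega> (Q ?t) ?s = \<omega> ?t (P ?s)" using assms V by (intro \<omega>_Q_left) auto
    also have "\<dots> = \<omega> ?t ?s - \<omega> ?t (Q ?s)"
      using split[of ?s] \<omega>_add(2)[of "P ?s" "Q ?s" ?t] assms V by simp
    finally show ?thesis using \<omega>_acomm_acomm[of q p y x] assms V by simp
  qed
  also have "\<dots> = cobr y (pair2 (acomm p x) q)"
    using assms V by (simp add: cobr_pair rho_acomm_left)
  also have "\<dots> = tensor_map scale V (rmult br x) id (cobr y) (pair2 p q)"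
    using assms V by (intro tensor_map_pair[symmetric] tensorial2_cobr adjoint_rmult) auto
  finally show "flip (tensor_map scale V (rmult br y) id (cobr x)) (pair2 p q) =
    tensor_map scale V (rmult br x) id (cobr y) (pair2 p q)" .
qed

text \<open>Symmetrized \<open>rho\<close> is dual to the cobracket plus its flip. The mixed
  anticommutator \<open>acomm (Q p) (P q)\<close> cancels between the two terms.\<close>

lemma rho_sym:
  assumes "p \<in> V" "q \<in> V"
  shows "rho p q + rho q p = acomm (Q p) q - acomm p (P q)"
  using rho_alt[of p q] assms br_add(1)[of "P q" "Q q" "P p"] br_add(1)[of "P q" "Q q" "Q p"]
    br_add(2)[of "P p" "Q p" "P q"] br_add(2)[of "P p" "Q p" "Q q"]
    br_add(2)[of "P p" "Q p" q] br_add(2)[of "P q" "Q q" "P p"] br_add(2)[of "P q" "Q q" "Q p"]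
  by (simp add: rho_def split algebra_simps)

lemma \<omega>_acomm_left:
  assumes "a \<in> V" "b \<in> V" "x \<in> V"
  shows "\<omega> (acomm a b) x = \<omega> b (br x a)" "\<omega> (acomm a b) x = \<omega> a (br x b)"
  using \<omega>_acomm[of a x b] \<omega>_acomm[of b x a] assms by (simp_all add: add.commute)

lemma \<omega>_rho_sym:
  assumes "p \<in> V" "q \<in> V" "x \<in> V"
  shows "\<omega> (rho p q + rho q p) x = \<omega> q (br x (Q p)) - \<omega> (P q) (br x p)"
  using assms by (subst rho_sym) (simp_all only: \<omega>_diff br_in V_closed PQ_in_V \<omega>_acomm_left(1))

text \<open>This and \<open>rho_sym_br\<close> release y into the last slot of
  \<open>\<omega>\<close>, so that all terms of the compatibility condition can be compared as
  vectors paired with y.\<close>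

lemma rho_sym_acomm:
  assumes "p \<in> V" "q \<in> V" "x \<in> V" "y \<in> V"
  shows "\<omega> (rho p (acomm q y) + rho (acomm q y) p) x =
    \<omega> (br (Q (br x p)) q - br (br x (Q p)) q) y"
proof -
  have 1: "\<omega> (acomm q y) z = - \<omega> (br z q) y" if "z \<in> V" for z
    using \<omega>_acomm_left(1)[of q y z] skew[of y "br z q"] assms that by simp
  have "\<omega> (rho p (acomm q y) + rho (acomm q y) p) x =
      \<omega> (acomm q y) (br x (Q p)) - \<omega> (P (acomm q y)) (br x p)"
    using assms by (intro \<omega>_rho_sym) auto
  also have "\<omega> (P (acomm q y)) (br x p) = \<omega> (acomm q y) (Q (br x p))"
    using assms by (intro \<omega>_P_left) auto
  finally show ?thesis using assms by (simp only: 1 br_in PQ_in_V \<omega>_diff) simp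
qed

lemma rho_sym_br:
  assumes "p \<in> V" "q \<in> V" "x \<in> V" "y \<in> V"
  shows "\<omega> (rho q (br p y) + rho (br p y) q) x =
    \<omega> (br p (br x (Q q)) - br p (Q (br x q))) y"
proof -
  have 1: "\<omega> (br p y) z = \<omega> (br p z) y" if "z \<in> V" for z
    using \<omega>_br_left[of y p z] skew[of y "br p z"] assms that by simp
  have "\<omega> (rho q (br p y) + rho (br p y) q) x = \<omega> (br p y) (br x (Q q)) - \<omega> (P (br p y)) (br x q)"
    using assms by (intro \<omega>_rho_sym) auto
  also have "\<omega> (P (br p y)) (br x q) = \<omega> (br p y) (Q (br x q))"
    using assms by (intro \<omega>_P_left) auto
  finally show ?thesis using assms by (simp only: 1 br_in PQ_in_V \<omega>_diff)
qed

text \<open>Writing P as identity minus Q shows \<open>rho\<close> as the descendent bracket of Q,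
  with three products. The Leibniz identity applies to each; the four terms left over come from left
  multiplication by x not commuting with Q.\<close>

lemma rho_derivation:
  assumes "p \<in> V" "q \<in> V" "x \<in> V"
  shows "br x (rho p q) = br (br x (Q p)) q - br (Q (br x p)) q + br p (br x (Q q))
    - br p (Q (br x q)) + rho p (br x q) + rho (br x p) q"
proof -
  have br_P: "br y (P z) = br y z - br y (Q z)" "br (P z) y = br z y - br (Q z) y"
    if "y \<in> V" "z \<in> V" for y z
    using br_add(1)[of "P z" "Q z" y] br_add(2)[of "P z" "Q z" y] that by (simp_all add: split)
  have "rho p q = br (Q p) q - br p q + br p (Q q)"
    "rho p (br x q) = br (Q p) (br x q) - br p (br x q) + br p (Q (br x q))"
    "rho (br x p) q = br (Q (br x p)) q - br (br x p) q + br (br x p) (Q q)"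
    using assms by (simp_all add: rho_alt br_P)
  then show ?thesis
    using assms leibniz_id[of x "Q p" q] leibniz_id[of x p q] leibniz_id[of x p "Q q"]
    by (simp add: br_add br_diff)
qed

text \<open>Paired with p and q, the two terms in the symmetrized cobracket of x contribute exactly
  the four correction terms of \<open>rho_derivation\<close>, and the two terms in the cobracket of
  y contribute the derivation terms.\<close>

lemma compat_br_cobr:
  assumes "x \<in> V" "y \<in> V"
  shows "cobr (br x y) =
    tensor_map scale V id (rmult br y) (cobr x + flip (cobr x))
    - tensor_map scale V (lmult br y + rmult br y) id (cobr x + flip (cobr x))
    + (tensor_map scale V id (lmult br x) (cobr y) + tensor_map scale V (lmult br x) id (cobr y))"
    (is "_ = ?R - ?L + (?l2 + ?l1)")
proof (rule tensor2_eqI)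
  let ?S = "cobr x + flip (cobr x)"
  have S: "tensorial2 scale V ?S"
    using assms by (intro tensorial2_add tensorial2_flip tensorial2_cobr)
  show "tensorial2 scale V (cobr (br x y))" using assms by (intro tensorial2_cobr) auto
  show "tensorial2 scale V (?R - ?L + (?l2 + ?l1))"
    using assms by (intro tensorial2_add tensorial2_diff tensorial2_tensor_map tensorial2_flip
        tensorial2_cobr linear_mult)
  fix p q assume V: "p \<in> V" "q \<in> V"
  have S_pair: "?S (pair2 a b) = \<omega> (rho a b + rho b a) x" if "a \<in> V" "b \<in> V" for a b
  proof -
    have "flip (cobr x) (pair2 a b) = cobr x (pair2 b a)" by (simp add: flip_def mult.commute)
    then show ?thesis using assms that by (simp add: cobr_pair \<omega>_add)
  qed
  have "?R (pair2 p q) = ?S (pair2 p (acomm q y))"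
    using assms V S by (intro tensor_map_pair adjoint_rmult) auto
  then have R: "?R (pair2 p q) = \<omega> (br (Q (br x p)) q - br (br x (Q p)) q) y"
    using assms V by (simp only: S_pair rho_sym_acomm V_closed br_in)
  have "?L (pair2 p q) = ?S (pair2 (br p y) q)"
    using assms V S by (intro tensor_map_pair adjoint_both) auto
  also have "\<dots> = \<omega> (rho q (br p y) + rho (br p y) q) x"
    using assms V by (simp only: S_pair br_in) (simp add: add.commute)
  finally have L: "?L (pair2 p q) = \<omega> (br p (br x (Q q)) - br p (Q (br x q))) y"
    using assms V by (simp only: rho_sym_br)
  have "?l2 (pair2 p q) = cobr y (pair2 p (- br x q))" "?l1 (pair2 p q) = cobr y (pair2 (- br x p) q)"
    using assms V by (intro tensor_map_pair tensorial2_cobr adjoint_lmult; simp)+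
  then have l: "?l2 (pair2 p q) = - \<omega> (rho p (br x q)) y" "?l1 (pair2 p q) = - \<omega> (rho (br x p) q) y"
    using assms V by (simp_all add: cobr_pair rho_minus \<omega>_linear)
  have "cobr (br x y) (pair2 p q) = - \<omega> (br x (rho p q)) y"
    using assms V by (simp add: cobr_pair \<omega>_br_left)
  then show "cobr (br x y) (pair2 p q) = (?R - ?L + (?l2 + ?l1)) (pair2 p q)"
    using assms V by (simp add: R L l rho_derivation \<omega>_linear)
qed

lemma leibniz_algebra: "leibniz_algebra scale V br"
  by (intro leibniz_algebra.intro leibniz_algebra_axioms.intro findim bilinear_br leibniz_id)

section \<open>The classical Leibniz Yang-Baxter equation\<close>

lemma bilinear_double_sum:
  assumes \<beta>: "bilinear_form scale V \<beta>"
    and ab: "\<And>i. i \<in> J \<Longrightarrow> a i \<in> V" "\<And>j. j \<in> J' \<Longrightarrow> b j \<in> V"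
  shows "(\<Sum>i\<in>J. \<Sum>j\<in>J'. c i * d j * \<beta> (a i) (b j)) =
    \<beta> (\<Sum>i\<in>J. scale (c i) (a i)) (\<Sum>j\<in>J'. scale (d j) (b j))"
proof -
  have lin: "linear_on scale V (*) UNIV (\<lambda>x. \<beta> x y)" "linear_on scale V (*) UNIV (\<beta> y)"
    if "y \<in> V" for y
    using \<beta> that unfolding bilinear_on_def by auto
  let ?y = "\<Sum>j\<in>J'. scale (d j) (b j)"
  have y: "?y \<in> V" using ab by simp
  have "\<beta> (\<Sum>i\<in>J. scale (c i) (a i)) ?y = (\<Sum>i\<in>J. c i * \<beta> (a i) ?y)"
    using ab by (subst linear_formD(6)[OF lin(1)[OF y]]) (simp_all add: linear_formD(5)[OF lin(1)[OF y]])
  also have "\<dots> = (\<Sum>i\<in>J. c i * (\<Sum>j\<in>J'. d j * \<beta> (a i) (b j)))"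
  proof (intro sum.cong refl arg_cong2[of _ _ _ _ "(*)"])
    fix i assume "i \<in> J"
    then have ai: "a i \<in> V" by (rule ab)
    show "\<beta> (a i) ?y = (\<Sum>j\<in>J'. d j * \<beta> (a i) (b j))"
      using ab by (subst linear_formD(6)[OF lin(2)[OF ai]])
        (simp_all add: linear_formD(5)[OF lin(2)[OF ai]])
  qed
  finally show ?thesis by (simp add: sum_distrib_left mult.assoc)
qed

text \<open>\<open>P_expand\<close> and \<open>Q_expand\<close> collapse the three double sums. With
  c the anticommutator of \<open>Q p\<close> and \<open>P s\<close>, isotropy and the subalgebra
  property turn the outer two terms into \<open>\<omega> c (P q)\<close> and
  \<open>\<omega> c (Q q)\<close>, while the middle one is \<open>\<omega> q c\<close>; skewness
  makes the total 0.\<close>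

lemma yang_baxter_r: "yang_baxter scale V br r = 0"
proof (rule tensor3_eq_0I)
  let ?T = "\<lambda>i j. triple_tensor scale V (br (e i) (e j)) (e' i) (e' j)
      - triple_tensor scale V (e i) (br (e' i) (e j) + br (e j) (e' i)) (e' j)
      + triple_tensor scale V (e i) (e j) (br (e' j) (e' i))"
  have eq: "yang_baxter scale V br r = (\<Sum>i\<in>I. \<Sum>j\<in>I. ?T i j)"
    by (rule yang_baxter_sum[OF leibniz_algebra e_in e'_in r_def])
  show "tensorial3 scale V (yang_baxter scale V br r)"
    unfolding eq using e_in e'_in
    by (intro tensorial3_sum tensorial3_add tensorial3_diff tensorial3_triple_tensor) auto
  fix p q s assume V: "p \<in> V" "q \<in> V" "s \<in> V"
  have bil: "bilinear_form scale V (\<lambda>x y. \<omega> a (br x y))"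
    "bilinear_form scale V (\<lambda>x y. \<omega> a (acomm x y))"
    "bilinear_form scale V (\<lambda>x y. \<omega> a (br y x))" if "a \<in> V" for a
    using that unfolding bilinear_on_def linear_on_def
    by (simp_all add: br_linear \<omega>_linear algebra_simps)
  have 1: "(\<Sum>i\<in>I. \<Sum>j\<in>I. \<omega> q (e' i) * \<omega> s (e' j) * \<omega> p (br (e i) (e j))) =
      \<omega> p (br (- P q) (- P s))"
    using bilinear_double_sum[OF bil(1), of p I e I e] V e_in by (simp add: P_expand)
  have 2: "(\<Sum>i\<in>I. \<Sum>j\<in>I. \<omega> p (e i) * \<omega> s (e' j) * \<omega> q (acomm (e' i) (e j))) =
      \<omega> q (acomm (Q p) (- P s))"
    using bilinear_double_sum[OF bil(2), of q I e' I e] V e_in e'_in by (simp add: P_expand Q_expand)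
  have 3: "(\<Sum>i\<in>I. \<Sum>j\<in>I. \<omega> p (e i) * \<omega> q (e j) * \<omega> s (br (e' j) (e' i))) =
      \<omega> s (br (Q q) (Q p))"
    using bilinear_double_sum[OF bil(3), of s I e' I e'] V e'_in by (simp add: Q_expand)
  have trip: "triple_tensor scale V x y z (pair3 p q s) = \<omega> p x * \<omega> q y * \<omega> s z" for x y z
    using V by (simp add: triple_tensor_def trilinear_pair3)
  have "yang_baxter scale V br r (pair3 p q s) =
      (\<Sum>i\<in>I. \<Sum>j\<in>I. \<omega> q (e' i) * \<omega> s (e' j) * \<omega> p (br (e i) (e j))
        - \<omega> p (e i) * \<omega> s (e' j) * \<omega> q (acomm (e' i) (e j))
        + \<omega> p (e i) * \<omega> q (e j) * \<omega> s (br (e' j) (e' i)))"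
    unfolding eq sum_fun_apply
    by (intro sum.cong refl) (simp add: trip; simp add: mult_ac)
  also have "\<dots> = \<omega> p (br (- P q) (- P s)) - \<omega> q (acomm (Q p) (- P s)) + \<omega> s (br (Q q) (Q p))"
    by (simp only: sum.distrib sum_subtractf 1 2 3)
  also have "\<dots> = \<omega> p (br (P q) (P s)) + \<omega> q (acomm (Q p) (P s)) + \<omega> s (br (Q q) (Q p))"
    using V by (simp add: br_minus \<omega>_linear)
  also have "\<omega> p (br (P q) (P s)) = \<omega> (acomm (Q p) (P s)) (P q)"
  proof -
    have "\<omega> (P p) (br (P q) (P s)) = 0" using V by (intro isotropic subalgebra P_in_A)
    then have "\<omega> p (br (P q) (P s)) = \<omega> (Q p) (br (P q) (P s))"
      using \<omega>_add(1)[of "P p" "Q p" "br (P q) (P s)"] V by (simp add: split)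
    then show ?thesis using V by (simp only: \<omega>_acomm PQ_in_V)
  qed
  also have "\<omega> s (br (Q q) (Q p)) = \<omega> (acomm (Q p) (P s)) (Q q)"
  proof -
    have "\<omega> (Q s) (br (Q q) (Q p)) = 0" using V by (intro isotropic subalgebra Q_in_B)
    then have "\<omega> s (br (Q q) (Q p)) = \<omega> (P s) (br (Q q) (Q p))"
      using \<omega>_add(1)[of "P s" "Q s" "br (Q q) (Q p)"] V by (simp add: split)
    also have "\<dots> = \<omega> (acomm (P s) (Q p)) (Q q)" using V by (simp only: \<omega>_acomm PQ_in_V)
    finally show ?thesis by (simp add: add.commute)
  qed
  finally show "yang_baxter scale V br r (pair3 p q s) = 0"
    using V \<omega>_add(2)[of "P q" "Q q" "acomm (Q p) (P s)"] skew[of q "acomm (Q p) (P s)"]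
    by (simp add: split)
qed

section \<open>The skew part of r and factorizability\<close>

lemma tensorial2_skew_r: "tensorial2 scale V (r - flip r)"
  by (intro tensorial2_diff tensorial2_flip tensorial2_r)

text \<open>r contributes \<open>\<omega> q (Q p)\<close> and its flip, by adjointness,
  \<open>- \<omega> q (P p)\<close>; the two projections recombine to p.\<close>

lemma skew_r_pair:
  assumes "p \<in> V" "q \<in> V"
  shows "(r - flip r) (pair2 p q) = \<omega> q p"
proof -
  have "flip r (pair2 p q) = r (pair2 q p)" by (simp add: flip_def mult.commute)
  then have "(r - flip r) (pair2 p q) = \<omega> q (Q p) - \<omega> p (Q q)"
    using assms by (simp add: r_pair)
  also have "\<omega> p (Q q) = - \<omega> q (P p)"
    using assms skew[of "P p" q] by (simp add: \<omega>_P_left)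
  finally show ?thesis
    using assms \<omega>_add(2)[of "P p" "Q p" q] by (simp add: split)
qed

text \<open>As the skew part of r represents \<open>\<omega>\<close> itself, annihilation by F is
  the invariance axiom of the form.\<close>

lemma invariant_skew_r:
  assumes "x \<in> V"
  shows "F_op scale V br x (r - flip r) = 0"
proof (rule tensor2_eqI)
  show "tensorial2 scale V (F_op scale V br x (r - flip r))"
    using assms by (intro tensorial2_F_op tensorial2_skew_r)
  show "tensorial2 scale V 0" by (rule tensorial2_0)
  fix p q assume V: "p \<in> V" "q \<in> V"
  then have "F_op scale V br x (r - flip r) (pair2 p q) = \<omega> q (br p x) - \<omega> (acomm q x) p"
    using assms by (simp only: F_op_pair tensorial2_skew_r skew_r_pair br_in V_closed)
  then show "F_op scale V br x (r - flip r) (pair2 p q) = 0 (pair2 p q)"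
    using assms V by (simp only: \<omega>_acomm) simp
qed

lemma dual_eq_\<omega>:
  assumes "a \<in> dual_space scale V"
  shows "\<exists>p\<in>V. \<forall>x\<in>V. a x = \<omega> p x"
proof
  \<comment> \<open>Expand the functional in the coordinate functionals
    \<open>\<omega> (g k)\<close> and collect the vectors \<open>g k\<close>.\<close>
  let ?p = "\<Sum>k\<in>I <+> I. scale (a (case_sum e e' k)) (g k)"
  show p: "?p \<in> V" using g_in by simp
  show "\<forall>x\<in>V. a x = \<omega> ?p x"
  proof
    fix x assume x: "x \<in> V"
    have "a x = (\<Sum>k\<in>I <+> I. \<omega> (g k) x * a (case_sum e e' k))"
      using dual_spaceD(1)[OF assms] x by (rule form_expand)
    also have "\<dots> = \<omega> ?p x"
      using x g_in by (subst linear_formD(6)[OF linear_\<omega>(2)[OF x]]) (simp_all add: \<omega>_scale mult.commute)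
    finally show "a x = \<omega> ?p x" .
  qed
qed

text \<open>Pairing the skew part of r with \<open>\<omega> p\<close> and \<open>\<omega> q\<close>
  gives \<open>\<omega> q p\<close>, that is, evaluation at p. So the map attached to it inverts the
  passage from p to the functional \<open>\<omega> p\<close>.\<close>

lemma skew_r_to_map:
  assumes "a \<in> dual_space scale V" "p \<in> V" "\<And>x. x \<in> V \<Longrightarrow> a x = \<omega> p x"
  shows "tensor_to_map scale V (r - flip r) a = p"
proof -
  have "tensor_pairing (r - flip r) a b = b p" if b: "b \<in> dual_space scale V" for b
  proof -
    obtain q where q: "q \<in> V" "\<And>x. x \<in> V \<Longrightarrow> b x = \<omega> q x" using dual_eq_\<omega>[OF b] by blast
    have "tensor_pairing (r - flip r) a b = (r - flip r) (pair2 p q)"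
      unfolding tensor_pairing_def
      by (rule tensorial2D(4)[OF tensorial2_skew_r]) (simp add: assms q)
    then show ?thesis using assms q by (simp only: skew_r_pair)
  qed
  then have "tensor_to_map scale V (r - flip r) a = of_bidual scale V (to_bidual scale V p)"
    unfolding tensor_to_map_def to_bidual_def by (intro arg_cong[of _ _ "of_bidual scale V"]) auto
  then show ?thesis using assms of_bidual_to_bidual by simp
qed

theorem factorizable: "factorizable_leibniz_bialgebra scale V br r"
proof -
  interpret L: leibniz_algebra scale V br by (rule leibniz_algebra)
  interpret dual: carrier_space fun_scale "dual_space scale V" by (rule carrier_space_dual)
  let ?T = "tensor_to_map scale V (r - flip r)"
  \<comment> \<open>The value at a functional is its representing vector; linearity and bijectivity
    below use only this characterization.\<close>
  have T: "?T a \<in> V \<and> (\<forall>x\<in>V. a x = \<omega> (?T a) x)" if "a \<in> dual_space scale V" for a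
    using dual_eq_\<omega>[OF that] skew_r_to_map[OF that] by metis
  show ?thesis
  proof unfold_locales
    show "linear_on scale V fun_scale (tensor_square scale V) cobr" by (rule linear_cobr)
    show "r \<in> tensor_square scale V" using tensorial2_r by (rule tensorial2_in_tensor_square)
    show "linear_on fun_scale (dual_space scale V) scale V ?T"
      unfolding linear_on_def
    proof (intro conjI ballI allI)
      fix a b c assume a: "a \<in> dual_space scale V" and b: "b \<in> dual_space scale V"
      show "?T a \<in> V" using T[OF a] by simp
      show "?T (a + b) = ?T a + ?T b"
        using a b T[OF a] T[OF b] by (intro skew_r_to_map) (simp_all add: \<omega>_add)
      show "?T (fun_scale c a) = scale c (?T a)"
        using a T[OF a] by (intro skew_r_to_map dual.V_closed(5)) (simp_all add: \<omega>_scale fun_scale_def)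
    qed
    show "bij_betw ?T (dual_space scale V) V"
      unfolding bij_betw_def
    proof (intro conjI inj_onI equalityI subsetI)
      fix a b assume "a \<in> dual_space scale V" "b \<in> dual_space scale V" "?T a = ?T b"
      then show "a = b" using T[of a] T[of b] by (intro dual_space_eqI) auto
    next
      fix p assume p: "p \<in> V"
      have a: "(\<lambda>x. if x \<in> V then \<omega> p x else 0) \<in> dual_space scale V"
        by (rule restrict_in_dual_space[OF linear_\<omega>(1)[OF p]])
      have "p = ?T (\<lambda>x. if x \<in> V then \<omega> p x else 0)"
        by (rule skew_r_to_map[OF a p, symmetric]) simp
      then show "p \<in> ?T ` dual_space scale V" using a by (rule image_eqI)
    next
      fix p assume "p \<in> ?T ` dual_space scale V"
      then show "p \<in> V" by (elim imageE) (simp add: T)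
    qed
  qed (fact coleibniz_cobr compat_flip_cobr compat_br_cobr yang_baxter_r invariant_skew_r)+
qed

end

section \<open>The double of a Leibniz bialgebra\<close>

text \<open>Biorthogonality concerns the finitely many \<open>e j\<close>; linearity carries it over
  their span and yields the \<open>expand\<close> condition of \<open>coordinates\<close>.\<close>

lemma expand_in_basis:
  fixes s :: "'k::field \<Rightarrow> 'a::ab_group_add \<Rightarrow> 'a"
  assumes "vector_space s" and x: "x \<in> module.span s (e ` I)" and I: "finite I"
    and \<phi>: "\<And>i. i \<in> I \<Longrightarrow> linear_on s (module.span s (e ` I)) (*) UNIV (\<phi> i)"
    and dual: "\<And>i j. i \<in> I \<Longrightarrow> j \<in> I \<Longrightarrow> \<phi> i (e j) = (if i = j then 1 else 0)"
  shows "(\<Sum>i\<in>I. s (\<phi> i x) (e i)) = x"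
proof -
  interpret vector_space s by fact
  interpret carrier_space s "span (e ` I)"
    by unfold_locales (rule subspace_span)
  have "x \<in> span (e ` I) \<and> (\<Sum>i\<in>I. s (\<phi> i x) (e i)) = x"
    using x
  proof (induction rule: span_induct_alt)
    case base
    show ?case by (simp add: linear_formD(1)[OF \<phi>])
  next
    case (step c v y)
    then obtain j where j: "j \<in> I" "v = e j" by auto
    have v: "v \<in> span (e ` I)" using step by (simp add: span_base)
    have "(\<Sum>i\<in>I. s (\<phi> i (s c v + y)) (e i)) = (\<Sum>i\<in>I. s (c * \<phi> i v) (e i) + s (\<phi> i y) (e i))"
    proof (rule sum.cong[OF refl])
      fix i assume "i \<in> I"
      from \<phi>[OF this] show "s (\<phi> i (s c v + y)) (e i) = s (c * \<phi> i v) (e i) + s (\<phi> i y) (e i)"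
        using v step by (simp add: linear_formD(2,5) scale_left_distrib)
    qed
    also have "\<dots> = (\<Sum>i\<in>I. if i = j then s c (e i) else 0) + y"
      unfolding sum.distrib using step j dual by (intro arg_cong2[of _ _ _ _ "(+)"] sum.cong) auto
    also have "\<dots> = s c v + y" using I j by simp
    finally show ?case using v step by simp
  qed
  then show ?thesis by simp
qed

lemma dual_space_separates:
  assumes "coordinates s V I f \<phi>" "x \<in> V" "y \<in> V" "\<And>c. c \<in> dual_space s V \<Longrightarrow> c x = c y"
  shows "x = y"
proof -
  interpret coordinates s V I f \<phi> by fact
  have "\<phi> k x = \<phi> k y" if "k \<in> I" for k
    using assms(4)[OF restrict_in_dual_space[OF linear_coord[OF that]]] assms(2,3) by simp
  then have "(\<Sum>k\<in>I. s (\<phi> k x) (f k)) = (\<Sum>k\<in>I. s (\<phi> k y) (f k))" by simp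
  then show ?thesis unfolding expand[OF assms(2)] expand[OF assms(3)] .
qed

lemma fun_scale_apply: "fun_scale c f x = c * f x"
  by (simp add: fun_scale_def)

locale bialgebra_basis = leibniz_bialgebra scale V br \<Delta> + coordinates scale V I e e'
  for scale :: "'k::field \<Rightarrow> 'a::ab_group_add \<Rightarrow> 'a" and V br \<Delta>
    and I :: "'i set" and e :: "'i \<Rightarrow> 'a" and e' :: "'i \<Rightarrow> 'a \<Rightarrow> 'k" +
  assumes e'_in_dual: "i \<in> I \<Longrightarrow> e' i \<in> dual_space scale V"
begin

abbreviation dual :: "('a \<Rightarrow> 'k) set"
  where "dual \<equiv> dual_space scale V"

abbreviation dbr :: "('a \<Rightarrow> 'k) \<Rightarrow> ('a \<Rightarrow> 'k) \<Rightarrow> 'a \<Rightarrow> 'k"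
  where "dbr \<equiv> dual_bracket V \<Delta>"

text \<open>Composing a functional with an operator leaves the normalized dual, since the result
  need not be 0 outside V. The cut-off restores membership, and tensors do not notice it
  (\<open>dbr_res\<close>).\<close>

abbreviation res :: "('a \<Rightarrow> 'k) \<Rightarrow> 'a \<Rightarrow> 'k"
  where "res h \<equiv> \<lambda>x. if x \<in> V then h x else 0"

sublocale dual: carrier_space fun_scale dual
  by (rule carrier_space_dual)

lemma separate: "x \<in> V \<Longrightarrow> y \<in> V \<Longrightarrow> (\<And>c. c \<in> dual \<Longrightarrow> c x = c y) \<Longrightarrow> x = y"
  using coordinates_axioms by (rule dual_space_separates)

lemma br_in_V [simp]: "x \<in> V \<Longrightarrow> y \<in> V \<Longrightarrow> br x y \<in> V"
  using bilinear_br unfolding bilinear_on_def linear_on_def by blast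

lemma br_bilinear:
  "x \<in> V \<Longrightarrow> y \<in> V \<Longrightarrow> z \<in> V \<Longrightarrow> br (x + y) z = br x z + br y z"
  "x \<in> V \<Longrightarrow> y \<in> V \<Longrightarrow> z \<in> V \<Longrightarrow> br z (x + y) = br z x + br z y"
  "x \<in> V \<Longrightarrow> y \<in> V \<Longrightarrow> br (scale c x) y = scale c (br x y)"
  "x \<in> V \<Longrightarrow> y \<in> V \<Longrightarrow> br x (scale c y) = scale c (br x y)"
  using bilinear_br unfolding bilinear_on_def linear_on_def by blast+

lemma linear_br: "x \<in> V \<Longrightarrow> linear_on scale V scale V (lmult br x)"
  "x \<in> V \<Longrightarrow> linear_on scale V scale V (rmult br x)"
  using bilinear_br unfolding bilinear_on_def lmult_def rmult_def by auto

lemma linear_lrmult: "x \<in> V \<Longrightarrow> linear_on scale V scale V (lmult br x + rmult br x)"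
  using linear_br[of x] unfolding linear_on_def by (auto simp: scale_right_distrib)

lemma linear_dual:
  assumes "a \<in> dual"
  shows "x \<in> V \<Longrightarrow> y \<in> V \<Longrightarrow> a (x + y) = a x + a y" "x \<in> V \<Longrightarrow> a (scale c x) = c * a x"
    "a 0 = 0" "x \<in> V \<Longrightarrow> y \<in> V \<Longrightarrow> a (x - y) = a x - a y" "x \<in> V \<Longrightarrow> a (- x) = - a x"
  using linear_formD[OF dual_spaceD(1)[OF assms]] by auto

lemma linear_compose:
  "a \<in> dual \<Longrightarrow> linear_on scale V scale V f \<Longrightarrow> linear_on scale V (*) UNIV (\<lambda>x. a (f x))"
  unfolding linear_on_def by (simp add: linear_dual)

lemma res_in_dual: "linear_on scale V (*) UNIV h \<Longrightarrow> res h \<in> dual"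
  by (rule restrict_in_dual_space)

lemma res_compose_in_dual:
  assumes "a \<in> dual" "linear_on scale V scale V f"
  shows "res (\<lambda>x. a (f x)) \<in> dual"
  using assms by (intro res_in_dual linear_compose)

lemma res_mult_in_dual:
  assumes "a \<in> dual" "x \<in> V"
  shows "res (\<lambda>z. a (br x z)) \<in> dual" "res (\<lambda>z. a (br z x)) \<in> dual"
    "res (\<lambda>z. a (br x z + br z x)) \<in> dual"
proof -
  note compose = res_compose_in_dual[OF assms(1)]
  show "res (\<lambda>z. a (br x z)) \<in> dual"
    using compose[OF linear_br(1)[OF assms(2)]] unfolding lmult_def .
  show "res (\<lambda>z. a (br z x)) \<in> dual"
    using compose[OF linear_br(2)[OF assms(2)]] unfolding rmult_def .
  show "res (\<lambda>z. a (br x z + br z x)) \<in> dual"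
    using compose[OF linear_lrmult[OF assms(2)]] unfolding lmult_def rmult_def plus_fun_def .
qed

section \<open>The Leibniz algebra on the dual space\<close>

lemma tensorial2_\<Delta>: "x \<in> V \<Longrightarrow> tensorial2 scale V (\<Delta> x)"
  using linear_comult unfolding linear_on_def by (intro tensorial2_tensor_square) auto

lemma bilinear_dual: "a \<in> dual \<Longrightarrow> b \<in> dual \<Longrightarrow> bilinear_form scale V (\<lambda>x y. a x * b y)"
  by (intro bilinear_form_mult dual_spaceD)

lemma dbr_apply: "x \<in> V \<Longrightarrow> dbr a b x = \<Delta> x (\<lambda>u v. a u * b v)"
  by (simp add: dual_bracket_def tensor_pairing_def)

lemma dbr_in_dual [simp]:
  assumes "a \<in> dual" "b \<in> dual"
  shows "dbr a b \<in> dual"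
  unfolding dual_bracket_def tensor_pairing_def
  using comult_formD[OF linear_comult] by (intro res_in_dual) (simp add: linear_on_def)

lemma dbr_bilinear:
  assumes "a \<in> dual" "b \<in> dual" "c \<in> dual"
  shows "dbr (a + b) c = dbr a c + dbr b c" "dbr c (a + b) = dbr c a + dbr c b"
    "dbr (fun_scale k a) b = fun_scale k (dbr a b)" "dbr a (fun_scale k b) = fun_scale k (dbr a b)"
proof -
  show "dbr (a + b) c = dbr a c + dbr b c" "dbr c (a + b) = dbr c a + dbr c b"
    using tensorial2D(2)[OF tensorial2_\<Delta> bilinear_dual[OF assms(1,3)] bilinear_dual[OF assms(2,3)]]
      tensorial2D(2)[OF tensorial2_\<Delta> bilinear_dual[OF assms(3,1)] bilinear_dual[OF assms(3,2)]]
    by (auto simp: fun_eq_iff dual_bracket_def tensor_pairing_def algebra_simps)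
  show "dbr (fun_scale k a) b = fun_scale k (dbr a b)" "dbr a (fun_scale k b) = fun_scale k (dbr a b)"
    using tensorial2D(3)[OF tensorial2_\<Delta> bilinear_dual[OF assms(1,2)], of _ k]
    by (auto simp: fun_eq_iff dual_bracket_def tensor_pairing_def fun_scale_def mult_ac)
qed

lemma dbr_zero [simp]: "a \<in> dual \<Longrightarrow> dbr 0 a = 0" "a \<in> dual \<Longrightarrow> dbr a 0 = 0"
  using dbr_bilinear(3)[of 0 a 0 0] dbr_bilinear(4)[of a 0 0 0]
  by simp_all

lemma dbr_minus: "a \<in> dual \<Longrightarrow> b \<in> dual \<Longrightarrow> dbr (- a) b = - dbr a b"
  "a \<in> dual \<Longrightarrow> b \<in> dual \<Longrightarrow> dbr a (- b) = - dbr a b"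
  using dbr_bilinear(3)[of a b a "-1"] dbr_bilinear(4)[of a b a "-1"]
  by (simp_all add: fun_scale.scale_minus_left)

lemma dbr_res:
  assumes "x \<in> V"
  shows "dbr (res h) (res h') x = \<Delta> x (\<lambda>u v. h u * h' v)"
    "dbr (res h) b x = \<Delta> x (\<lambda>u v. h u * b v)" "dbr b (res h) x = \<Delta> x (\<lambda>u v. b u * h v)"
  unfolding dbr_apply[OF assms]
  by (rule tensorial2D(4)[OF tensorial2_\<Delta>[OF assms]]; simp)+

lemma trilinear_dual:
  "a \<in> dual \<Longrightarrow> b \<in> dual \<Longrightarrow> c \<in> dual \<Longrightarrow> trilinear_form scale V (\<lambda>x y z. a x * b y * c z)"
  by (intro trilinear_form_mult dual_spaceD)

lemma \<Delta>_scale: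
  assumes "x \<in> V" "a \<in> dual" "b \<in> dual"
  shows "\<Delta> x (\<lambda>u v. k * (a u * b v)) = k * dbr a b x"
  using tensorial2D(3)[OF tensorial2_\<Delta>[OF assms(1)] bilinear_dual[OF assms(2,3)]] assms(1)
  by (simp add: dbr_apply)

lemma comult_right_dual:
  assumes "x \<in> V" "a \<in> dual" "b \<in> dual" "c \<in> dual"
  shows "comult_right scale V \<Delta> (\<Delta> x) (\<lambda>x y z. a x * b y * c z) = dbr a (dbr b c) x"
proof -
  have "\<Delta> x (\<lambda>u v. \<Delta> v (\<lambda>y z. a u * b y * c z)) = \<Delta> x (\<lambda>u v. a u * dbr b c v)"
    by (rule tensorial2D(4)[OF tensorial2_\<Delta>[OF assms(1)]])
      (simp only: mult.assoc \<Delta>_scale assms)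
  then show ?thesis
    using assms by (simp add: comult_right_def trilinear_dual dbr_apply)
qed

lemma comult_left_dual:
  assumes "x \<in> V" "a \<in> dual" "b \<in> dual" "c \<in> dual"
  shows "comult_left scale V \<Delta> (\<Delta> x) (\<lambda>x y z. a x * b y * c z) = dbr (dbr a b) c x"
proof -
  have "\<Delta> x (\<lambda>u v. \<Delta> u (\<lambda>x y. a x * b y * c v)) = \<Delta> x (\<lambda>u v. dbr a b u * c v)"
    by (rule tensorial2D(4)[OF tensorial2_\<Delta>[OF assms(1)]])
      (simp only: mult.commute[of _ "c _"] \<Delta>_scale assms)
  then show ?thesis
    using assms by (simp add: comult_left_def trilinear_dual dbr_apply)
qed

text \<open>The coalgebra axiom is evaluated on the product of a, b and c: the iterated
  comultiplications become nested brackets, and \<open>flip12\<close> exchanges a and b.\<close>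

lemma dbr_leibniz:
  assumes "a \<in> dual" "b \<in> dual" "c \<in> dual"
  shows "dbr a (dbr b c) = dbr (dbr a b) c + dbr b (dbr a c)"
proof (rule dual_space_eqI)
  show "dbr a (dbr b c) \<in> dual" "dbr (dbr a b) c + dbr b (dbr a c) \<in> dual" using assms by auto
  fix x assume x: "x \<in> V"
  have "flip12 (comult_right scale V \<Delta> (\<Delta> x)) (\<lambda>x y z. a x * b y * c z) =
      comult_right scale V \<Delta> (\<Delta> x) (\<lambda>x y z. b x * a y * c z)"
    by (simp add: flip12_def mult.commute)
  then show "dbr a (dbr b c) x = (dbr (dbr a b) c + dbr b (dbr a c)) x"
    using fun_cong[OF coleibniz[OF x], of "\<lambda>x y z. a x * b y * c z"] x assms
    by (simp add: comult_left_dual comult_right_dual)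
qed

text \<open>\<open>of_bidual\<close> inverts evaluation only on linear functionals of the dual, so
  closure and linearity of \<open>f a\<close> must be known before the defining pairing can be
  used.\<close>

lemma dual_rep':
  assumes f: "\<And>c. c \<in> dual \<Longrightarrow> f a c \<in> dual"
    "\<And>c c'. c \<in> dual \<Longrightarrow> c' \<in> dual \<Longrightarrow> f a (c + c') = f a c + f a c'"
    "\<And>c k. c \<in> dual \<Longrightarrow> f a (fun_scale k c) = fun_scale k (f a c)"
    and x: "x \<in> V"
  shows "dual_rep' scale V f a x \<in> V"
    and "c \<in> dual \<Longrightarrow> c (dual_rep' scale V f a x) = - f a c x"
proof -
  let ?\<Phi> = "dual_rep dual f a (to_bidual scale V x)"
  have \<Phi>: "?\<Phi> c = (if c \<in> dual then - f a c x else 0)" for c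
    using f(1) by (simp add: dual_rep_def to_bidual_def)
  have "linear_on fun_scale dual (*) UNIV ?\<Phi>"
    unfolding linear_on_def by (simp add: \<Phi> f fun_scale_apply)
  from bidual_surj[OF this] show "dual_rep' scale V f a x \<in> V"
    "c \<in> dual \<Longrightarrow> c (dual_rep' scale V f a x) = - f a c x"
    unfolding dual_rep'_def by (simp_all add: \<Phi>)
qed

lemma dual_rep'_mult:
  assumes "a \<in> dual" "x \<in> V"
  shows "dual_rep' scale V (lmult dbr) a x \<in> V" "dual_rep' scale V (rmult dbr) a x \<in> V"
    and "c \<in> dual \<Longrightarrow> c (dual_rep' scale V (lmult dbr) a x) = - dbr a c x"
    and "c \<in> dual \<Longrightarrow> c (dual_rep' scale V (rmult dbr) a x) = - dbr c a x"
  using dual_rep'(1)[of "lmult dbr" a x] dual_rep'(1)[of "rmult dbr" a x]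
    dual_rep'(2)[of "lmult dbr" a x c] dual_rep'(2)[of "rmult dbr" a x c] assms
  by (simp_all add: lmult_def rmult_def dbr_bilinear)

section \<open>The double and its invariant form\<close>

abbreviation D :: "('a \<times> ('a \<Rightarrow> 'k)) set"
  where "D \<equiv> double_space scale V"

abbreviation S :: "'k \<Rightarrow> 'a \<times> ('a \<Rightarrow> 'k) \<Rightarrow> 'a \<times> ('a \<Rightarrow> 'k)"
  where "S \<equiv> double_scale scale"

abbreviation Dbr :: "'a \<times> ('a \<Rightarrow> 'k) \<Rightarrow> 'a \<times> ('a \<Rightarrow> 'k) \<Rightarrow> 'a \<times> ('a \<Rightarrow> 'k)"
  where "Dbr \<equiv> double_bracket scale V br \<Delta>"

definition \<omega> :: "'a \<times> ('a \<Rightarrow> 'k) \<Rightarrow> 'a \<times> ('a \<Rightarrow> 'k) \<Rightarrow> 'k"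
  where "\<omega> u v = snd u (fst v) - snd v (fst u)"

sublocale prod: vector_space_prod scale "fun_scale :: 'k \<Rightarrow> ('a \<Rightarrow> 'k) \<Rightarrow> _"
  by unfold_locales

lemma S_def: "S c u = (scale c (fst u), fun_scale c (snd u))"
  by (simp add: double_scale_def prod.scale_def)

lemma in_D: "u \<in> D \<longleftrightarrow> fst u \<in> V \<and> snd u \<in> dual"
  by (simp add: double_space_def mem_Times_iff)

lemma in_D_snd: "u \<in> D \<Longrightarrow> snd u \<in> dual" by (simp add: in_D)
lemma in_D_fst: "u \<in> D \<Longrightarrow> fst u \<in> V" by (simp add: in_D)

lemma carrier_space_double: "carrier_space S D"
  unfolding carrier_space_def carrier_space_axioms_def double_scale_def double_space_def
  using prod.p.vector_space_axioms prod.subspace_Times subspace_V dual.subspace_V by blast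

lemma Dbr_in_D:
  assumes "u \<in> D" "v \<in> D"
  shows "Dbr u v \<in> D"
proof -
  have rep: "dual_rep V f x a \<in> dual" if "linear_on scale V scale V (f x)" "a \<in> dual" for f x a
  proof -
    have "res (\<lambda>w. (- a) (f x w)) \<in> dual"
      by (intro res_compose_in_dual dual.V_closed(4) that)
    then show ?thesis by (simp only: dual_rep_def fun_Compl_def)
  qed
  show ?thesis
    using assms unfolding in_D double_bracket_def
    by (auto simp: Let_def dual_rep'_mult rep linear_br split: prod.splits)
qed

lemma Dbr_fst_in_V: "u \<in> D \<Longrightarrow> v \<in> D \<Longrightarrow> fst (Dbr u v) \<in> V"
  by (intro in_D_fst Dbr_in_D)

text \<open>The component in V is defined through the bidual and is therefore described by its
  values under functionals c. The signs of the coadjoint terms are reversed by the minus in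
  \<open>dual_rep\<close>.\<close>

lemma Dbr_fst:
  assumes "u \<in> D" "v \<in> D" "c \<in> dual"
  shows "c (fst (Dbr u v)) = c (br (fst u) (fst v)) - dbr (snd u) c (fst v)
    + dbr (snd v) c (fst u) + dbr c (snd v) (fst u)"
  using assms unfolding in_D double_bracket_def
  by (auto simp: Let_def dual_rep'_mult linear_dual split: prod.splits)

lemma Dbr_snd:
  assumes "u \<in> D" "v \<in> D" "z \<in> V"
  shows "snd (Dbr u v) z = dbr (snd u) (snd v) z - snd v (br (fst u) z)
    + snd u (br (fst v) z) + snd u (br z (fst v))"
  using assms unfolding in_D double_bracket_def
  by (auto simp: Let_def dual_rep_def lmult_def rmult_def split: prod.splits)

lemma D_eqI:
  assumes "u \<in> D" "v \<in> D" "\<And>c. c \<in> dual \<Longrightarrow> c (fst u) = c (fst v)"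
    "\<And>x. x \<in> V \<Longrightarrow> snd u x = snd v x"
  shows "u = v"
  using separate[of "fst u" "fst v"] dual_space_eqI[of "snd u" "snd v"] assms
  by (intro prod_eqI) (auto simp: in_D)

lemma bilinear_Dbr: "bilinear_on S D S D Dbr"
proof -
  interpret C: carrier_space S D by (rule carrier_space_double)
  have 1: "Dbr (u + v) w = Dbr u w + Dbr v w" "Dbr w (u + v) = Dbr w u + Dbr w v"
    if "u \<in> D" "v \<in> D" "w \<in> D" for u v w
    using that in_D_fst[of u] in_D_fst[of v] in_D_fst[of w] in_D_snd[of u] in_D_snd[of v] in_D_snd[of w]
    by (auto intro!: D_eqI Dbr_in_D C.V_closed
        simp: Dbr_fst Dbr_snd Dbr_fst_in_V br_bilinear dbr_bilinear linear_dual algebra_simps)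
  have 2: "Dbr (S k u) w = S k (Dbr u w)" "Dbr w (S k u) = S k (Dbr w u)"
    if "u \<in> D" "w \<in> D" for u w k
    using that in_D_fst[of u] in_D_fst[of w] in_D_snd[of u] in_D_snd[of w]
      in_D_fst[OF Dbr_in_D[of u w]] in_D_fst[OF Dbr_in_D[of w u]] C.V_closed(5)[of u k]
      C.V_closed(5)[of "Dbr u w" k] C.V_closed(5)[of "Dbr w u" k]
    by (auto intro!: D_eqI Dbr_in_D C.V_closed
        simp: Dbr_fst Dbr_snd S_def br_bilinear dbr_bilinear linear_dual fun_scale_apply algebra_simps)
  show ?thesis
    unfolding bilinear_on_def linear_on_def by (simp add: 1 2 Dbr_in_D)
qed

lemma invariant_form_double: "invariant_form S D Dbr \<omega>"
proof -
  interpret C: carrier_space S D by (rule carrier_space_double)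
  show ?thesis
  proof
    show "bilinear_on S D S D Dbr" by (rule bilinear_Dbr)
    show "bilinear_form S D \<omega>"
      unfolding bilinear_on_def linear_on_def \<omega>_def S_def
      by (auto simp: in_D linear_dual fun_scale_apply algebra_simps)
    show "\<omega> u v = - \<omega> v u" if "u \<in> D" "v \<in> D" for u v by (simp add: \<omega>_def)
    show "u = 0" if u: "u \<in> D" and 0: "\<And>v. v \<in> D \<Longrightarrow> \<omega> u v = 0" for u
    proof (rule D_eqI[OF u])
      show "0 \<in> D" by simp
      show "snd u x = snd 0 x" if "x \<in> V" for x
        using 0[of "(x, 0)"] that u by (simp add: \<omega>_def in_D)
      show "c (fst u) = c (fst 0)" if "c \<in> dual" for c
        using 0[of "(0, c)"] that u by (simp add: \<omega>_def in_D linear_dual)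
    qed
    show "\<omega> u (Dbr v w) = \<omega> (Dbr u w + Dbr w u) v" if "u \<in> D" "v \<in> D" "w \<in> D" for u v w
      using that in_D_fst[of u] in_D_fst[of v] in_D_fst[of w] in_D_snd[of u] in_D_snd[of v] in_D_snd[of w]
        in_D_fst[OF Dbr_in_D[of u w]] in_D_fst[OF Dbr_in_D[of w u]]
      by (simp add: \<omega>_def Dbr_fst Dbr_snd linear_dual)
  qed
qed

definition P :: "'a \<times> ('a \<Rightarrow> 'k) \<Rightarrow> 'a \<times> ('a \<Rightarrow> 'k)" where "P u = (fst u, 0)"
definition Q :: "'a \<times> ('a \<Rightarrow> 'k) \<Rightarrow> 'a \<times> ('a \<Rightarrow> 'k)" where "Q u = (0, snd u)"

lemma embed_in_D: "x \<in> V \<Longrightarrow> (x, 0) \<in> D" "a \<in> dual \<Longrightarrow> (0, a) \<in> D"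
  by (simp_all add: in_D)

lemma br_zero [simp]: "x \<in> V \<Longrightarrow> br 0 x = 0" "x \<in> V \<Longrightarrow> br x 0 = 0"
  using br_bilinear(3)[of 0 x 0] br_bilinear(4)[of x 0 0] by simp_all

lemma Dbr_V: "x \<in> V \<Longrightarrow> y \<in> V \<Longrightarrow> Dbr (x, 0) (y, 0) = (br x y, 0)"
  by (intro D_eqI Dbr_in_D embed_in_D) (simp_all add: Dbr_fst Dbr_snd embed_in_D)

lemma Dbr_dual: "a \<in> dual \<Longrightarrow> b \<in> dual \<Longrightarrow> Dbr (0, a) (0, b) = (0, dbr a b)"
  by (intro D_eqI Dbr_in_D embed_in_D) (simp_all add: Dbr_fst Dbr_snd embed_in_D linear_dual)

lemma lagrangian_splitting_double: "lagrangian_splitting S D Dbr \<omega> (V \<times> {0}) ({0} \<times> dual) P Q"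
proof -
  interpret F: invariant_form S D Dbr \<omega> by (rule invariant_form_double)
  show ?thesis
    by unfold_locales
      (auto simp: P_def Q_def in_D embed_in_D Dbr_V Dbr_dual \<omega>_def linear_dual)
qed

section \<open>Mixed Leibniz identities from the compatibility conditions\<close>

lemma tensor_map_dual:
  "a \<in> dual \<Longrightarrow> b \<in> dual \<Longrightarrow>
    tensor_map scale V f g t (\<lambda>x y. a x * b y) = t (\<lambda>x y. a (f x) * b (g y))"
  by (simp add: tensor_map_def bilinear_dual)

lemma flip_dual:
  fixes t :: "('k, 'a) tensor2"
  shows "flip t (\<lambda>x y. a x * b y) = t (\<lambda>x y. b x * a y)"
  by (simp only: flip_def mult.commute[of "b _"])

lemma compat_flip_dual:
  assumes "x \<in> V" "y \<in> V" "a \<in> dual" "b \<in> dual"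
  shows "dbr (res (\<lambda>z. b (br z y))) a x = dbr (res (\<lambda>z. a (br z x))) b y"
  using fun_cong[OF compat_flip[OF assms(1,2)], of "\<lambda>x y. a x * b y"] assms
  by (simp add: tensor_map_dual flip_dual dbr_res rmult_def)

lemma compat_br_dual:
  assumes "x \<in> V" "y \<in> V" "a \<in> dual" "b \<in> dual"
  defines "b' \<equiv> res (\<lambda>z. b (br z y))" and "a' \<equiv> res (\<lambda>z. a (br y z + br z y))"
  shows "dbr a b (br x y) = dbr a b' x + dbr b' a x - (dbr a' b x + dbr b a' x)
    + (dbr a (res (\<lambda>z. b (br x z))) y + dbr (res (\<lambda>z. a (br x z))) b y)"
  using fun_cong[OF compat_br[OF assms(1,2)], of "\<lambda>x y. a x * b y"] assms(1-4)
  by (simp add: tensor_map_dual flip_dual dbr_res dbr_apply rmult_def lmult_def a'_def b'_def)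

text \<open>The ABBA input of \<open>leib_eq_0I\<close>, as pairing with \<open>(y, 0)\<close> reads
  off minus the second component at y. Written out, the terms are those of the bracket compatibility
  tested on a and b.\<close>

lemma leibniz_mixed:
  assumes "x \<in> V" "y \<in> V" "a \<in> dual" "b \<in> dual"
  shows "snd (Dbr (x, 0) (Dbr (0, a) (0, b)) - Dbr (Dbr (x, 0) (0, a)) (0, b)
    - Dbr (0, a) (Dbr (x, 0) (0, b))) y = 0"
proof -
  let ?b' = "res (\<lambda>z. b (br z y))" and ?a' = "res (\<lambda>z. a (br y z + br z y))"
  let ?xa = "Dbr (x, 0) (0, a)" and ?xb = "Dbr (x, 0) (0, b)"
  note D = embed_in_D(1)[OF assms(1)] embed_in_D(2)[OF assms(3)] embed_in_D(2)[OF assms(4)]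
  have xa: "?xa \<in> D" and xb: "?xb \<in> D" using D Dbr_in_D by auto
  have b': "?b' \<in> dual" and a': "?a' \<in> dual"
    and res_x: "res (\<lambda>z. a (br x z)) \<in> dual" "res (\<lambda>z. b (br x z)) \<in> dual"
    by (intro res_mult_in_dual assms)+
  have snd_x: "snd (Dbr (x, 0) (0, c)) = - res (\<lambda>z. c (br x z))"
    if c: "c \<in> dual" "res (\<lambda>z. c (br x z)) \<in> dual" for c
  proof (rule dual_space_eqI)
    show "snd (Dbr (x, 0) (0, c)) \<in> dual" using c assms by (intro in_D_snd Dbr_in_D embed_in_D)
    show "- res (\<lambda>z. c (br x z)) \<in> dual" using c by (intro dual.V_closed)
    show "snd (Dbr (x, 0) (0, c)) z = (- res (\<lambda>z. c (br x z))) z" if "z \<in> V" for z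
      using c that assms by (simp add: Dbr_snd embed_in_D fun_Compl_def)
  qed
  have snd_xa: "snd ?xa = - res (\<lambda>z. a (br x z))" and snd_xb: "snd ?xb = - res (\<lambda>z. b (br x z))"
    using snd_x assms res_x by auto
  have "snd (Dbr (x, 0) (Dbr (0, a) (0, b))) y = - dbr a b (br x y)"
    using assms D by (simp add: Dbr_dual Dbr_snd embed_in_D)
  moreover have "snd (Dbr ?xa (0, b)) y =
      - dbr (res (\<lambda>z. a (br x z))) b y - (dbr a ?b' x + dbr ?b' a x)"
  proof -
    \<comment> \<open>\<open>fst ?xa\<close> is accessible only through functionals, so the bracket
      with y is absorbed into the functional \<open>?b'\<close>.\<close>
    have "b (br (fst ?xa) y) = ?b' (fst ?xa)" using in_D_fst[OF xa] by simp
    also have "\<dots> = dbr a ?b' x + dbr ?b' a x"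
      using Dbr_fst[OF D(1,2) b'] in_D_fst[OF xa] b' assms by (simp add: linear_dual)
    finally show ?thesis
      using xa D assms res_x by (simp add: Dbr_snd snd_xa dbr_minus linear_dual)
  qed
  moreover have "snd (Dbr (0, a) ?xb) y =
      - dbr a (res (\<lambda>z. b (br x z))) y + (dbr b ?a' x + dbr ?a' b x)"
  proof -
    have "a (br (fst ?xb) y) + a (br y (fst ?xb)) = ?a' (fst ?xb)"
      using in_D_fst[OF xb] assms by (simp add: linear_dual)
    also have "\<dots> = dbr b ?a' x + dbr ?a' b x"
      using Dbr_fst[OF D(1,3) a'] in_D_fst[OF xb] a' assms by (simp add: linear_dual)
    finally show ?thesis
      using xb D assms res_x by (simp add: Dbr_snd snd_xb dbr_minus linear_dual)
  qed
  ultimately show ?thesis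
    using compat_br_dual[OF assms] by simp
qed

text \<open>In an anticommutator of a vector with a functional most coadjoint terms cancel, leaving
  one right multiplication and one dual bracket. The two halves of \<open>\<omega>\<close> are then
  the two sides of the flip compatibility.\<close>

lemma \<omega>_acomm_mixed:
  assumes "x \<in> V" "y \<in> V" "a \<in> dual" "b \<in> dual"
  shows "\<omega> (Dbr (0, a) (x, 0) + Dbr (x, 0) (0, a)) (Dbr (y, 0) (0, b) + Dbr (0, b) (y, 0)) = 0"
proof -
  note D = embed_in_D(1)[OF assms(1)] embed_in_D(1)[OF assms(2)]
    embed_in_D(2)[OF assms(3)] embed_in_D(2)[OF assms(4)]
  have snd_acomm: "snd (Dbr (0, c) (z, 0) + Dbr (z, 0) (0, c)) w = c (br w z)"
    if "z \<in> V" "w \<in> V" "c \<in> dual" for z w c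
    using that by (simp add: Dbr_snd embed_in_D linear_dual)
  have fst_acomm: "c' (fst (Dbr (0, c) (z, 0) + Dbr (z, 0) (0, c))) = dbr c' c z"
    if "z \<in> V" "c \<in> dual" "c' \<in> dual" for z c c'
    using that by (simp add: Dbr_fst Dbr_fst_in_V embed_in_D linear_dual)
  let ?ax = "Dbr (0, a) (x, 0) + Dbr (x, 0) (0, a)" and ?by = "Dbr (0, b) (y, 0) + Dbr (y, 0) (0, b)"
  have in_V: "fst ?ax \<in> V" "fst ?by \<in> V" using D by (simp_all add: Dbr_fst_in_V)
  have res: "res (\<lambda>z. a (br z x)) \<in> dual" "res (\<lambda>z. b (br z y)) \<in> dual"
    by (intro res_mult_in_dual assms)+
  have "snd ?ax (fst ?by) = res (\<lambda>z. a (br z x)) (fst ?by)"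
    using snd_acomm[of x "fst ?by" a] in_V assms by simp
  also have "\<dots> = dbr (res (\<lambda>z. a (br z x))) b y"
    using assms res by (intro fst_acomm)
  also have "\<dots> = dbr (res (\<lambda>z. b (br z y))) a x"
    using compat_flip_dual[OF assms] by simp
  also have "\<dots> = res (\<lambda>z. b (br z y)) (fst ?ax)"
    using assms res by (intro fst_acomm[symmetric])
  also have "\<dots> = snd ?by (fst ?ax)"
    using snd_acomm[of y "fst ?ax" b] in_V assms by simp
  finally show ?thesis by (simp only: \<omega>_def add.commute[of "Dbr (y, 0) (0, b)"]) simp
qed

lemma manin_triple_double:
  "manin_triple S D Dbr \<omega> (V \<times> {0}) ({0} \<times> dual) P Q I (\<lambda>i. (e i, 0)) (\<lambda>i. (0, e' i))"
proof -
  interpret L: lagrangian_splitting S D Dbr \<omega> "V \<times> {0}" "{0} \<times> dual" P Q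
    by (rule lagrangian_splitting_double)
  show ?thesis
  proof unfold_locales
    show "L.subspace (V \<times> {0})" "L.subspace ({0} \<times> dual)"
      using subspace_V dual.subspace_V
      unfolding L.subspace_def subspace_def fun_scale.subspace_def
      by (auto simp: S_def zero_prod_def)
    show "finite I" by (rule finite_I)
    show "(e i, 0) \<in> D" "(0, e' i) \<in> D" if "i \<in> I" for i
      using that f_in e'_in_dual by (auto intro: embed_in_D)
    show "(\<Sum>i\<in>I. S (\<omega> u (e i, 0)) (0, e' i)) = Q u" if u: "u \<in> D" for u
    proof -
      \<comment> \<open>Pairing with \<open>(e i, 0)\<close> evaluates the dual component at
        \<open>e i\<close>, so \<open>Q_expand\<close> is the expansion of a functional in the dual
        basis.\<close>
      have "(\<Sum>i\<in>I. fun_scale (snd u (e i)) (e' i)) = snd u"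
      proof (rule dual_space_eqI)
        show "(\<Sum>i\<in>I. fun_scale (snd u (e i)) (e' i)) \<in> dual" "snd u \<in> dual"
          using e'_in_dual in_D_snd[OF u] by auto
        show "(\<Sum>i\<in>I. fun_scale (snd u (e i)) (e' i)) x = snd u x" if "x \<in> V" for x
          using form_expand[OF dual_spaceD(1)[OF in_D_snd[OF u]] that]
          by (simp add: sum_fun_apply fun_scale_apply mult.commute)
      qed
      then show ?thesis
        by (simp add: S_def \<omega>_def Q_def prod_eq_iff fst_sum snd_sum)
    qed
    show "L.leibniz_defect u v w = 0" if "u \<in> D" "v \<in> D" "w \<in> D" for u v w
    proof (rule L.leib_eq_0I[OF _ _ _ _ that])
      show "\<forall>x\<in>V \<times> {0}. \<forall>y\<in>V \<times> {0}. \<forall>z\<in>V \<times> {0}. L.leibniz_defect x y z = 0"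
      proof safe
        fix x y z assume "x \<in> V" "y \<in> V" "z \<in> V"
        with leibniz[of x y z] show "L.leibniz_defect (x, 0) (y, 0) (z, 0) = 0"
          by (simp add: L.leibniz_defect_def Dbr_V zero_prod_def)
      qed
      show "\<forall>a\<in>{0} \<times> dual. \<forall>b\<in>{0} \<times> dual. \<forall>c\<in>{0} \<times> dual. L.leibniz_defect a b c = 0"
      proof safe
        fix a b c assume "a \<in> dual" "b \<in> dual" "c \<in> dual"
        with dbr_leibniz[of a b c] show "L.leibniz_defect (0, a) (0, b) (0, c) = 0"
          by (simp add: L.leibniz_defect_def Dbr_dual zero_prod_def)
      qed
      fix x y a b assume "x \<in> V \<times> {0 :: 'a \<Rightarrow> 'k}" "y \<in> V \<times> {0 :: 'a \<Rightarrow> 'k}"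
        "a \<in> {0 :: 'a} \<times> dual" "b \<in> {0 :: 'a} \<times> dual"
      then obtain x' y' a' b' where eq: "x = (x', 0)" "y = (y', 0)" "a = (0, a')" "b = (0, b')"
        and in_V: "x' \<in> V" "y' \<in> V" "a' \<in> dual" "b' \<in> dual" by auto
      show "\<omega> y (L.leibniz_defect x a b) = 0"
        using leibniz_mixed[OF in_V] by (simp add: eq \<omega>_def L.leibniz_defect_def)
      show "\<omega> (L.acomm a x) (L.acomm y b) = 0"
        using \<omega>_acomm_mixed[OF in_V] by (simp add: eq)
    qed
  qed
qed

end

theorem theorem3p6:
  fixes scale :: "'k::{alg_closed_field, field_char_0} \<Rightarrow> 'a::ab_group_add \<Rightarrow> 'a"
    and A :: "'a set"
    and br :: "'a \<Rightarrow> 'a \<Rightarrow> 'a"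
    and \<Delta> :: "'a \<Rightarrow> ('k, 'a) tensor2"
    and n :: nat
    and e :: "nat \<Rightarrow> 'a"
    and e' :: "nat \<Rightarrow> ('a \<Rightarrow> 'k)"
    and r :: "('k, 'a \<times> ('a \<Rightarrow> 'k)) tensor2"
  assumes bialgebra: "leibniz_bialgebra scale A br \<Delta>"
    and basis: "inj_on e {1..n}" "\<not> module.dependent scale (e ` {1..n})"
      "module.span scale (e ` {1..n}) = A"
    and dual_basis: "\<And>i. i \<in> {1..n} \<Longrightarrow> e' i \<in> dual_space scale A"
      "\<And>i j. \<lbrakk>i \<in> {1..n}; j \<in> {1..n}\<rbrakk> \<Longrightarrow> e' i (e j) = (if i = j then 1 else 0)"
    and r: "r = (\<Sum>i = 1..n. tensor (double_scale scale) (double_space scale A) (e i, 0) (0, e' i))"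
  shows "factorizable_leibniz_bialgebra (double_scale scale) (double_space scale A)
    (double_bracket scale A br \<Delta>) r"
proof -
  interpret B: leibniz_bialgebra scale A br \<Delta> by (fact bialgebra)
  interpret V: carrier_space scale A
    by unfold_locales (use B.finitely_spanned B.subspace_span in auto)
  interpret B: bialgebra_basis scale A br \<Delta> "{1..n}" e e'
  proof unfold_locales
    show "e i \<in> A" if "i \<in> {1..n}" for i
      using that basis(3) B.span_base by blast
    show "linear_on scale A (*) UNIV (e' i)" if "i \<in> {1..n}" for i
      using V.dual_spaceD(1)[OF dual_basis(1)[OF that]] .
    show "(\<Sum>i = 1..n. scale (e' i x) (e i)) = x" if "x \<in> A" for x
      using that V.dual_spaceD(1)[OF dual_basis(1)] dual_basis(2)
      by (intro expand_in_basis[OF B.vector_space_axioms, where e = e and I = "{1..n}", unfolded basis(3)])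
        auto
  qed (use dual_basis in auto)
  interpret M: manin_triple "double_scale scale" "double_space scale A" "double_bracket scale A br \<Delta>"
    B.\<omega> "A \<times> {0}" "{0} \<times> dual_space scale A" B.P B.Q "{1..n}" "\<lambda>i. (e i, 0)" "\<lambda>i. (0, e' i)"
    by (rule B.manin_triple_double)
  show ?thesis using M.factorizable unfolding M.r_def r .
qed

end
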